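(* Let $(X,d,\mu,\mathcal E,\mathcal F)$ be a sub-Gaussian Dirichlet space with parameters $d_H,d_W$ that satisfies $wBE(\kappa)$ with $\kappa=d_W-\lambda_1^\#$. Assume $d_W-\kappa<d_H$ and define $1^*$ by $\frac1{1^*}=1-\frac{d_W-\kappa}{d_H}$. Then $BV(X)\subset L^{1^*}(X,\mu)$ and there is $C>0$ such that for every $f\in BV(X)$, $$\|f\|_{L^{1^*}(X,\mu)}\le C\,\mathbf{Var}(f).$$ In particular, there exists a constant $C>0$ such that for every set $E$ of finite perimeter, $$\mu(E)^{\frac{d_H-d_W+\kappa}{d_H}}\le C\,P(E).$$
   Context: A sub-Gaussian Dirichlet space $(X,d,\mu,\mathcal E,\mathcal F)$ with parameters $d_H,d_W$ means: $(X,d,\mu)$ is a locally compact metric measure space, $\mu$ is a Radon measure with support $X$, $(\mathcal E,\mathcal F)$ is a Dirichlet form on $L^2(X,\mu)$, and (i) every ball $B(x,r)=\{y: d(x,y)<r\}$, $x\in X$, $0<r<\infty$, has compact closure; (ii) $\mu$ is Ahlfors $d_H$-regular: there are $c_1,c_2,d_H\in(0,\infty)$ with $c_1r^{d_H}\le\mu(B(x,r))\le c_2r^{d_H}$ for all $x\in X$, $r\in[0,\infty)$; (iii) $\mathcal E$ is regular and strongly local (i.e. $\mathcal E(u,v)=0$ for $u,v\in\mathcal F$ with compact supports such that $u$ is constant in a neighborhood of the support of $v$); (iv) the heat semigroup $\{P_t\}$ of $(\mathcal E,\mathcal F)$ has a continuous heat kernel $p_t(x,y)$ (so $P_tg(x)=\int_Xp_t(x,y)g(y)\,d\mu(y)$)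 satisfying, for some $c_3,c_4,c_5,c_6\in(0,\infty)$ and $d_W\in(2,\infty)$, $$c_5t^{-d_H/d_W}\exp\Big(-c_6\Big(\tfrac{d(x,y)^{d_W}}{t}\Big)^{\frac1{d_W-1}}\Big)\le p_t(x,y)\le c_3t^{-d_H/d_W}\exp\Big(-c_4\Big(\tfrac{d(x,y)^{d_W}}{t}\Big)^{\frac1{d_W-1}}\Big)$$ for $\mu\times\mu$-a.e. $(x,y)$ and all $t>0$. In this setting $P_t1=1$. $X$ satisfies $wBE(\kappa)$ if $0<\kappa<d_W$ and there is $C>0$ such that $|P_tg(x)-P_tg(y)|\le C\frac{d(x,y)^\kappa}{t^{\kappa/d_W}}\|g\|_{L^\infty(X,\mu)}$ for all $t>0$, $g\in L^\infty(X,\mu)$, $x,y\in X$. Let $\Delta_r=\{(x,y)\in X\times X: d(x,y)<r\}$. For $\lambda>0$, $KS^{\lambda,1}(X)$ is the set of $f\in L^1(X,\mu)$ such that $\limsup_{r\to0^+}\iint_{\Delta_r}\frac{|f(y)-f(x)|}{r^\lambda\mu(B(x,r))}\,d\mu(y)\,d\mu(x)<\infty$. Set $\lambda_1^\#=\sup\{\lambda>0: KS^{\lambda,1}(X)\text{ contains non-constant functions}\}$, $BV(X)=KS^{\lambda_1^\#,1}(X)$, and for $f\in BV(X)$ $$\mathbf{Var}(f)=\liminf_{r\to0^+}\iint_{\Delta_r}\frac{|f(y)-f(x)|}{r^{\lambda_1^\#}\mu(B(x,r))}\,d\mu(y)\,d\mu(x).$$ A Borel set $E$ has finite perimeter if $\mathbf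 1_E\in BV(X)$; then $P(E)=\mathbf{Var}(\mathbf 1_E)$. *)

theory Defs
  imports "HOL-Analysis.Analysis" "HOL-Probability.Essential_Supremum"
begin

text \<open>
  The space \<open>X\<close> is the whole type \<open>'a :: metric_space\<close>, and elements of \<open>L\<^sup>p(X, \<mu>)\<close> are
  represented by real-valued Borel functions; two functions that agree almost everywhere
  represent the same element.
\<close>

section \<open>Lebesgue spaces\<close>

definition Lp_space :: "'a measure \<Rightarrow> real \<Rightarrow> ('a \<Rightarrow> real) set" where
  "Lp_space M q = {f \<in> borel_measurable M. integrable M (\<lambda>x. \<bar>f x\<bar> powr q)}"

definition Lp_norm :: "'a measure \<Rightarrow> real \<Rightarrow> ('a \<Rightarrow> real) \<Rightarrow> real" where
  "Lp_norm M q f = (\<integral>x. \<bar>f x\<bar> powr q \<partial>M) powr (1 / q)"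

definition L2_inner :: "'a measure \<Rightarrow> ('a \<Rightarrow> real) \<Rightarrow> ('a \<Rightarrow> real) \<Rightarrow> real" where
  "L2_inner M u v = (\<integral>x. u x * v x \<partial>M)"

definition Linf_space :: "'a measure \<Rightarrow> ('a \<Rightarrow> real) set" where
  "Linf_space M = {g \<in> borel_measurable M. esssup M (\<lambda>x. ennreal \<bar>g x\<bar>) < \<infinity>}"

definition Linf_norm :: "'a measure \<Rightarrow> ('a \<Rightarrow> real) \<Rightarrow> real" where
  "Linf_norm M g = enn2real (esssup M (\<lambda>x. ennreal \<bar>g x\<bar>))"


section \<open>Radon measures\<close>

definition Radon_measure :: "'a::topological_space measure \<Rightarrow> bool" where
  "Radon_measure M \<longleftrightarrow>
     sets M = sets borel \<and>
     (\<forall>K. compact K \<longrightarrow> emeasure M K < \<infinity>) \<and>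
     (\<forall>A\<in>sets borel. emeasure M A = (INF U\<in>{U. open U \<and> A \<subseteq> U}. emeasure M U)) \<and>
     (\<forall>U. open U \<longrightarrow> emeasure M U = (SUP K\<in>{K. compact K \<and> K \<subseteq> U}. emeasure M K))"

definition full_support :: "'a::topological_space measure \<Rightarrow> bool" where
  "full_support M \<longleftrightarrow> (\<forall>U. open U \<longrightarrow> U \<noteq> {} \<longrightarrow> emeasure M U > 0)"

definition Ahlfors_regular :: "'a::metric_space measure \<Rightarrow> real \<Rightarrow> bool" where
  "Ahlfors_regular M d_H \<longleftrightarrow> d_H > 0 \<and>
     (\<exists>c\<^sub>1>0. \<exists>c\<^sub>2>0. \<forall>x. \<forall>r\<ge>0.
        ennreal (c\<^sub>1 * r powr d_H) \<le> emeasure M (ball x r) \<and>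
        emeasure M (ball x r) \<le> ennreal (c\<^sub>2 * r powr d_H))"


section \<open>Dirichlet forms\<close>

definition energy1 ::
  "'a measure \<Rightarrow> (('a \<Rightarrow> real) \<Rightarrow> ('a \<Rightarrow> real) \<Rightarrow> real) \<Rightarrow> ('a \<Rightarrow> real) \<Rightarrow> real" where
  "energy1 M \<E> u = \<E> u u + L2_inner M u u"

text \<open>
  The assumptions \<open>domain_AE\<close> and \<open>form_AE\<close> express that the form and its domain live on
  equivalence classes modulo almost everywhere equality.
\<close>

locale Dirichlet_form =
  fixes M :: "'a measure"
    and \<E> :: "('a \<Rightarrow> real) \<Rightarrow> ('a \<Rightarrow> real) \<Rightarrow> real"
    and \<F> :: "('a \<Rightarrow> real) set"
  assumes domain_L2: "\<F> \<subseteq> Lp_space M 2"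
    and domain_AE: "\<And>u v. u \<in> \<F> \<Longrightarrow> v \<in> borel_measurable M \<Longrightarrow> (AE x in M. u x = v x) \<Longrightarrow> v \<in> \<F>"
    and form_AE: "\<And>u v w. u \<in> \<F> \<Longrightarrow> v \<in> \<F> \<Longrightarrow> w \<in> \<F> \<Longrightarrow> (AE x in M. u x = v x) \<Longrightarrow> \<E> u w = \<E> v w"
    and domain_zero: "(\<lambda>x. 0) \<in> \<F>"
    and domain_linear: "\<And>u v a b. u \<in> \<F> \<Longrightarrow> v \<in> \<F> \<Longrightarrow> (\<lambda>x. a * u x + b * v x) \<in> \<F>"
    and domain_dense: "\<And>u \<epsilon>. u \<in> Lp_space M 2 \<Longrightarrow> \<epsilon> > 0 \<Longrightarrow>
          \<exists>v\<in>\<F>. Lp_norm M 2 (\<lambda>x. u x - v x) < \<epsilon>"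
    and form_sym: "\<And>u v. u \<in> \<F> \<Longrightarrow> v \<in> \<F> \<Longrightarrow> \<E> u v = \<E> v u"
    and form_linear: "\<And>u v w a b. u \<in> \<F> \<Longrightarrow> v \<in> \<F> \<Longrightarrow> w \<in> \<F> \<Longrightarrow>
          \<E> (\<lambda>x. a * u x + b * v x) w = a * \<E> u w + b * \<E> v w"
    and form_nonneg: "\<And>u. u \<in> \<F> \<Longrightarrow> \<E> u u \<ge> 0"
    and form_closed: "\<And>u. (\<And>n. u n \<in> \<F>) \<Longrightarrow>
          (\<forall>\<epsilon>>0. \<exists>N::nat. \<forall>m\<ge>N. \<forall>n\<ge>N. energy1 M \<E> (\<lambda>x. u m x - u n x) < \<epsilon>) \<Longrightarrow>
          \<exists>v\<in>\<F>. (\<lambda>n. energy1 M \<E> (\<lambda>x. u n x - v x)) \<longlonglongrightarrow> 0"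
    and form_Markov: "\<And>u. u \<in> \<F> \<Longrightarrow>
          (\<lambda>x. min (max (u x) 0) 1) \<in> \<F> \<and>
          \<E> (\<lambda>x. min (max (u x) 0) 1) (\<lambda>x. min (max (u x) 0) 1) \<le> \<E> u u"

definition C_c :: "('a::topological_space \<Rightarrow> real) set" where
  "C_c = {u. continuous_on UNIV u \<and> compact (closure {x. u x \<noteq> 0})}"

definition regular_form ::
  "'a::topological_space measure \<Rightarrow> (('a \<Rightarrow> real) \<Rightarrow> ('a \<Rightarrow> real) \<Rightarrow> real) \<Rightarrow> ('a \<Rightarrow> real) set \<Rightarrow> bool"
where
  "regular_form M \<E> \<F> \<longleftrightarrow>
     (\<forall>\<phi>\<in>C_c. \<forall>\<epsilon>>0. \<exists>v\<in>\<F> \<inter> C_c. \<forall>x. \<bar>\<phi> x - v x\<bar> < \<epsilon>) \<and>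
     (\<forall>u\<in>\<F>. \<forall>\<epsilon>>0. \<exists>v\<in>\<F> \<inter> C_c. energy1 M \<E> (\<lambda>x. u x - v x) < \<epsilon>)"

text \<open>
  The support of an almost-everywhere class: the complement of the largest open set on which
  the function vanishes almost everywhere.
\<close>

definition ess_support :: "'a::topological_space measure \<Rightarrow> ('a \<Rightarrow> real) \<Rightarrow> 'a set" where
  "ess_support M u = - \<Union>{U. open U \<and> (AE x in M. x \<in> U \<longrightarrow> u x = 0)}"

definition strongly_local ::
  "'a::topological_space measure \<Rightarrow> (('a \<Rightarrow> real) \<Rightarrow> ('a \<Rightarrow> real) \<Rightarrow> real) \<Rightarrow> ('a \<Rightarrow> real) set \<Rightarrow> bool"
where
  "strongly_local M \<E> \<F> \<longleftrightarrow>
     (\<forall>u\<in>\<F>. \<forall>v\<in>\<F>. compact (ess_support M u) \<longrightarrow> compact (ess_support M v) \<longrightarrow>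
        (\<exists>U c. open U \<and> ess_support M v \<subseteq> U \<and> (AE x in M. x \<in> U \<longrightarrow> u x = c)) \<longrightarrow>
        \<E> u v = 0)"


section \<open>The heat semigroup and the heat kernel\<close>

definition L2_contraction_semigroup ::
  "'a measure \<Rightarrow> (real \<Rightarrow> ('a \<Rightarrow> real) \<Rightarrow> ('a \<Rightarrow> real)) \<Rightarrow> bool" where
  "L2_contraction_semigroup M P \<longleftrightarrow>
     (\<forall>t\<ge>0. \<forall>u\<in>Lp_space M 2. P t u \<in> Lp_space M 2 \<and> Lp_norm M 2 (P t u) \<le> Lp_norm M 2 u) \<and>
     (\<forall>t\<ge>0. \<forall>u\<in>Lp_space M 2. \<forall>v\<in>Lp_space M 2. \<forall>a b.
        AE x in M. P t (\<lambda>z. a * u z + b * v z) x = a * P t u x + b * P t v x) \<and>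
     (\<forall>u\<in>Lp_space M 2. AE x in M. P 0 u x = u x) \<and>
     (\<forall>s\<ge>0. \<forall>t\<ge>0. \<forall>u\<in>Lp_space M 2. AE x in M. P (s + t) u x = P s (P t u) x) \<and>
     (\<forall>u\<in>Lp_space M 2. ((\<lambda>t. Lp_norm M 2 (\<lambda>x. P t u x - u x)) \<longlongrightarrow> 0) (at_right 0))"

text \<open>
  Both generators are given as relations: \<open>w\<close> represents the value of the generator at \<open>u\<close>.
\<close>

definition semigroup_generator ::
  "'a measure \<Rightarrow> (real \<Rightarrow> ('a \<Rightarrow> real) \<Rightarrow> ('a \<Rightarrow> real)) \<Rightarrow> ('a \<Rightarrow> real) \<Rightarrow> ('a \<Rightarrow> real) \<Rightarrow> bool" where
  "semigroup_generator M P u w \<longleftrightarrow> u \<in> Lp_space M 2 \<and> w \<in> Lp_space M 2 \<and>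
     ((\<lambda>t. Lp_norm M 2 (\<lambda>x. (P t u x - u x) / t - w x)) \<longlongrightarrow> 0) (at_right 0)"

definition form_generator ::
  "'a measure \<Rightarrow> (('a \<Rightarrow> real) \<Rightarrow> ('a \<Rightarrow> real) \<Rightarrow> real) \<Rightarrow> ('a \<Rightarrow> real) set \<Rightarrow>
   ('a \<Rightarrow> real) \<Rightarrow> ('a \<Rightarrow> real) \<Rightarrow> bool" where
  "form_generator M \<E> \<F> u w \<longleftrightarrow> u \<in> \<F> \<and> w \<in> Lp_space M 2 \<and> (\<forall>v\<in>\<F>. \<E> u v = - L2_inner M w v)"

definition heat_semigroup ::
  "'a measure \<Rightarrow> (('a \<Rightarrow> real) \<Rightarrow> ('a \<Rightarrow> real) \<Rightarrow> real) \<Rightarrow> ('a \<Rightarrow> real) set \<Rightarrow>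
   (real \<Rightarrow> ('a \<Rightarrow> real) \<Rightarrow> ('a \<Rightarrow> real)) \<Rightarrow> bool" where
  "heat_semigroup M \<E> \<F> P \<longleftrightarrow> L2_contraction_semigroup M P \<and>
     (\<forall>u w. semigroup_generator M P u w \<longleftrightarrow> form_generator M \<E> \<F> u w)"

text \<open>The action of a kernel on a function, defined at every point \<open>x\<close>.\<close>

definition kernel_op ::
  "'a measure \<Rightarrow> (real \<Rightarrow> 'a \<Rightarrow> 'a \<Rightarrow> real) \<Rightarrow> real \<Rightarrow> ('a \<Rightarrow> real) \<Rightarrow> 'a \<Rightarrow> real" where
  "kernel_op M p t g x = (\<integral>y. p t x y * g y \<partial>M)"

definition heat_kernel ::
  "'a measure \<Rightarrow> (('a \<Rightarrow> real) \<Rightarrow> ('a \<Rightarrow> real) \<Rightarrow> real) \<Rightarrow> ('a \<Rightarrow> real) set \<Rightarrow>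
   (real \<Rightarrow> 'a \<Rightarrow> 'a \<Rightarrow> real) \<Rightarrow> bool" where
  "heat_kernel M \<E> \<F> p \<longleftrightarrow>
     (\<exists>P. heat_semigroup M \<E> \<F> P \<and>
        (\<forall>t>0. \<forall>g\<in>Lp_space M 2. AE x in M.
           integrable M (\<lambda>y. p t x y * g y) \<and> P t g x = kernel_op M p t g x))"


section \<open>Sub-Gaussian Dirichlet spaces\<close>

definition sub_Gaussian ::
  "real \<Rightarrow> real \<Rightarrow> real \<Rightarrow> real \<Rightarrow> 'a::metric_space \<Rightarrow> 'a \<Rightarrow> real" where
  "sub_Gaussian d_H d_W c t x y =
     t powr (- (d_H / d_W)) * exp (- c * (dist x y powr d_W / t) powr (1 / (d_W - 1)))"

locale sub_Gaussian_Dirichlet_space = Dirichlet_form M \<E> \<F>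
  for M :: "'a::metric_space measure"
    and \<E> :: "('a \<Rightarrow> real) \<Rightarrow> ('a \<Rightarrow> real) \<Rightarrow> real"
    and \<F> :: "('a \<Rightarrow> real) set" +
  fixes p :: "real \<Rightarrow> 'a \<Rightarrow> 'a \<Rightarrow> real"
    and d_H d_W :: real
  assumes locally_compact: "locally compact (UNIV :: 'a set)"
    and Radon: "Radon_measure M"
    and support: "full_support M"
    and compact_balls: "\<And>(x::'a) r. r > 0 \<Longrightarrow> compact (closure (ball x r))"
    and Ahlfors: "Ahlfors_regular M d_H"
    and regular: "regular_form M \<E> \<F>"
    and strong_locality: "strongly_local M \<E> \<F>"
    and heat_kernel: "heat_kernel M \<E> \<F> p"
    and kernel_continuous: "\<And>t. t > 0 \<Longrightarrow> continuous_on UNIV (\<lambda>(x, y). p t x y)"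
    and d_W_gt_2: "d_W > 2"
    and kernel_bounds:
      "\<exists>c\<^sub>3>0. \<exists>c\<^sub>4>0. \<exists>c\<^sub>5>0. \<exists>c\<^sub>6>0. AE (x, y) in M \<Otimes>\<^sub>M M. \<forall>t>0.
         c\<^sub>5 * sub_Gaussian d_H d_W c\<^sub>6 t x y \<le> p t x y \<and>
         p t x y \<le> c\<^sub>3 * sub_Gaussian d_H d_W c\<^sub>4 t x y"

definition wBE ::
  "'a::metric_space measure \<Rightarrow> (real \<Rightarrow> 'a \<Rightarrow> 'a \<Rightarrow> real) \<Rightarrow> real \<Rightarrow> real \<Rightarrow> bool" where
  "wBE M p d_W \<kappa> \<longleftrightarrow> 0 < \<kappa> \<and> \<kappa> < d_W \<and>
     (\<exists>C>0. \<forall>t>0. \<forall>g\<in>Linf_space M. \<forall>x y.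
        \<bar>kernel_op M p t g x - kernel_op M p t g y\<bar>
          \<le> C * (dist x y powr \<kappa> / t powr (\<kappa> / d_W)) * Linf_norm M g)"


section \<open>Korevaar--Schoen classes, BV functions and perimeter\<close>

definition Delta :: "real \<Rightarrow> ('a::metric_space \<times> 'a) set" where
  "Delta r = {(x, y). dist x y < r}"

definition KS_energy :: "'a::metric_space measure \<Rightarrow> real \<Rightarrow> ('a \<Rightarrow> real) \<Rightarrow> real \<Rightarrow> ennreal" where
  "KS_energy M lam f r =
     (\<integral>\<^sup>+ x. (\<integral>\<^sup>+ y. ennreal (\<bar>f y - f x\<bar> / (r powr lam * measure M (ball x r))) *
        indicator (Delta r) (x, y) \<partial>M) \<partial>M)"

definition KS :: "'a::metric_space measure \<Rightarrow> real \<Rightarrow> ('a \<Rightarrow> real) set" where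
  "KS M lam = {f \<in> Lp_space M 1. Limsup (at_right 0) (KS_energy M lam f) < \<infinity>}"

text \<open>
  The critical exponent is an extended real: the supremum is \<open>-\<infinity>\<close> if no exponent is
  admissible and \<open>\<infinity>\<close> if the admissible exponents are unbounded. A function is non-constant if it
  is not almost everywhere equal to a constant.
\<close>

definition lambda1_sharp :: "'a::metric_space measure \<Rightarrow> ereal" where
  "lambda1_sharp M =
     Sup {ereal lam | lam. lam > 0 \<and> (\<exists>f\<in>KS M lam. \<not> (\<exists>c. AE x in M. f x = c))}"

text \<open>
  The coercion below is meaningful only for a finite critical exponent.
\<close>

definition BV :: "'a::metric_space measure \<Rightarrow> ('a \<Rightarrow> real) set" where
  "BV M = KS M (real_of_ereal (lambda1_sharp M))"

definition Var :: "'a::metric_space measure \<Rightarrow> ('a \<Rightarrow> real) \<Rightarrow> ennreal" where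
  "Var M f = Liminf (at_right 0) (KS_energy M (real_of_ereal (lambda1_sharp M)) f)"

definition finite_perimeter :: "'a::metric_space measure \<Rightarrow> 'a set \<Rightarrow> bool" where
  "finite_perimeter M A \<longleftrightarrow> A \<in> sets borel \<and> indicator A \<in> BV M"

definition perimeter :: "'a::metric_space measure \<Rightarrow> 'a set \<Rightarrow> ennreal" where
  "perimeter M A = Var M (indicator A)"

end

theory Submission
  imports Defs
begin

text \<open>
  Put \<open>\<lambda> = d_W - \<kappa>\<close>. For a set \<open>A\<close> of finite measure, telescoping the semigroup in steps \<open>\<tau>\<close> and using
  the symmetry and conservativeness of the kernel, the loss of heat \<open>\<integral>\<^sub>A (1 - P\<^sub>t 1\<^sub>A)\<close> is at most a multiple of
  \<open>t\<^bsup>\<lambda>/d_W\<^esup>\<close> times \<open>m(A) = liminf \<tau>\<^bsup>-1\<^esup> \<integral>\<integral> p\<^sub>\<tau>(x, y) d(x, y)\<^bsup>\<kappa>\<^esup> \<bar>1\<^sub>A(x) - 1\<^sub>A(y)\<bar>\<close>, by the weak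
  Bakry-Emery estimate. For \<open>t\<close> of order \<open>\<mu>(A)\<^bsup>d_W/d_H\<^esup>\<close> at least half of the heat is lost, which gives the
  isoperimetric inequality \<open>\<mu>(A)\<^bsup>1 - \<lambda>/d_H\<^esup> \<le> C m(A)\<close>; for \<open>t = R\<^bsup>d_W\<^esup>\<close> the lower kernel bound gives that the
  Korevaar-Schoen energy of \<open>1\<^sub>A\<close> at scale \<open>R\<close> is at most \<open>C m(A)\<close>. The coarea formula carries both to
  functions, with \<open>m(f)\<close> in place of \<open>m(A)\<close>. Finally the decay of the kernel bounds \<open>m(f)\<close> by the
  lower limit of the energies of \<open>f\<close> plus a small multiple of their supremum, which is absorbed.
\<close>

section \<open>Symmetry of the heat semigroup\<close>

text \<open>Symmetry and conservativeness are not part of the definitions and have to be derived.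
  The semigroup is tied to the form only through equality of generators, so symmetry is read off
  from the symmetric form on the generator's domain and extended by density; conservativeness comes
  out of the two-sided mass bounds together with the Hoelder estimate. The Hoelder constant of the
  heat flow blows up at time zero like \<open>t powr (- (\<kappa> / dW))\<close>. As
  \<open>\<kappa> < dW\<close>, this singularity is integrable, so the loss at a fixed time is paid
  for by energies at arbitrarily fine steps, with a total that does not depend on the step. This is
  what allows a lower limit on the right-hand side. The obstacle is that the heat kernel charges all
  distances: its moment at one scale involves Korevaar-Schoen energies at every larger scale, while
  a lower limit controls a single sequence of radii. Hence the set estimates are proved for
  arbitrary sequences \<open>\<tau>\<close> and for all radii \<open>R > 0\<close>; the sequence is
  then fixed once per function, before Fatou's lemma is applied to the level sets.\<close>

abbreviation L2 :: "'a measure \<Rightarrow> ('a \<Rightarrow> real) set" where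
  "L2 M \<equiv> Lp_space M 2"

section \<open>The L2 inner product on representing functions\<close>

lemma abs_powr_2: "\<bar>x\<bar> powr 2 = x * (x::real)"
  by (cases "x = 0") (simp_all add: powr_numeral power2_eq_square)

lemma L2_iff: "u \<in> L2 M \<longleftrightarrow> u \<in> borel_measurable M \<and> integrable M (\<lambda>x. u x * u x)"
  by (simp add: Lp_space_def abs_powr_2)

lemma L2_linear:
  assumes "u \<in> L2 M" "v \<in> L2 M"
  shows "(\<lambda>x. a * u x + b * v x) \<in> L2 M"
proof -
  have [measurable]: "u \<in> borel_measurable M" "v \<in> borel_measurable M"
    and i: "integrable M (\<lambda>x. u x * u x)" "integrable M (\<lambda>x. v x * v x)"
    using assms by (auto simp: L2_iff)
  have "integrable M (\<lambda>x. (a * u x + b * v x) * (a * u x + b * v x))"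
  proof (rule Bochner_Integration.integrable_bound)
    show "integrable M (\<lambda>x. 2 * a\<^sup>2 * (u x * u x) + 2 * b\<^sup>2 * (v x * v x))"
      using i by auto
    have "(a * s + b * t) * (a * s + b * t) \<le> 2 * a\<^sup>2 * (s * s) + 2 * b\<^sup>2 * (t * t)" for s t
      using zero_le_power2[of "a * s - b * t"] by (simp add: power2_eq_square algebra_simps)
    then show "AE x in M. norm ((a * u x + b * v x) * (a * u x + b * v x))
        \<le> norm (2 * a\<^sup>2 * (u x * u x) + 2 * b\<^sup>2 * (v x * v x))"
      by (intro AE_I2) (simp add: abs_le_iff order_trans[OF _ abs_ge_self])
  qed measurable
  then show ?thesis by (simp add: L2_iff)
qed

lemma L2_diff:
  assumes "u \<in> L2 M" "v \<in> L2 M"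
  shows "(\<lambda>x. u x - v x) \<in> L2 M"
  using L2_linear[OF assms, of 1 "-1"] by simp

lemma L2_inner_integrable:
  assumes "u \<in> L2 M" "v \<in> L2 M"
  shows "integrable M (\<lambda>x. u x * v x)"
proof -
  have [measurable]: "u \<in> borel_measurable M" "v \<in> borel_measurable M"
    and i: "integrable M (\<lambda>x. u x * u x)" "integrable M (\<lambda>x. v x * v x)"
    using assms by (auto simp: L2_iff)
  show ?thesis
  proof (rule Bochner_Integration.integrable_bound)
    show "integrable M (\<lambda>x. u x * u x + v x * v x)" using i by auto
    have "\<bar>s * t\<bar> \<le> s * s + t * t" for s t :: real
      using zero_le_power2[of "s - t"] zero_le_power2[of "s + t"] zero_le_power2[of s] zero_le_power2[of t]
      unfolding abs_le_iff power2_eq_square by (simp add: algebra_simps)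
    then show "AE x in M. norm (u x * v x) \<le> norm (u x * u x + v x * v x)"
      by (intro AE_I2) (metis abs_ge_self order_trans real_norm_def)
  qed measurable
qed

lemma L2_inner_commute: "L2_inner M u v = L2_inner M v u"
  by (simp add: L2_inner_def mult.commute)

lemma L2_inner_linear_left:
  assumes "u \<in> L2 M" "v \<in> L2 M" "w \<in> L2 M"
  shows "L2_inner M (\<lambda>x. a * u x + b * v x) w = a * L2_inner M u w + b * L2_inner M v w"
proof -
  have "L2_inner M (\<lambda>x. a * u x + b * v x) w = (\<integral>x. a * (u x * w x) + b * (v x * w x) \<partial>M)"
    unfolding L2_inner_def by (simp add: algebra_simps)
  also have "\<dots> = a * L2_inner M u w + b * L2_inner M v w"
    unfolding L2_inner_def using assms by (simp add: L2_inner_integrable)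
  finally show ?thesis .
qed

lemma L2_inner_diff_left:
  assumes "u \<in> L2 M" "v \<in> L2 M" "w \<in> L2 M"
  shows "L2_inner M (\<lambda>x. u x - v x) w = L2_inner M u w - L2_inner M v w"
  using L2_inner_linear_left[OF assms, of 1 "-1"] by simp

lemma L2_inner_cong_AE:
  assumes "AE x in M. u x = u' x" "AE x in M. v x = v' x"
    and "u \<in> L2 M" "v \<in> L2 M" "u' \<in> L2 M" "v' \<in> L2 M"
  shows "L2_inner M u v = L2_inner M u' v'"
  unfolding L2_inner_def using assms by (intro integral_cong_AE) (auto simp: L2_iff)

lemma L2_norm_eq: "Lp_norm M 2 u = sqrt (L2_inner M u u)"
  unfolding Lp_norm_def L2_inner_def abs_powr_2 by (simp add: powr_half_sqrt)

lemma L2_inner_self_nonneg: "L2_inner M u u \<ge> 0"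
  unfolding L2_inner_def by simp

lemma L2_norm_nonneg: "Lp_norm M 2 u \<ge> 0"
  by (simp add: Lp_norm_def)

lemma L2_norm_sq: "(Lp_norm M 2 u)\<^sup>2 = L2_inner M u u"
  by (simp add: L2_norm_eq L2_inner_self_nonneg)

lemma L2_norm_cong_AE:
  assumes "AE x in M. u x = u' x" "u \<in> L2 M" "u' \<in> L2 M"
  shows "Lp_norm M 2 u = Lp_norm M 2 u'"
  unfolding L2_norm_eq using assms by (metis L2_inner_cong_AE)

text \<open>Discriminant test without a sign condition on the leading coefficient. It serves
  Cauchy-Schwarz, the vanishing of the first variation at a minimiser (\<open>A = 0\<close> forces
  \<open>B = 0\<close>), and a bound on the first variation near one.\<close>

lemma quadratic_nonneg_discriminant:
  fixes A B C :: real
  assumes q: "\<And>s. 0 \<le> A + 2 * s * B + s\<^sup>2 * C"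
  shows "B\<^sup>2 \<le> A * C"
proof (cases "C = 0")
  case True
  show ?thesis
  proof (cases "B = 0")
    case False
    \<comment> \<open>At this \<open>s\<close> the affine function takes the value
      \<open>-1\<close>.\<close>
    have "2 * (- (A + 1) / (2 * B)) * B = - (A + 1)" using False by simp
    with q[of "- (A + 1) / (2 * B)"] True show ?thesis by simp
  qed (simp add: True)
next
  case False
  have "C \<ge> 0"
  proof (rule ccontr)
    assume "\<not> C \<ge> 0"
    then have C: "C < 0" by simp
    \<comment> \<open>Large enough for the negative quadratic term to beat the other two.\<close>
    define s where "s = 1 + (\<bar>A\<bar> + 2 * \<bar>B\<bar>) / (- C)"
    have s: "s \<ge> 1" unfolding s_def using C divide_nonneg_nonneg[of "\<bar>A\<bar> + 2 * \<bar>B\<bar>" "- C"] by linarith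
    have sC: "s * (- C) = \<bar>A\<bar> + 2 * \<bar>B\<bar> - C" unfolding s_def using C by (simp add: field_simps)
    have "A + 2 * s * B \<le> s * (\<bar>A\<bar> + 2 * \<bar>B\<bar>)"
    proof -
      have "A \<le> s * \<bar>A\<bar>" using s mult_right_mono[of 1 s "\<bar>A\<bar>"] by simp
      moreover have "s * B \<le> s * \<bar>B\<bar>" using s by (intro mult_left_mono) auto
      ultimately show ?thesis by (simp add: algebra_simps)
    qed
    also have "\<dots> = s * (s * (- C) + C)" using sC by simp
    finally have "A + 2 * s * B + s\<^sup>2 * C \<le> s * C" by (simp add: power2_eq_square algebra_simps)
    also have "\<dots> < 0" using s C by (simp add: mult_pos_neg)
    finally show False using q[of s] by simp
  qed
  with False have C: "C > 0" by simp
  have "0 \<le> (A + 2 * (- B / C) * B + (- B / C)\<^sup>2 * C) * C"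
    by (rule mult_nonneg_nonneg[OF q]) (use C in simp)
  also have "\<dots> = A * C - B\<^sup>2" using C by (simp add: power2_eq_square field_simps)
  finally show ?thesis by simp
qed

lemma L2_Cauchy_Schwarz:
  assumes u: "u \<in> L2 M" and v: "v \<in> L2 M"
  shows "\<bar>L2_inner M u v\<bar> \<le> Lp_norm M 2 u * Lp_norm M 2 v"
proof -
  have "0 \<le> L2_inner M u u + 2 * s * L2_inner M u v + s\<^sup>2 * L2_inner M v v" for s
  proof -
    let ?w = "\<lambda>x. 1 * u x + s * v x"
    have w: "?w \<in> L2 M" using L2_linear[OF u v] .
    have "0 \<le> L2_inner M ?w ?w" by (rule L2_inner_self_nonneg)
    also have "\<dots> = 1 * L2_inner M u ?w + s * L2_inner M v ?w"
      using L2_inner_linear_left[OF u v w] .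
    also have "L2_inner M u ?w = 1 * L2_inner M u u + s * L2_inner M v u"
      by (subst L2_inner_commute) (rule L2_inner_linear_left[OF u v u])
    also have "L2_inner M v ?w = 1 * L2_inner M u v + s * L2_inner M v v"
      by (subst L2_inner_commute) (rule L2_inner_linear_left[OF u v v])
    finally show ?thesis by (simp add: L2_inner_commute[of M v u] algebra_simps power2_eq_square)
  qed
  from quadratic_nonneg_discriminant[OF this]
  have "(L2_inner M u v)\<^sup>2 \<le> (Lp_norm M 2 u * Lp_norm M 2 v)\<^sup>2"
    by (simp add: power_mult_distrib L2_norm_sq)
  then show ?thesis
    by (simp add: abs_le_square_iff[symmetric] abs_mult L2_norm_nonneg)
qed

lemma L2_contraction_semigroupD:
  assumes "L2_contraction_semigroup M P"
  shows "\<And>t u. t \<ge> 0 \<Longrightarrow> u \<in> L2 M \<Longrightarrow> P t u \<in> L2 M"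
    and "\<And>t u. t \<ge> 0 \<Longrightarrow> u \<in> L2 M \<Longrightarrow> Lp_norm M 2 (P t u) \<le> Lp_norm M 2 u"
    and "\<And>t u v a b. t \<ge> 0 \<Longrightarrow> u \<in> L2 M \<Longrightarrow> v \<in> L2 M \<Longrightarrow>
      AE x in M. P t (\<lambda>z. a * u z + b * v z) x = a * P t u x + b * P t v x"
    and "\<And>s t u. s \<ge> 0 \<Longrightarrow> t \<ge> 0 \<Longrightarrow> u \<in> L2 M \<Longrightarrow> AE x in M. P (s + t) u x = P s (P t u) x"
    and "\<And>u. u \<in> L2 M \<Longrightarrow> AE x in M. P 0 u x = u x"
  using assms unfolding L2_contraction_semigroup_def by blast+

section \<open>Density of the generator's domain, and symmetry on it\<close>

context Dirichlet_form
begin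

lemma domain_L2': "u \<in> \<F> \<Longrightarrow> u \<in> L2 M"
  using domain_L2 by blast

text \<open>The minimiser over \<open>\<F>\<close> is \<open>c\<close> times the resolvent at
  \<open>c\<close> applied to \<open>f\<close>: its Euler-Lagrange equation puts it in the domain of
  the form generator, with value \<open>c * (u - f)\<close>. Minimisation takes the place of a Riesz
  representation argument.\<close>

definition penalised :: "real \<Rightarrow> ('a \<Rightarrow> real) \<Rightarrow> ('a \<Rightarrow> real) \<Rightarrow> real" where
  "penalised c f u = \<E> u u + c * L2_inner M (\<lambda>x. u x - f x) (\<lambda>x. u x - f x)"

lemma penalised_nonneg: "c \<ge> 0 \<Longrightarrow> u \<in> \<F> \<Longrightarrow> penalised c f u \<ge> 0"
  unfolding penalised_def using form_nonneg[of u] by (simp add: L2_inner_self_nonneg)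

lemma penalised_expand:
  assumes u: "u \<in> \<F>" and \<phi>: "\<phi> \<in> \<F>" and f: "f \<in> L2 M"
  shows "penalised c f (\<lambda>x. u x + s * \<phi> x) = penalised c f u
     + 2 * s * (\<E> u \<phi> + c * L2_inner M (\<lambda>x. u x - f x) \<phi>) + s\<^sup>2 * (\<E> \<phi> \<phi> + c * L2_inner M \<phi> \<phi>)"
proof -
  let ?w = "\<lambda>x. 1 * u x + s * \<phi> x"
  have w: "?w \<in> \<F>" using domain_linear[OF u \<phi>] .
  have "\<E> ?w ?w = 1 * \<E> u ?w + s * \<E> \<phi> ?w" by (rule form_linear[OF u \<phi> w])
  also have "\<E> u ?w = 1 * \<E> u u + s * \<E> \<phi> u"
    using form_sym[OF u w] form_linear[OF u \<phi> u, of 1 s] by simp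
  also have "\<E> \<phi> ?w = 1 * \<E> u \<phi> + s * \<E> \<phi> \<phi>"
    using form_sym[OF \<phi> w] form_linear[OF u \<phi> \<phi>, of 1 s] by simp
  finally have 1: "\<E> ?w ?w = \<E> u u + 2 * s * \<E> u \<phi> + s\<^sup>2 * \<E> \<phi> \<phi>"
    by (simp add: form_sym[OF \<phi> u] algebra_simps power2_eq_square)
  let ?v = "\<lambda>x. u x - f x" and ?z = "\<lambda>x. 1 * (u x - f x) + s * \<phi> x"
  have v: "?v \<in> L2 M" and \<phi>': "\<phi> \<in> L2 M"
    using L2_diff domain_L2' u \<phi> f by auto
  have z: "?z \<in> L2 M" using L2_linear[OF v \<phi>'] .
  have "L2_inner M ?z ?z = 1 * L2_inner M ?v ?z + s * L2_inner M \<phi> ?z"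
    by (rule L2_inner_linear_left[OF v \<phi>' z])
  also have "L2_inner M ?v ?z = 1 * L2_inner M ?v ?v + s * L2_inner M \<phi> ?v"
    by (subst L2_inner_commute) (rule L2_inner_linear_left[OF v \<phi>' v])
  also have "L2_inner M \<phi> ?z = 1 * L2_inner M ?v \<phi> + s * L2_inner M \<phi> \<phi>"
    by (subst L2_inner_commute) (rule L2_inner_linear_left[OF v \<phi>' \<phi>'])
  finally have 2: "L2_inner M ?z ?z = L2_inner M ?v ?v + 2 * s * L2_inner M ?v \<phi> + s\<^sup>2 * L2_inner M \<phi> \<phi>"
    by (simp add: L2_inner_commute[of M \<phi> "\<lambda>x. u x - f x"] algebra_simps power2_eq_square)
  have eq: "?z = (\<lambda>x. (u x + s * \<phi> x) - f x)" by (auto simp: algebra_simps)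
  have combine: "a + c * b = a0 + c * b0 + 2 * s * (a1 + c * b1) + s\<^sup>2 * (a2 + c * b2)"
    if "a = a0 + 2 * s * a1 + s\<^sup>2 * a2" "b = b0 + 2 * s * b1 + s\<^sup>2 * b2" for a b a0 a1 a2 b0 b1 b2
    unfolding that by (simp add: algebra_simps)
  show ?thesis
    unfolding penalised_def by (rule combine[OF 1[unfolded mult_1] 2[unfolded eq]])
qed

lemma energy_scale:
  assumes u: "u \<in> \<F>"
  shows "\<E> (\<lambda>x. a * u x) (\<lambda>x. a * u x) = a\<^sup>2 * \<E> u u"
    and "L2_inner M (\<lambda>x. a * u x) (\<lambda>x. a * u x) = a\<^sup>2 * L2_inner M u u"
proof -
  have w: "(\<lambda>x. a * u x + 0 * u x) \<in> \<F>" by (rule domain_linear[OF u u])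
  show "\<E> (\<lambda>x. a * u x) (\<lambda>x. a * u x) = a\<^sup>2 * \<E> u u"
    using form_linear[OF u u w, of a 0] form_linear[OF u u u, of a 0] form_sym[OF u w]
    by (simp add: power2_eq_square)
  show "L2_inner M (\<lambda>x. a * u x) (\<lambda>x. a * u x) = a\<^sup>2 * L2_inner M u u"
  proof -
    have "L2_inner M (\<lambda>x. a * u x) (\<lambda>x. a * u x) = (\<integral>x. a\<^sup>2 * (u x * u x) \<partial>M)"
      unfolding L2_inner_def by (simp add: power2_eq_square ac_simps)
    then show ?thesis unfolding L2_inner_def by simp
  qed
qed

text \<open>Direct method. The parallelogram identity makes a minimising sequence Cauchy,
  \<open>c \<ge> 1\<close> lets the quadratic part dominate \<open>energy1\<close>, and closedness
  of the form supplies the limit.\<close>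

lemma penalised_minimiser:
  assumes f: "f \<in> L2 M" and c: "c \<ge> 1"
  shows "\<exists>v\<in>\<F>. \<forall>u\<in>\<F>. penalised c f v \<le> penalised c f u"
proof -
  let ?K = "penalised c f"
  define m where "m = Inf (?K ` \<F>)"
  have bdd: "bdd_below (?K ` \<F>)"
    using penalised_nonneg c by (intro bdd_belowI[of _ 0]) auto
  have m_le: "m \<le> ?K u" if "u \<in> \<F>" for u
    unfolding m_def using bdd that by (auto intro: cInf_lower)
  have "\<exists>u\<in>\<F>. ?K u < m + 1 / Suc n" for n
  proof -
    have "Inf (?K ` \<F>) < m + 1 / Suc n" unfolding m_def by simp
    then show ?thesis using cInf_less_iff[OF _ bdd] domain_zero by auto
  qed
  then obtain w where w: "\<And>n. w n \<in> \<F>" and wK: "\<And>n. ?K (w n) < m + 1 / Suc n" by metis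
  have wL: "w n \<in> L2 M" for n using w domain_L2' by auto
  have cauchy: "energy1 M \<E> (\<lambda>x. w i x - w j x) \<le> 2 / Suc i + 2 / Suc j" for i j
  proof -
    \<comment> \<open>Midpoint and half difference: \<open>w i\<close> and \<open>w j\<close> are
      \<open>?a\<close> plus and minus \<open>?b\<close>, so the cross terms cancel in the sum, and
      the value at the midpoint is at least \<open>m\<close>.\<close>
    let ?a = "\<lambda>x. (1/2) * w i x + (1/2) * w j x" and ?b = "\<lambda>x. (1/2) * w i x + (-1/2) * w j x"
    have a: "?a \<in> \<F>" and b: "?b \<in> \<F>" by (rule domain_linear[OF w w])+
    let ?B = "\<E> ?b ?b + c * L2_inner M ?b ?b"
    have i: "(\<lambda>x. ?a x + 1 * ?b x) = w i" and j: "(\<lambda>x. ?a x + (-1) * ?b x) = w j"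
      by (auto simp: field_simps)
    have "?K (w i) + ?K (w j) = 2 * ?K ?a + 2 * ?B"
      using penalised_expand[OF a b f, of c 1] penalised_expand[OF a b f, of c "-1"]
      unfolding i j by simp
    then have B: "2 * ?B \<le> 1 / Suc i + 1 / Suc j"
      using m_le[OF a] wK[of i] wK[of j] by linarith
    have d: "(\<lambda>x. w i x - w j x) = (\<lambda>x. 2 * ?b x)" by (auto simp: field_simps)
    have "L2_inner M ?b ?b \<le> c * L2_inner M ?b ?b"
      using c mult_right_mono[OF c L2_inner_self_nonneg[of M ?b]] by simp
    then have "energy1 M \<E> (\<lambda>x. w i x - w j x) \<le> 4 * ?B"
      unfolding d energy1_def energy_scale[OF b] by simp
    with B show ?thesis by simp
  qed
  have "\<exists>v\<in>\<F>. (\<lambda>n. energy1 M \<E> (\<lambda>x. w n x - v x)) \<longlonglongrightarrow> 0"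
  proof (rule form_closed[OF w], intro allI impI)
    fix e :: real assume e: "e > 0"
    obtain N where N: "1 / Suc N < e / 4" using nat_approx_posE[of "e/4"] e by auto
    show "\<exists>N. \<forall>m\<ge>N. \<forall>n\<ge>N. energy1 M \<E> (\<lambda>x. w m x - w n x) < e"
    proof (intro exI allI impI)
      fix i j assume ij: "i \<ge> N" "j \<ge> N"
      have "1 / Suc i \<le> 1 / Suc N" "1 / Suc j \<le> 1 / Suc N" using ij by (simp_all add: frac_le)
      then have "2 / Suc i + 2 / Suc j < e" using N by simp
      then show "energy1 M \<E> (\<lambda>x. w i x - w j x) < e" using cauchy[of i j] by linarith
    qed
  qed
  then obtain v where v: "v \<in> \<F>" and lim: "(\<lambda>n. energy1 M \<E> (\<lambda>x. w n x - v x)) \<longlonglongrightarrow> 0" by auto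
  have "?K v \<le> m"
  proof (rule LIMSEQ_le_const)
    let ?e = "\<lambda>n. energy1 M \<E> (\<lambda>x. w n x - v x)"
    let ?r = "\<lambda>n. m + 1 / Suc n + 2 * sqrt ((m + 1) * (c * ?e n)) + c * ?e n"
    have l1: "(\<lambda>n. 1 / real (Suc n)) \<longlonglongrightarrow> 0" using lim_inverse_n' LIMSEQ_Suc by blast
    have "?r \<longlonglongrightarrow> m + 0 + 2 * sqrt ((m + 1) * (c * 0)) + c * 0"
      by (intro tendsto_intros lim l1)
    then show "?r \<longlonglongrightarrow> m" by simp
    show "\<exists>N. \<forall>n\<ge>N. ?K v \<le> ?r n"
    proof (intro exI allI impI)
      fix n :: nat
      define d where "d = (\<lambda>x. (-1) * w n x + 1 * v x)"
      have d: "d \<in> \<F>" unfolding d_def by (rule domain_linear[OF w v])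
      let ?L = "\<E> (w n) d + c * L2_inner M (\<lambda>x. w n x - f x) d"
      let ?B = "\<E> d d + c * L2_inner M d d"
      have e: "?e n = \<E> d d + L2_inner M d d"
      proof -
        have eq: "(\<lambda>x. w n x - v x) = (\<lambda>x. (-1) * d x)" by (auto simp: d_def)
        show ?thesis unfolding energy1_def eq energy_scale[OF d] by simp
      qed
      have "\<E> d d \<le> c * \<E> d d" using mult_right_mono[OF c form_nonneg[OF d]] by simp
      then have B: "?B \<le> c * ?e n" unfolding e by (simp add: algebra_simps)
      have B0: "0 \<le> ?B" using form_nonneg[OF d] c by (simp add: L2_inner_self_nonneg)
      have K0: "0 \<le> ?K (w n)" using penalised_nonneg[OF _ w] c by simp
      have Km: "?K (w n) \<le> m + 1"
      proof -
        have "1 / real (Suc n) \<le> 1" by simp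
        then show ?thesis using wK[of n] by linarith
      qed
      \<comment> \<open>Nonnegativity of the functional along a line doubles as its Cauchy-Schwarz
        inequality: the linear term \<open>?L\<close> tends to 0 because \<open>?B\<close>
        does.\<close>
      have "0 \<le> ?K (w n) + 2 * s * ?L + s\<^sup>2 * ?B" for s
        using penalised_expand[OF w d f, of c n s] penalised_nonneg[of c "\<lambda>x. 1 * w n x + s * d x" f]
          domain_linear[OF w d, of 1 n s] c by simp
      from quadratic_nonneg_discriminant[OF this]
      have "?L\<^sup>2 \<le> ?K (w n) * ?B" .
      also have "\<dots> \<le> (m + 1) * (c * ?e n)" using Km B B0 K0 by (intro mult_mono) auto
      finally have L: "?L \<le> sqrt ((m + 1) * (c * ?e n))"
        by (rule real_le_rsqrt)
      have "?K v = ?K (\<lambda>x. w n x + 1 * d x)" by (simp add: d_def)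
      also have "\<dots> = ?K (w n) + 2 * ?L + ?B" unfolding penalised_expand[OF w d f] by simp
      also have "\<dots> \<le> ?r n"
        by (intro add_mono mult_left_mono L B less_imp_le[OF wK]) simp
      finally show "?K v \<le> ?r n" .
    qed
  qed
  then show ?thesis using v m_le by force
qed

text \<open>Comparing the minimiser \<open>v\<close> with some \<open>g\<close> in
  \<open>\<F>\<close> close to \<open>f\<close> shows that c ||v - f||^2 is less than E(g,g) + c
  (e/2)^2, so a strong penalty forces \<open>v\<close> towards \<open>f\<close>.\<close>

lemma form_generator_dense:
  assumes f: "f \<in> L2 M" and e: "e > 0"
  shows "\<exists>v w. form_generator M \<E> \<F> v w \<and> Lp_norm M 2 (\<lambda>x. v x - f x) < e"
proof -
  obtain g where g: "g \<in> \<F>" "Lp_norm M 2 (\<lambda>x. f x - g x) < e / 2"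
    using domain_dense[OF f, of "e/2"] e by auto
  \<comment> \<open>Now \<open>c * e\<^sup>2\<close> equals \<open>e\<^sup>2 + 2 * \<E> g g\<close>,
    which exceeds the comparison bound; the summand 1 ensures \<open>c \<ge> 1\<close>.\<close>
  define c where "c = 1 + 2 * \<E> g g / e\<^sup>2"
  have Eg: "\<E> g g \<ge> 0" using form_nonneg g by auto
  have c: "c \<ge> 1" unfolding c_def using Eg by simp
  obtain v where v: "v \<in> \<F>" and min: "\<And>u. u \<in> \<F> \<Longrightarrow> penalised c f v \<le> penalised c f u"
    using penalised_minimiser[OF f c] by auto
  let ?w = "\<lambda>x. c * v x + (- c) * f x"
  have vL: "v \<in> L2 M" using v domain_L2' by auto
  have w: "?w \<in> L2 M" using L2_linear[OF vL f] .
  have "\<E> v \<phi> = - L2_inner M ?w \<phi>" if \<phi>: "\<phi> \<in> \<F>" for \<phi>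
  proof -
    let ?L = "\<E> v \<phi> + c * L2_inner M (\<lambda>x. v x - f x) \<phi>"
    \<comment> \<open>By minimality the polynomial has constant term 0, so the discriminant forces
      the first variation to vanish.\<close>
    have "0 \<le> 0 + 2 * s * ?L + s\<^sup>2 * (\<E> \<phi> \<phi> + c * L2_inner M \<phi> \<phi>)" for s
      using min[of "\<lambda>x. 1 * v x + s * \<phi> x"] domain_linear[OF v \<phi>, of 1 s]
        penalised_expand[OF v \<phi> f, of c s] by simp
    from quadratic_nonneg_discriminant[OF this] have "?L = 0" by simp
    moreover have "L2_inner M ?w \<phi> = c * L2_inner M (\<lambda>x. v x - f x) \<phi>"
      unfolding L2_inner_linear_left[OF vL f domain_L2'[OF \<phi>]] L2_inner_diff_left[OF vL f domain_L2'[OF \<phi>]]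
      by (simp add: algebra_simps)
    ultimately show ?thesis by simp
  qed
  then have gen: "form_generator M \<E> \<F> v ?w" unfolding form_generator_def using v w by auto
  have gf: "L2_inner M (\<lambda>x. g x - f x) (\<lambda>x. g x - f x) < (e / 2)\<^sup>2"
  proof -
    have "L2_inner M (\<lambda>x. g x - f x) (\<lambda>x. g x - f x) = (Lp_norm M 2 (\<lambda>x. f x - g x))\<^sup>2"
      unfolding L2_norm_sq unfolding L2_inner_def by (intro Bochner_Integration.integral_cong refl) (simp add: algebra_simps)
    also have "\<dots> < (e / 2)\<^sup>2" using g L2_norm_nonneg by (intro power_strict_mono) auto
    finally show ?thesis .
  qed
  have "c * (Lp_norm M 2 (\<lambda>x. v x - f x))\<^sup>2 \<le> penalised c f v"
    unfolding penalised_def L2_norm_sq using form_nonneg[OF v] by simp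
  also have "\<dots> \<le> penalised c f g" using min g by auto
  also have "\<dots> < \<E> g g + c * (e / 2)\<^sup>2"
    unfolding penalised_def using gf c by simp
  also have "\<dots> < c * e\<^sup>2"
  proof -
    have "c * e\<^sup>2 = e\<^sup>2 + 2 * \<E> g g" unfolding c_def using e by (simp add: field_simps)
    moreover have "c * (e / 2)\<^sup>2 = c * e\<^sup>2 / 4" by (simp add: power_divide)
    moreover have "e\<^sup>2 > 0" using e by simp
    ultimately show ?thesis using Eg by linarith
  qed
  finally have "(Lp_norm M 2 (\<lambda>x. v x - f x))\<^sup>2 < e\<^sup>2" using c by simp
  then have "Lp_norm M 2 (\<lambda>x. v x - f x) < e" by (rule power2_less_imp_less) (use e in simp)
  then show ?thesis using gen by auto
qed


text \<open>\<open>P s\<close> commutes with difference quotients and is a contraction. The error at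
  \<open>P s u\<close> is therefore bounded uniformly in \<open>s\<close> by the error at
  \<open>u\<close>.\<close>

lemma semigroup_generator_orbit:
  assumes P: "L2_contraction_semigroup M P" and s: "s \<ge> 0" and h: "h > 0"
    and u: "u \<in> L2 M" and w: "w \<in> L2 M"
  shows "Lp_norm M 2 (\<lambda>x. (P h (P s u) x - P s u x) / h - P s w x)
    \<le> Lp_norm M 2 (\<lambda>x. (P h u x - u x) / h - w x)"
proof -
  note mem = L2_contraction_semigroupD(1)[OF P] and contr = L2_contraction_semigroupD(2)[OF P]
    and lin = L2_contraction_semigroupD(3)[OF P] and add = L2_contraction_semigroupD(4)[OF P]
  let ?z = "\<lambda>x. (1/h) * P h u x + (- (1/h)) * u x"
  let ?y = "\<lambda>x. 1 * ?z x + (-1) * w x"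
  have Ph: "P h u \<in> L2 M" using mem u h by auto
  have z: "?z \<in> L2 M" using L2_linear[OF Ph u] .
  have y: "?y \<in> L2 M" using L2_linear[OF z w] .
  have ae: "AE x in M. (P h (P s u) x - P s u x) / h - P s w x = P s ?y x"
    using lin[OF s z w, of 1 "-1"] lin[OF s Ph u, of "1/h" "- (1/h)"] add[OF s less_imp_le[OF h] u]
      add[OF less_imp_le[OF h] s u]
  proof eventually_elim
    case (elim x)
    have "P h (P s u) x = P s (P h u) x" using elim(3,4) by (simp add: add.commute)
    then show ?case unfolding elim(1,2) by (simp add: diff_divide_distrib)
  qed
  have m1: "(\<lambda>x. (P h (P s u) x - P s u x) / h - P s w x) \<in> L2 M"
  proof -
    have "(\<lambda>x. (1/h) * P h (P s u) x + (- (1/h)) * P s u x) \<in> L2 M"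
      using h s u mem by (intro L2_linear) auto
    from L2_diff[OF this mem[OF s w]] show ?thesis by (simp add: field_simps diff_divide_distrib)
  qed
  have "Lp_norm M 2 (\<lambda>x. (P h (P s u) x - P s u x) / h - P s w x) = Lp_norm M 2 (P s ?y)"
    by (rule L2_norm_cong_AE[OF ae m1 mem[OF s y]])
  also have "\<dots> \<le> Lp_norm M 2 ?y" by (rule contr[OF s y])
  also have "?y = (\<lambda>x. (P h u x - u x) / h - w x)" by (simp add: diff_divide_distrib)
  finally show ?thesis .
qed

text \<open>
  On the domain of the generator, symmetry of the form makes \<open>\<langle>P\<^sub>h a, b\<rangle> - \<langle>a, P\<^sub>h b\<rangle>\<close> of order
  \<open>o(h)\<close>, uniformly for \<open>a\<close>, \<open>b\<close> along orbits; moving \<open>P\<^sub>h\<close> across the inner product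
  \<open>t / h\<close> times then costs \<open>o(1)\<close>.
\<close>

lemma heat_semigroup_symmetric_domain:
  assumes heat: "heat_semigroup M \<E> \<F> P" and t: "t > 0"
    and u: "form_generator M \<E> \<F> u wu" and v: "form_generator M \<E> \<F> v wv"
  shows "L2_inner M (P t u) v = L2_inner M u (P t v)"
proof -
  have P: "L2_contraction_semigroup M P"
    and gen: "\<And>u w. semigroup_generator M P u w \<longleftrightarrow> form_generator M \<E> \<F> u w"
    using heat unfolding heat_semigroup_def by auto
  note mem = L2_contraction_semigroupD(1)[OF P] and contr = L2_contraction_semigroupD(2)[OF P]
    and add = L2_contraction_semigroupD(4)[OF P] and P0 = L2_contraction_semigroupD(5)[OF P]
  have uL: "u \<in> L2 M" "wu \<in> L2 M" and vL: "v \<in> L2 M" "wv \<in> L2 M"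
    using u v domain_L2' unfolding form_generator_def by auto
  define e where "e h u w = Lp_norm M 2 (\<lambda>x. (P h u x - u x) / h - w x)" for h u w
  have e_nonneg: "e h u w \<ge> 0" for h u w unfolding e_def by (rule L2_norm_nonneg)
  have e_lim: "((\<lambda>h. e h u wu) \<longlongrightarrow> 0) (at_right 0)" "((\<lambda>h. e h v wv) \<longlongrightarrow> 0) (at_right 0)"
    using u v gen unfolding semigroup_generator_def e_def by blast+
  have orbit: "form_generator M \<E> \<F> (P s a) (P s w)" if s: "s \<ge> 0" and a: "form_generator M \<E> \<F> a w" for s a w
  proof -
    have aL: "a \<in> L2 M" "w \<in> L2 M"
      and lim: "((\<lambda>h. e h a w) \<longlongrightarrow> 0) (at_right 0)"
      using a gen unfolding semigroup_generator_def e_def by blast+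
    have "((\<lambda>h. e h (P s a) (P s w)) \<longlongrightarrow> 0) (at_right 0)"
    proof (rule tendsto_sandwich[OF _ _ tendsto_const lim])
      show "\<forall>\<^sub>F h in at_right 0. 0 \<le> e h (P s a) (P s w)" by (simp add: e_nonneg)
      show "\<forall>\<^sub>F h in at_right 0. e h (P s a) (P s w) \<le> e h a w"
        using eventually_at_right_less[of "0::real"]
        by eventually_elim (unfold e_def, rule semigroup_generator_orbit[OF P s _ aL])
    qed
    then have "semigroup_generator M P (P s a) (P s w)"
      unfolding semigroup_generator_def e_def using mem s aL by auto
    then show ?thesis using gen by blast
  qed
  \<comment> \<open>Symmetry of the form gives (wa, b) = (wb, a), so the terms of first order in
    \<open>h\<close> cancel and only the errors of the two difference quotients remain.\<close>
  have step: "\<bar>L2_inner M (P h a) b - L2_inner M a (P h b)\<bar> \<le> h * (e h a wa * Lp_norm M 2 b + Lp_norm M 2 a * e h b wb)"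
    if h: "h > 0" and a: "form_generator M \<E> \<F> a wa" and b: "form_generator M \<E> \<F> b wb" for h a b wa wb
  proof -
    have L: "a \<in> L2 M" "wa \<in> L2 M" "b \<in> L2 M" "wb \<in> L2 M"
      "P h a \<in> L2 M" "P h b \<in> L2 M"
      using a b h mem domain_L2' unfolding form_generator_def by auto
    have "\<E> a b = - L2_inner M wa b" "\<E> b a = - L2_inner M wb a" "\<E> a b = \<E> b a"
      using a b form_sym unfolding form_generator_def by auto
    then have sym: "L2_inner M wa b = L2_inner M wb a" by simp
    have *: "(\<lambda>x. (P h c x - c x) / h - wc x) \<in> L2 M
       \<and> L2_inner M (\<lambda>x. (P h c x - c x) / h - wc x) d = (L2_inner M (P h c) d - L2_inner M c d) / h - L2_inner M wc d"
      if cL: "c \<in> L2 M" "wc \<in> L2 M" "d \<in> L2 M" for c wc d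
    proof -
      have m: "P h c \<in> L2 M" using mem h cL by auto
      let ?z = "\<lambda>x. (1/h) * P h c x + (- (1/h)) * c x"
      have z: "?z \<in> L2 M" using L2_linear[OF m cL(1)] .
      have eq: "(\<lambda>x. (P h c x - c x) / h - wc x) = (\<lambda>x. ?z x - wc x)" using h by (auto simp: field_simps)
      show ?thesis unfolding eq L2_inner_diff_left[OF z cL(2,3)] L2_inner_linear_left[OF m cL(1,3)]
        using L2_diff[OF z cL(2)] by (simp add: diff_divide_distrib)
    qed
    let ?x = "L2_inner M (\<lambda>x. (P h a x - a x) / h - wa x) b" and ?y = "L2_inner M (\<lambda>x. (P h b x - b x) / h - wb x) a"
    have "L2_inner M (P h a) b - L2_inner M a (P h b) = h * (?x - ?y)"
      using *[OF L(1,2,3)] *[OF L(3,4,1)] sym h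
      by (simp add: field_simps L2_inner_commute[of M a])
    moreover have "\<bar>?x\<bar> \<le> e h a wa * Lp_norm M 2 b" "\<bar>?y\<bar> \<le> e h b wb * Lp_norm M 2 a"
      unfolding e_def using *[OF L(1,2,3)] *[OF L(3,4,1)] L(1,3) by (blast intro: L2_Cauchy_Schwarz)+
    moreover from this have "\<bar>?x - ?y\<bar> \<le> e h a wa * Lp_norm M 2 b + Lp_norm M 2 a * e h b wb"
      by (simp add: mult.commute)
    ultimately show ?thesis using h by (simp add: abs_mult)
  qed
  have orbit_step: "\<bar>L2_inner M (P h (P s u)) (P r v) - L2_inner M (P s u) (P h (P r v))\<bar>
      \<le> h * (e h u wu * Lp_norm M 2 v + Lp_norm M 2 u * e h v wv)"
    if h: "h > 0" and s: "s \<ge> 0" and r: "r \<ge> 0" for h s r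
  proof -
    have "\<bar>L2_inner M (P h (P s u)) (P r v) - L2_inner M (P s u) (P h (P r v))\<bar>
      \<le> h * (e h (P s u) (P s wu) * Lp_norm M 2 (P r v) + Lp_norm M 2 (P s u) * e h (P r v) (P r wv))"
      using step[OF h orbit[OF s u] orbit[OF r v]] .
    also have "\<dots> \<le> h * (e h u wu * Lp_norm M 2 v + Lp_norm M 2 u * e h v wv)"
      using semigroup_generator_orbit[OF P s h uL] semigroup_generator_orbit[OF P r h vL] contr[OF s uL(1)] contr[OF r vL(1)] h
      unfolding e_def by (intro mult_left_mono add_mono mult_mono) (auto simp: L2_norm_nonneg)
    finally show ?thesis .
  qed
  \<comment> \<open>Each step moves one \<open>h\<close> from the left time to the right one. The
    right time therefore changes along the induction, and \<open>orbit_step\<close> charges the same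
    error at every step.\<close>
  have tele: "\<bar>L2_inner M (P (real n * h + s) u) (P r v) - L2_inner M (P s u) (P (real n * h + r) v)\<bar>
      \<le> real n * h * (e h u wu * Lp_norm M 2 v + Lp_norm M 2 u * e h v wv)"
    if h: "h > 0" and s: "s \<ge> 0" and r: "r \<ge> 0" for h s r n
    using r
  proof (induction n arbitrary: r)
    case (Suc n)
    let ?s = "real n * h + s"
    have s': "?s \<ge> 0" using h s by simp
    have 1: "L2_inner M (P (h + ?s) u) (P r v) = L2_inner M (P h (P ?s u)) (P r v)"
      using h s' Suc.prems by (intro L2_inner_cong_AE add) (auto intro!: mem uL vL)
    have 2: "L2_inner M (P ?s u) (P (h + r) v) = L2_inner M (P ?s u) (P h (P r v))"
      using h s' Suc.prems by (intro L2_inner_cong_AE add) (auto intro!: mem uL vL)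
    have 3: "real (Suc n) * h + s = h + ?s" "real (Suc n) * h + r = real n * h + (h + r)"
      by (simp_all add: algebra_simps)
    have "\<bar>L2_inner M (P ?s u) (P (h + r) v) - L2_inner M (P s u) (P (real n * h + (h + r)) v)\<bar>
      \<le> real n * h * (e h u wu * Lp_norm M 2 v + Lp_norm M 2 u * e h v wv)"
      using Suc.IH[of "h + r"] h Suc.prems by simp
    moreover have "\<bar>L2_inner M (P (h + ?s) u) (P r v) - L2_inner M (P ?s u) (P (h + r) v)\<bar>
       \<le> h * (e h u wu * Lp_norm M 2 v + Lp_norm M 2 u * e h v wv)"
      unfolding 1 2 using orbit_step[OF h s' Suc.prems] .
    ultimately show ?case unfolding 3 by (simp add: algebra_simps)
  qed simp
  have bound: "\<bar>L2_inner M (P t u) v - L2_inner M u (P t v)\<bar>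
      \<le> t * (e (t / real (Suc n)) u wu * Lp_norm M 2 v + Lp_norm M 2 u * e (t / real (Suc n)) v wv)" for n
  proof -
    have 1: "real (Suc n) * (t / real (Suc n)) + 0 = t" by simp
    have 2: "L2_inner M (P t u) (P 0 v) = L2_inner M (P t u) v" "L2_inner M (P 0 u) (P t v) = L2_inner M u (P t v)"
      using t by (auto intro!: L2_inner_cong_AE P0 uL vL mem)
    show ?thesis using tele[of "t / real (Suc n)" 0 0 "Suc n"] t unfolding 1 2 by simp
  qed
  have lim0: "filterlim (\<lambda>n. t / real (Suc n)) (at_right 0) sequentially"
  proof (rule tendsto_imp_filterlim_at_right)
    have "(\<lambda>n. t * inverse (real (Suc n))) \<longlonglongrightarrow> t * 0" by (intro tendsto_intros LIMSEQ_inverse_real_of_nat)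
    then show "(\<lambda>n. t / real (Suc n)) \<longlonglongrightarrow> 0" by (simp add: divide_inverse)
  qed (use t in auto)
  have "(\<lambda>n. t * (e (t / real (Suc n)) u wu * Lp_norm M 2 v + Lp_norm M 2 u * e (t / real (Suc n)) v wv))
     \<longlonglongrightarrow> t * (0 * Lp_norm M 2 v + Lp_norm M 2 u * 0)"
    by (intro tendsto_intros filterlim_compose[OF e_lim(1) lim0] filterlim_compose[OF e_lim(2) lim0])
  then have "\<bar>L2_inner M (P t u) v - L2_inner M u (P t v)\<bar> \<le> 0"
    by (intro LIMSEQ_le_const[where a = "\<bar>L2_inner M (P t u) v - L2_inner M u (P t v)\<bar>"]) (use bound in auto)
  then show ?thesis by simp
qed

text \<open>Both sides are L2-continuous in the first argument, so \<open>extend\<close> passes from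
  the generator's domain to all of L2 in that slot. It is used once per slot, after exchanging the
  arguments.\<close>

lemma heat_semigroup_symmetric:
  assumes heat: "heat_semigroup M \<E> \<F> P" and t: "t > 0"
    and u: "u \<in> L2 M" and v: "v \<in> L2 M"
  shows "L2_inner M (P t u) v = L2_inner M u (P t v)"
proof -
  have P: "L2_contraction_semigroup M P" using heat unfolding heat_semigroup_def by auto
  note mem = L2_contraction_semigroupD(1)[OF P less_imp_le[OF t]]
    and contr = L2_contraction_semigroupD(2)[OF P less_imp_le[OF t]]
    and lin = L2_contraction_semigroupD(3)[OF P less_imp_le[OF t]]
  have est: "\<bar>L2_inner M (P t f) g - L2_inner M (P t f') g\<bar> \<le> Lp_norm M 2 (\<lambda>x. f' x - f x) * Lp_norm M 2 g"
    "\<bar>L2_inner M f (P t g) - L2_inner M f' (P t g)\<bar> \<le> Lp_norm M 2 (\<lambda>x. f' x - f x) * Lp_norm M 2 g"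
    if f: "f \<in> L2 M" "f' \<in> L2 M" and g: "g \<in> L2 M" for f f' g
  proof -
    let ?d = "\<lambda>x. 1 * f' x + (-1) * f x"
    have d: "?d \<in> L2 M" using L2_linear[OF f(2,1)] .
    have "L2_inner M (P t ?d) g = L2_inner M (\<lambda>x. 1 * P t f' x + (-1) * P t f x) g"
      by (rule L2_inner_cong_AE[OF lin[OF f(2,1)] AE_I2[OF refl] mem[OF d] g L2_linear[OF mem[OF f(2)] mem[OF f(1)]] g])
    also have "\<dots> = L2_inner M (P t f') g - L2_inner M (P t f) g"
      using L2_inner_linear_left[OF mem[OF f(2)] mem[OF f(1)] g, of 1 "-1"] by simp
    finally have "\<bar>L2_inner M (P t f) g - L2_inner M (P t f') g\<bar> = \<bar>L2_inner M (P t ?d) g\<bar>" by simp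
    also have "\<dots> \<le> Lp_norm M 2 (P t ?d) * Lp_norm M 2 g" by (rule L2_Cauchy_Schwarz[OF mem[OF d] g])
    also have "\<dots> \<le> Lp_norm M 2 ?d * Lp_norm M 2 g" by (intro mult_right_mono contr d L2_norm_nonneg)
    finally show "\<bar>L2_inner M (P t f) g - L2_inner M (P t f') g\<bar> \<le> Lp_norm M 2 (\<lambda>x. f' x - f x) * Lp_norm M 2 g" by simp
    have "\<bar>L2_inner M f (P t g) - L2_inner M f' (P t g)\<bar> = \<bar>L2_inner M ?d (P t g)\<bar>"
      using L2_inner_linear_left[OF f(2,1) mem[OF g], of 1 "-1"] by simp
    also have "\<dots> \<le> Lp_norm M 2 ?d * Lp_norm M 2 (P t g)" by (rule L2_Cauchy_Schwarz[OF d mem[OF g]])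
    also have "\<dots> \<le> Lp_norm M 2 ?d * Lp_norm M 2 g" by (intro mult_left_mono contr g L2_norm_nonneg)
    finally show "\<bar>L2_inner M f (P t g) - L2_inner M f' (P t g)\<bar> \<le> Lp_norm M 2 (\<lambda>x. f' x - f x) * Lp_norm M 2 g" by simp
  qed
  have extend: "L2_inner M (P t f) g = L2_inner M f (P t g)"
    if f: "f \<in> L2 M" and g: "g \<in> L2 M"
      and dom: "\<And>f' w. form_generator M \<E> \<F> f' w \<Longrightarrow> L2_inner M (P t f') g = L2_inner M f' (P t g)" for f g
  proof -
    have "\<bar>L2_inner M (P t f) g - L2_inner M f (P t g)\<bar> \<le> 0 + e" if e: "e > 0" for e
    proof -
      define d where "d = e / (2 * (Lp_norm M 2 g + 1))"
      have N: "Lp_norm M 2 g \<ge> 0" by (rule L2_norm_nonneg)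
      have d: "d > 0" unfolding d_def using e N by simp
      obtain f' w where f': "form_generator M \<E> \<F> f' w" "Lp_norm M 2 (\<lambda>x. f' x - f x) < d"
        using form_generator_dense[OF f d] by auto
      have f'L: "f' \<in> L2 M" using f' domain_L2' unfolding form_generator_def by auto
      have "\<bar>L2_inner M (P t f) g - L2_inner M f (P t g)\<bar> \<le> 2 * (Lp_norm M 2 (\<lambda>x. f' x - f x) * Lp_norm M 2 g)"
        using est[OF f f'L g] dom[OF f'(1)] by linarith
      also have "\<dots> \<le> 2 * (d * (Lp_norm M 2 g + 1))"
        using f' N d by (intro mult_left_mono mult_mono) auto
      also have "\<dots> = e" unfolding d_def using N by (simp add: field_simps)
      finally show ?thesis by simp
    qed
    then have "\<bar>L2_inner M (P t f) g - L2_inner M f (P t g)\<bar> \<le> 0" by (rule field_le_epsilon)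
    then show ?thesis by simp
  qed
  show ?thesis
  proof (rule extend[OF u v])
    fix f' w assume f': "form_generator M \<E> \<F> f' w"
    have f'L: "f' \<in> L2 M" using f' domain_L2' unfolding form_generator_def by auto
    have "L2_inner M (P t v) f' = L2_inner M v (P t f')"
    proof (rule extend[OF v f'L])
      fix v' w' assume "form_generator M \<E> \<F> v' w'"
      from heat_semigroup_symmetric_domain[OF heat t this f']
      show "L2_inner M (P t v') f' = L2_inner M v' (P t f')" .
    qed
    then show "L2_inner M (P t f') v = L2_inner M f' (P t v)" by (simp add: L2_inner_commute)
  qed
qed

end

section \<open>Ahlfors regular spaces\<close>

text \<open>For \<open>u \<ge> 2 ^ K\<close> the summand of the dyadic shell containing
  \<open>u\<close> dominates on its own. \<open>K = 0\<close> serves integrability; large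
  \<open>K\<close> later produces the small factor in the absorption.\<close>

lemma dyadic_powr_bound:
  fixes a u :: real
  assumes a: "a > 0" and u: "u \<ge> 0"
  shows "ennreal ((1 + u) powr (- a)) \<le> indicator {..<2 ^ K} u
    + (\<Sum>k. ennreal ((2 powr (- a)) ^ (K + k)) * indicator {..<2 ^ (K + k + 1)} u)"
proof (cases "u < 2 ^ K")
  case True
  have "(1 + u) powr (- a) \<le> 1 powr (- a)" using a u by (intro powr_mono2') auto
  then have "ennreal ((1 + u) powr (- a)) \<le> 1" by simp
  then show ?thesis using True by (simp add: add_increasing2)
next
  case False
  have ex: "\<exists>n. u < 2 ^ n" using real_arch_pow[of 2 u] by auto
  define n where "n = (LEAST n. u < 2 ^ n)"
  have n: "u < 2 ^ n" unfolding n_def using LeastI_ex[OF ex] .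
  have "n > K"
  proof (rule ccontr)
    assume "\<not> n > K"
    then have "(2::real) ^ n \<le> 2 ^ K" by (intro power_increasing) auto
    with n False show False by simp
  qed
  then obtain k where k: "n = K + k + 1" using less_imp_Suc_add[of K n] by auto
  have lo: "2 ^ (K + k) \<le> u" using not_less_Least[of "K + k" "\<lambda>n. u < 2 ^ n"] k unfolding n_def by auto
  have "(1 + u) powr (- a) \<le> (2 ^ (K + k)) powr (- a)" using a u lo by (intro powr_mono2') auto
  also have "\<dots> = (2 powr (- a)) ^ (K + k)"
    by (simp add: powr_realpow[symmetric] powr_powr mult.commute)
  finally have le: "(1 + u) powr (- a) \<le> (2 powr (- a)) ^ (K + k)" .
  define F where "F i = ennreal ((2 powr (- a)) ^ (K + i)) * indicator {..<2 ^ (K + i + 1)} u" for i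
  have "indicator {..<2 ^ (K + k + 1)} u = (1 :: ennreal)" using n k by simp
  then have "ennreal ((1 + u) powr (- a)) \<le> F k"
    unfolding F_def using le by (simp only: mult_1_right ennreal_leI)
  also have "\<dots> = (\<Sum>i\<in>{k}. F i)" by simp
  also have "\<dots> \<le> (\<Sum>i. F i)" by (intro sum_le_suminf summableI) auto
  also have "\<dots> \<le> indicator {..<2 ^ K} u + (\<Sum>i. F i)" by simp
  finally show ?thesis unfolding F_def .
qed

text \<open>The metric measure part of the setting, with the constants named so that later constants
  can be built from them.\<close>

locale ahlfors_space =
  fixes M :: "'a::metric_space measure" and dH c1 c2 :: real
  assumes sets_M[measurable_cong]: "sets M = sets borel"
    and compact_balls: "\<And>(x::'a) r. r > 0 \<Longrightarrow> compact (closure (ball x r))"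
    and dH_pos: "dH > 0" and c1_pos: "c1 > 0" and c2_pos: "c2 > 0"
    and ball_lower: "\<And>x r. r \<ge> 0 \<Longrightarrow> ennreal (c1 * r powr dH) \<le> emeasure M (ball x r)"
    and ball_upper: "\<And>x r. r \<ge> 0 \<Longrightarrow> emeasure M (ball x r) \<le> ennreal (c2 * r powr dH)"
begin

lemma space_M[simp]: "space M = UNIV"
  using sets_eq_imp_space_eq[OF sets_M] by simp

lemma ball_sets[measurable]: "ball x r \<in> sets M"
  by (simp add: sets_M)

lemma ball_finite: "emeasure M (ball x r) < \<infinity>"
proof (cases "r \<ge> 0")
  case True
  then show ?thesis using ball_upper[of r x] by (auto intro: le_less_trans)
qed (simp add: ball_empty)

lemma measure_ball:
  assumes "r \<ge> 0"
  shows "c1 * r powr dH \<le> measure M (ball x r)" "measure M (ball x r) \<le> c2 * r powr dH"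
proof -
  have e: "emeasure M (ball x r) = ennreal (measure M (ball x r))"
    using ball_finite[of x r] by (intro emeasure_eq_ennreal_measure) auto
  show "c1 * r powr dH \<le> measure M (ball x r)" "measure M (ball x r) \<le> c2 * r powr dH"
    using ball_lower[OF assms, of x] ball_upper[OF assms, of x] c2_pos unfolding e by simp_all
qed

lemma sigma_finite: "sigma_finite_measure M"
proof
  obtain x0 :: 'a where True by simp
  show "\<exists>A. countable A \<and> A \<subseteq> sets M \<and> \<Union> A = space M \<and> (\<forall>a\<in>A. emeasure M a \<noteq> \<infinity>)"
  proof (intro exI conjI)
    let ?A = "range (\<lambda>n::nat. ball x0 (real n))"
    show "countable ?A" "?A \<subseteq> sets M" by auto
    show "\<forall>a\<in>?A. emeasure M a \<noteq> \<infinity>" using ball_finite by (auto simp: less_top)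
    show "\<Union> ?A = space M" using reals_Archimedean2 by (auto)
  qed
qed

sublocale sigma_finite_measure M by (rule sigma_finite)

sublocale pair_sigma_finite M M by unfold_locales

section \<open>Separability and measurability on the product space\<close>

lemma countable_dense:
  "\<exists>D::'a set. countable D \<and> (\<forall>x. \<forall>e>0. \<exists>d\<in>D. dist x d < e)"
proof -
  obtain x0 :: 'a where True by simp
  have "\<exists>F. finite F \<and> closure (ball x0 (real (Suc n))) \<subseteq> (\<Union>x\<in>F. ball x (1 / Suc k))" for n k
    using compact_balls[of "real (Suc n)" x0] unfolding compact_eq_totally_bounded by auto
  then obtain F where F: "\<And>n k. finite (F n k)"
    "\<And>n k. closure (ball x0 (real (Suc n))) \<subseteq> (\<Union>x\<in>F n k. ball x (1 / Suc k))" by metis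
  let ?D = "\<Union>n k. F n k"
  have "countable ?D" using countable_finite[OF F(1)] by (intro countable_UN) auto
  moreover have "\<exists>d\<in>?D. dist x d < e" if e: "e > 0" for x :: 'a and e
  proof -
    obtain n where n: "dist x0 x < real n" using reals_Archimedean2[of "dist x0 x"] by auto
    obtain k where k: "1 / Suc k < e" using nat_approx_posE[OF e] by auto
    have "x \<in> closure (ball x0 (real (Suc n)))"
      using n closure_subset[of "ball x0 (real (Suc n))"] by (auto simp: subset_iff)
    then obtain d where "d \<in> F n k" "dist d x < 1 / Suc k" using F(2)[of n k] by auto
    then show ?thesis using k unfolding UN_iff Bex_def by (metis UNIV_I dist_commute less_trans)
  qed
  ultimately show ?thesis by blast
qed

text \<open>On a general metric space the Borel sets of the product can exceed the product
  sigma-algebra. Here totally bounded balls give a countable dense set, so an open set is a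
  countable union of rectangles of balls.\<close>

lemma open_pair_measurable:
  assumes U: "open (U :: ('a \<times> 'a) set)"
  shows "U \<in> sets (M \<Otimes>\<^sub>M M)"
proof -
  obtain D :: "'a set" where D: "countable D" "\<And>x e. e > 0 \<Longrightarrow> \<exists>d\<in>D. dist x d < e"
    using countable_dense by blast
  define I where "I = {(d, d', n::nat). d \<in> D \<and> d' \<in> D \<and> ball d (1 / Suc n) \<times> ball d' (1 / Suc n) \<subseteq> U}"
  have cI: "countable I"
    by (rule countable_subset[of _ "D \<times> D \<times> UNIV"]) (auto simp: I_def D)
  have "U = (\<Union>(d, d', n)\<in>I. ball d (1 / Suc n) \<times> ball d' (1 / Suc n))"
  proof (intro equalityI subsetI)
    fix z assume "z \<in> U"
    obtain x y where z: "z = (x, y)" by (cases z)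
    obtain A B where AB': "open A" "open B" "z \<in> A \<times> B" "A \<times> B \<subseteq> U"
      by (rule open_prod_elim[OF U \<open>z \<in> U\<close>])
    then have AB: "open A" "open B" "x \<in> A" "y \<in> B" "A \<times> B \<subseteq> U" by (simp_all add: z)
    obtain e1 where e1: "e1 > 0" "ball x e1 \<subseteq> A" by (rule openE[OF AB(1,3)])
    obtain e2 where e2: "e2 > 0" "ball y e2 \<subseteq> B" by (rule openE[OF AB(2,4)])
    \<comment> \<open>The factor 2 is needed because a ball about a nearby \<open>d\<close> reaches
      up to twice its radius from \<open>x\<close>.\<close>
    obtain n where n: "1 / Suc n < min e1 e2 / 2" using nat_approx_posE[of "min e1 e2 / 2"] e1 e2 by auto
    obtain d d' where d: "d \<in> D" "d' \<in> D" "dist x d < 1 / Suc n" "dist y d' < 1 / Suc n"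
      using D(2)[of "1 / Suc n" x] D(2)[of "1 / Suc n" y] by auto
    have sub: "ball a (1 / Suc n) \<subseteq> ball b e" if "dist b a < 1 / Suc n" "min e1 e2 \<le> e" for a b :: 'a and e
    proof
      fix w assume "w \<in> ball a (1 / Suc n)"
      then have "dist b w < 1 / Suc n + 1 / Suc n" using that dist_triangle[of b w a] by simp
      then have "dist b w < min e1 e2" using n by simp
      then have "dist b w < e" using that(2) by linarith
      then show "w \<in> ball b e" by simp
    qed
    have "(d, d', n) \<in> I"
    proof -
      have "ball d (1 / Suc n) \<subseteq> A" using sub[OF d(3)] e1(2) by (meson min.cobounded1 order_trans)
      moreover have "ball d' (1 / Suc n) \<subseteq> B" using sub[OF d(4)] e2(2) by (meson min.cobounded2 order_trans)
      ultimately show ?thesis unfolding I_def using d AB(5) by blast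
    qed
    moreover have "z \<in> ball d (1 / Suc n) \<times> ball d' (1 / Suc n)" using d z by (simp add: dist_commute)
    ultimately show "z \<in> (\<Union>(d, d', n)\<in>I. ball d (1 / Suc n) \<times> ball d' (1 / Suc n))" by blast
  qed (auto simp: I_def)
  also have "\<dots> \<in> sets (M \<Otimes>\<^sub>M M)"
    using cI by (intro sets.countable_UN') auto
  finally show ?thesis .
qed

lemma continuous_pair_measurable:
  fixes f :: "'a \<times> 'a \<Rightarrow> 'b::topological_space"
  assumes "continuous_on UNIV f"
  shows "f \<in> borel_measurable (M \<Otimes>\<^sub>M M)"
proof (rule borel_measurableI)
  fix S :: "'b set" assume "open S"
  then have "open (f -` S)" using assms by (simp add: continuous_on_open_vimage)
  then show "f -` S \<inter> space (M \<Otimes>\<^sub>M M) \<in> sets (M \<Otimes>\<^sub>M M)"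
    using open_pair_measurable by (simp add: space_pair_measure)
qed

text \<open>Makes kernels that are known to be jointly measurable usable by the measurability prover
  in curried form.\<close>

lemma pair_compose:
  assumes "(\<lambda>z. k (fst z) (snd z)) \<in> borel_measurable (M \<Otimes>\<^sub>M M)" "f \<in> measurable N M" "g \<in> measurable N M"
  shows "(\<lambda>w. k (f w) (g w) :: 'b::topological_space) \<in> borel_measurable N"
proof -
  note [measurable] = assms
  have "(\<lambda>w. (\<lambda>z. k (fst z) (snd z)) (f w, g w)) \<in> borel_measurable N" by measurable
  then show ?thesis by simp
qed

lemma dist_measurable[measurable (raw)]:
  "f \<in> measurable N M \<Longrightarrow> g \<in> measurable N M \<Longrightarrow> (\<lambda>x. dist (f x) (g x)) \<in> borel_measurable N"
  by (rule pair_compose[OF continuous_pair_measurable]) (intro continuous_intros)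

lemma emeasure_ball_le: "r \<ge> 0 \<Longrightarrow> emeasure M {y. dist x y < r} \<le> ennreal (c2 * r powr dH)"
  using ball_upper[of r x] by (simp add: ball_def)

lemma dist_less_sets[measurable]: "{y. dist x y < r} \<in> sets M"
  using ball_sets[of x r] by (simp add: ball_def)

text \<open>The ball of radius 2^(k+1) r has measure of order 2^(k dH) r^dH and carries the weight
  2^(-a k); the resulting geometric series converges because \<open>a > dH\<close>.\<close>

lemma decay_integral_bound:
  assumes a: "a > dH"
  shows "\<exists>C>0. \<forall>x. \<forall>r>0. (\<integral>\<^sup>+ y. ennreal ((1 + dist x y / r) powr (- a)) \<partial>M) \<le> ennreal (C * r powr dH)"
proof -
  define q where "q = 2 powr (dH - a)"
  have q: "0 < q" "q < 1" unfolding q_def using a by (auto intro: powr_less_one)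
  have aq: "(2 powr (- a)) ^ k * (2 ^ (k + 1)) powr dH = 2 powr dH * q ^ k" for k :: nat
  proof -
    have "(2 ^ (k + 1)) powr dH = 2 powr dH * (2 powr dH) ^ k"
      by (simp add: powr_mult powr_power powr_powr powr_realpow[symmetric] mult.commute)
    moreover have "(2 powr (- a)) ^ k * (2 powr dH) ^ k = q ^ k"
      unfolding q_def power_mult_distrib[symmetric] powr_add[symmetric] by simp
    ultimately show ?thesis by (simp add: mult_ac)
  qed
  let ?C = "c2 * (1 + 2 powr dH * (1 / (1 - q)))"
  show ?thesis
  proof (intro exI conjI allI impI)
    show "?C > 0" using c2_pos q by (intro mult_pos_pos add_pos_nonneg) auto
    fix x and r :: real assume r: "r > 0"
    have "(\<integral>\<^sup>+ y. ennreal ((1 + dist x y / r) powr (- a)) \<partial>M)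
      \<le> (\<integral>\<^sup>+ y. indicator {y. dist x y < r} y
         + (\<Sum>k. ennreal ((2 powr (- a)) ^ k) * indicator {y. dist x y < 2 ^ (k + 1) * r} y) \<partial>M)"
    proof (rule nn_integral_mono)
      fix y
      have ind: "(indicator {..<c} (dist x y / r) :: ennreal) = indicator {y. dist x y < c * r} y" for c
        using r by (simp add: indicator_def field_simps)
      show "ennreal ((1 + dist x y / r) powr (- a)) \<le> indicator {y. dist x y < r} y
         + (\<Sum>k. ennreal ((2 powr (- a)) ^ k) * indicator {y. dist x y < 2 ^ (k + 1) * r} y)"
        using dyadic_powr_bound[of a "dist x y / r" 0] a dH_pos r unfolding ind by simp
    qed
    also have "\<dots> = emeasure M {y. dist x y < r}
       + (\<Sum>k. ennreal ((2 powr (- a)) ^ k) * emeasure M {y. dist x y < 2 ^ (k + 1) * r})"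
      by (simp add: nn_integral_add nn_integral_suminf nn_integral_cmult)
    also have "\<dots> \<le> ennreal (c2 * r powr dH)
       + (\<Sum>k. ennreal ((2 powr (- a)) ^ k) * ennreal (c2 * (2 ^ (k + 1) * r) powr dH))"
      using r by (intro add_mono suminf_le summableI mult_left_mono emeasure_ball_le) auto
    also have "(\<lambda>k. ennreal ((2 powr (- a)) ^ k) * ennreal (c2 * (2 ^ (k + 1) * r) powr dH))
       = (\<lambda>k. ennreal (c2 * r powr dH * 2 powr dH * q ^ k))"
    proof
      fix k :: nat
      have "(2 powr (- a)) ^ k * (c2 * (2 ^ (k + 1) * r) powr dH)
        = c2 * r powr dH * ((2 powr (- a)) ^ k * (2 ^ (k + 1)) powr dH)"
        using r by (simp add: powr_mult)
      then show "ennreal ((2 powr (- a)) ^ k) * ennreal (c2 * (2 ^ (k + 1) * r) powr dH)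
        = ennreal (c2 * r powr dH * 2 powr dH * q ^ k)"
        using aq[of k] c2_pos by (simp add: ennreal_mult[symmetric] mult_ac)
    qed
    also have "(\<Sum>k. ennreal (c2 * r powr dH * 2 powr dH * q ^ k)) = ennreal (c2 * r powr dH * 2 powr dH * (1 / (1 - q)))"
      using q c2_pos r by (intro suminf_ennreal_eq sums_mult geometric_sums) auto
    also have "ennreal (c2 * r powr dH) + \<dots> = ennreal (?C * r powr dH)"
      using q c2_pos r by (subst ennreal_plus[symmetric]) (auto simp: algebra_simps)
    finally show "(\<integral>\<^sup>+ y. ennreal ((1 + dist x y / r) powr (- a)) \<partial>M) \<le> ennreal (?C * r powr dH)" .
  qed
qed

end

section \<open>Conservativeness\<close>

text \<open>
  The kernel bounds are required at every point, and the sub-Gaussian upper bound is relaxed to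
  polynomial decay of order \<open>dW + dH + 1\<close>: one more than the order at which the dyadic sum in
  \<open>heat_moment_energy_le\<close> diverges.
\<close>

locale kernel_space = ahlfors_space M dH c1 c2
  for M :: "'a::metric_space measure" and dH c1 c2 :: real +
  fixes p :: "real \<Rightarrow> 'a \<Rightarrow> 'a \<Rightarrow> real" and dW \<kappa> cl cu :: real
  assumes kappa: "0 < \<kappa>" "\<kappa> < dW"
    and cl_pos: "cl > 0" and cu_pos: "cu > 0"
    and p_joint: "\<And>t. t > 0 \<Longrightarrow> (\<lambda>z. p t (fst z) (snd z)) \<in> borel_measurable (M \<Otimes>\<^sub>M M)"
    and p_nonneg: "\<And>t x y. t > 0 \<Longrightarrow> 0 \<le> p t x y"
    and p_lower: "\<And>t x y. t > 0 \<Longrightarrow> dist x y < t powr (1 / dW) \<Longrightarrow> cl * t powr (- (dH / dW)) \<le> p t x y"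
    and p_upper: "\<And>t x y. t > 0 \<Longrightarrow>
      p t x y \<le> cu * t powr (- (dH / dW)) * (1 + dist x y / t powr (1 / dW)) powr (- (dW + dH + 1))"
begin

abbreviation heat :: "real \<Rightarrow> ('a \<Rightarrow> real) \<Rightarrow> 'a \<Rightarrow> real" where
  "heat t g \<equiv> kernel_op M p t g"

lemma dW_pos: "dW > 0" using kappa by simp

lemmas p_measurable = pair_compose[OF p_joint]

text \<open>\<open>k\<close> counts the powers of the distance that the integrand carries, each of
  which costs one order of decay; \<open>k < dW + 1\<close> leaves an order above \<open>dH\<close>.
  The function \<open>F\<close> is kept free to cover both the mass and the moment of order
  \<open>\<kappa>\<close>.\<close>

lemma decay_moment_bound:
  assumes k: "k < dW + 1"
  shows "\<exists>C>0. \<forall>t>0. \<forall>x F. (\<forall>y. F y \<le> cu * t powr ((k - dH) / dW)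
      * (1 + dist x y / t powr (1 / dW)) powr (- (dW + dH + 1 - k))) \<longrightarrow>
    (\<integral>\<^sup>+ y. ennreal (F y) \<partial>M) \<le> ennreal (C * t powr (k / dW))"
proof -
  let ?a = "dW + dH + 1 - k"
  obtain C where C: "C > 0"
    "\<And>x r. r > 0 \<Longrightarrow> (\<integral>\<^sup>+ y. ennreal ((1 + dist x y / r) powr (- ?a)) \<partial>M) \<le> ennreal (C * r powr dH)"
    using decay_integral_bound[of ?a] k by auto
  show ?thesis
  proof (intro exI conjI allI impI)
    show "cu * C > 0" using C cu_pos by simp
    fix t :: real and x and F :: "'a \<Rightarrow> real"
    let ?r = "t powr (1 / dW)" and ?c = "cu * t powr ((k - dH) / dW)"
    assume t: "t > 0" and F: "\<forall>y. F y \<le> ?c * (1 + dist x y / ?r) powr (- ?a)"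
    have c: "?c \<ge> 0" using cu_pos by simp
    have "(\<integral>\<^sup>+ y. ennreal (F y) \<partial>M) \<le> (\<integral>\<^sup>+ y. ennreal ?c * ennreal ((1 + dist x y / ?r) powr (- ?a)) \<partial>M)"
      using F c by (intro nn_integral_mono) (simp add: ennreal_mult[symmetric] ennreal_leI)
    also have "\<dots> = ennreal ?c * (\<integral>\<^sup>+ y. ennreal ((1 + dist x y / ?r) powr (- ?a)) \<partial>M)"
      by (rule nn_integral_cmult) measurable
    also have "\<dots> \<le> ennreal ?c * ennreal (C * ?r powr dH)"
      using t by (intro mult_left_mono C) auto
    also have "\<dots> = ennreal (?c * (C * ?r powr dH))"
      using c C by (intro ennreal_mult[symmetric]) auto
    also have "?c * (C * ?r powr dH) = cu * C * (t powr ((k - dH) / dW) * ?r powr dH)" by simp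
    also have "t powr ((k - dH) / dW) * ?r powr dH = t powr (k / dW)"
      by (simp add: powr_powr powr_add[symmetric] diff_divide_distrib)
    finally show "(\<integral>\<^sup>+ y. ennreal (F y) \<partial>M) \<le> ennreal (cu * C * t powr (k / dW))" .
  qed
qed

lemma mass_upper: "\<exists>C>0. \<forall>t>0. \<forall>x. (\<integral>\<^sup>+ y. ennreal (p t x y) \<partial>M) \<le> ennreal C"
proof -
  obtain C where "C > 0" and C: "\<forall>t>0. \<forall>x F. (\<forall>y. F y \<le> cu * t powr ((0 - dH) / dW)
      * (1 + dist x y / t powr (1 / dW)) powr (- (dW + dH + 1 - 0))) \<longrightarrow>
    (\<integral>\<^sup>+ y. ennreal (F y) \<partial>M) \<le> ennreal (C * t powr (0 / dW))"
    using decay_moment_bound[of 0] dW_pos by auto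
  have "(\<integral>\<^sup>+ y. ennreal (p t x y) \<partial>M) \<le> ennreal (C * t powr (0 / dW))" if t: "t > 0" for t x
    by (rule C[rule_format, OF t]) (use p_upper[OF t] in simp)
  then show ?thesis using \<open>C > 0\<close> by (intro exI[of _ C]) simp
qed

lemma p_moment_pointwise:
  assumes t: "t > 0" and k: "k \<ge> 0"
  shows "p t x y * dist x y powr k
    \<le> cu * t powr ((k - dH) / dW) * (1 + dist x y / t powr (1 / dW)) powr (- (dW + dH + 1 - k))"
proof -
  let ?r = "t powr (1 / dW)"
  let ?u = "dist x y / ?r"
  have r: "?r > 0" using t by simp
  have "dist x y powr k = ?r powr k * ?u powr k" using r by (simp add: powr_mult[symmetric])
  also have "\<dots> \<le> ?r powr k * (1 + ?u) powr k" using k r by (intro mult_left_mono powr_mono2) auto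
  finally have "p t x y * dist x y powr k
    \<le> (cu * t powr (- (dH / dW)) * (1 + ?u) powr (- (dW + dH + 1))) * (?r powr k * (1 + ?u) powr k)"
    using p_upper[OF t, of x y] p_nonneg[OF t, of x y] by (intro mult_mono) auto
  also have "\<dots> = cu * (t powr (- (dH / dW)) * ?r powr k) * ((1 + ?u) powr (- (dW + dH + 1)) * (1 + ?u) powr k)"
    by simp
  also have "t powr (- (dH / dW)) * ?r powr k = t powr ((k - dH) / dW)"
    by (simp add: powr_powr powr_add[symmetric] diff_divide_distrib)
  also have "(1 + ?u) powr (- (dW + dH + 1)) * (1 + ?u) powr k = (1 + ?u) powr (- (dW + dH + 1 - k))"
    by (subst powr_add[symmetric]) (simp add: algebra_simps)
  finally show ?thesis .
qed

lemma moment_bound: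
  "\<exists>D>0. \<forall>t>0. \<forall>x. (\<integral>\<^sup>+ y. ennreal (p t x y * dist x y powr \<kappa>) \<partial>M) \<le> ennreal (D * t powr (\<kappa> / dW))"
proof -
  have "\<kappa> < dW + 1" using kappa by simp
  from decay_moment_bound[OF this] show ?thesis
    using p_moment_pointwise[OF _ less_imp_le[OF kappa(1)]] by meson
qed

lemma p_integrable:
  assumes t: "t > 0"
  shows "integrable M (p t x)"
proof (rule integrableI_bounded)
  note [measurable] = p_measurable[OF t]
  show "p t x \<in> borel_measurable M" by measurable
  obtain C where "C > 0" "\<forall>t>0. \<forall>x. (\<integral>\<^sup>+ y. ennreal (p t x y) \<partial>M) \<le> ennreal C" using mass_upper by blast
  then have "(\<integral>\<^sup>+ y. ennreal (p t x y) \<partial>M) \<le> ennreal C" using t by blast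
  then have "(\<integral>\<^sup>+ y. ennreal (p t x y) \<partial>M) < \<infinity>" by (rule le_less_trans) simp
  then show "(\<integral>\<^sup>+ y. ennreal (norm (p t x y)) \<partial>M) < \<infinity>" using p_nonneg[OF t] by simp
qed

lemma kernel_op_integrable:
  assumes t: "t > 0" and [measurable]: "g \<in> borel_measurable M" and g: "\<And>y. \<bar>g y\<bar> \<le> B"
  shows "integrable M (\<lambda>y. p t x y * g y)"
proof (rule Bochner_Integration.integrable_bound)
  note [measurable] = p_measurable[OF t]
  show "integrable M (\<lambda>y. B * p t x y)" using p_integrable[OF t] by simp
  show "(\<lambda>y. p t x y * g y) \<in> borel_measurable M" by measurable
  have B: "B \<ge> 0" using g[of undefined] by linarith
  show "AE y in M. norm (p t x y * g y) \<le> norm (B * p t x y)"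
    using p_nonneg[OF t] g B by (intro AE_I2) (simp add: abs_mult mult.commute mult_right_mono)
qed

lemma kernel_op_measurable:
  assumes t: "t > 0" and [measurable]: "g \<in> borel_measurable M"
  shows "heat t g \<in> borel_measurable M"
proof -
  note [measurable] = p_measurable[OF t]
  show ?thesis unfolding kernel_op_def[abs_def] by measurable
qed

lemma kernel_op_mono:
  assumes t: "t > 0" and [measurable]: "g \<in> borel_measurable M" "h \<in> borel_measurable M"
    and "\<And>y. \<bar>g y\<bar> \<le> B" "\<And>y. \<bar>h y\<bar> \<le> B" "\<And>y. g y \<le> h y"
  shows "heat t g x \<le> heat t h x"
  unfolding kernel_op_def
proof (rule integral_mono)
  show "integrable M (\<lambda>y. p t x y * g y)" by (rule kernel_op_integrable[OF t _ assms(4)]) simp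
  show "integrable M (\<lambda>y. p t x y * h y)" by (rule kernel_op_integrable[OF t _ assms(5)]) simp
  show "p t x y * g y \<le> p t x y * h y" for y by (intro mult_left_mono assms(6) p_nonneg t)
qed

lemma kernel_op_indicator_range:
  assumes t: "t > 0" and [measurable]: "A \<in> sets M"
  shows "0 \<le> heat t (indicator A) x"
    and "heat t (indicator A) x \<le> heat t (\<lambda>_. 1) x"
proof -
  show "0 \<le> heat t (indicator A) x"
    unfolding kernel_op_def using p_nonneg[OF t] by (intro integral_nonneg_AE AE_I2) auto
  show "heat t (indicator A) x \<le> heat t (\<lambda>_. 1) x"
    by (rule kernel_op_mono[OF t, where B = 1]) (auto simp: indicator_def)
qed

text \<open>The near-diagonal bound on the ball of radius \<open>t powr (1 / dW)\<close> gives the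
  lower estimate, where the powers of \<open>t\<close> cancel. Uniformity in \<open>t\<close> on
  both sides is what \<open>conservative\<close> contradicts.\<close>

lemma kernel_op_one_bounds:
  "\<exists>C. \<forall>t>0. \<forall>x. cl * c1 \<le> heat t (\<lambda>_. 1) x \<and> heat t (\<lambda>_. 1) x \<le> C"
proof -
  obtain C where C: "C > 0" "\<forall>t>0. \<forall>x. (\<integral>\<^sup>+ y. ennreal (p t x y) \<partial>M) \<le> ennreal C" using mass_upper by blast
  have "cl * c1 \<le> heat t (\<lambda>_. 1) x \<and> heat t (\<lambda>_. 1) x \<le> C" if t: "t > 0" for t x
  proof
    have "ennreal (\<integral>y. p t x y \<partial>M) = (\<integral>\<^sup>+ y. ennreal (p t x y) \<partial>M)"
      using p_nonneg[OF t] by (intro nn_integral_eq_integral[symmetric] p_integrable[OF t]) auto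
    also have "\<dots> \<le> ennreal C" using C t by blast
    finally show "heat t (\<lambda>_. 1) x \<le> C" using C(1) unfolding kernel_op_def by simp
    let ?r = "t powr (1 / dW)"
    have "cl * c1 = cl * t powr (- (dH / dW)) * (c1 * ?r powr dH)"
      using t dW_pos by (simp add: powr_powr powr_add[symmetric] mult_ac)
    also have "\<dots> \<le> cl * t powr (- (dH / dW)) * measure M (ball x ?r)"
      using cl_pos by (intro mult_left_mono measure_ball) auto
    also have "\<dots> = (\<integral>y. cl * t powr (- (dH / dW)) * indicator (ball x ?r) y \<partial>M)" by simp
    also have "\<dots> \<le> (\<integral>y. p t x y * 1 \<partial>M)"
    proof (rule integral_mono)
      show "integrable M (\<lambda>y. cl * t powr (- (dH / dW)) * indicator (ball x ?r) y)"
        using ball_finite[of x ?r] by (intro integrable_mult_right integrable_real_indicator) auto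
      show "integrable M (\<lambda>y. p t x y * 1)" using p_integrable[OF t, of x] by simp
      show "cl * t powr (- (dH / dW)) * indicator (ball x ?r) y \<le> p t x y * 1" for y
        using p_lower[OF t, of x y] p_nonneg[OF t, of x y] by (simp add: indicator_def)
    qed
    finally show "cl * c1 \<le> heat t (\<lambda>_. 1) x" unfolding kernel_op_def .
  qed
  then show ?thesis by blast
qed

end

text \<open>All that the later estimates use of the Dirichlet form. \<open>semigroup\<close> and
  \<open>initial\<close> concern indicators of finite-measure sets, which lie in L2, and
  \<open>hoelder\<close> functions with values in [0,1], whose sup norm is at most 1;
  \<open>semigroup\<close> and \<open>hoelder\<close> hold at every point, so that iterates can be
  integrated.\<close>

locale heat_kernel_space = kernel_space M dH c1 c2 p dW \<kappa> cl cu
  for M :: "'a::metric_space measure" and dH c1 c2 :: real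
    and p :: "real \<Rightarrow> 'a \<Rightarrow> 'a \<Rightarrow> real" and dW \<kappa> cl cu :: real +
  fixes cw :: real
  assumes cw_pos: "cw > 0"
    and p_sym: "\<And>t x y. t > 0 \<Longrightarrow> p t x y = p t y x"
    and semigroup: "\<And>s t A x. s > 0 \<Longrightarrow> t > 0 \<Longrightarrow> A \<in> sets M \<Longrightarrow> emeasure M A < \<infinity> \<Longrightarrow>
      kernel_op M p (s + t) (indicator A) x = kernel_op M p s (kernel_op M p t (indicator A)) x"
    and hoelder: "\<And>t g x y. t > 0 \<Longrightarrow> g \<in> borel_measurable M \<Longrightarrow> (\<And>z. 0 \<le> g z \<and> g z \<le> 1) \<Longrightarrow>
      \<bar>kernel_op M p t g x - kernel_op M p t g y\<bar> \<le> cw * (dist x y powr \<kappa> / t powr (\<kappa> / dW))"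
    and initial: "\<And>A. A \<in> sets M \<Longrightarrow> emeasure M A < \<infinity> \<Longrightarrow>
      ((\<lambda>t. \<integral>x. indicator A x * (1 - kernel_op M p t (indicator A) x) \<partial>M) \<longlongrightarrow> 0) (at_right 0)"
begin

text \<open>The constant 1 is not in L2 of this infinite measure, so the space is exhausted by balls
  and dominated convergence is applied twice, with majorants from the mass bounds.\<close>

lemma semigroup_one:
  assumes s: "s > 0" and t: "t > 0"
  shows "heat (s + t) (\<lambda>_. 1) x = heat s (heat t (\<lambda>_. 1)) x"
proof -
  obtain x0 :: 'a where True by simp
  define B where "B n = ball x0 (real n)" for n
  have Bm[measurable]: "B n \<in> sets M" for n unfolding B_def by simp
  have ind: "(\<lambda>n. indicator (B n) y :: real) \<longlonglongrightarrow> 1" for y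
  proof -
    obtain N where N: "dist x0 y < real N" using reals_Archimedean2 by blast
    have "indicator (B n) y = (1 :: real)" if "n \<ge> N" for n
    proof -
      have "real N \<le> real n" using that by simp
      then show ?thesis using N unfolding B_def by (simp add: indicator_def)
    qed
    then show ?thesis by (intro tendsto_eventually) (auto simp: eventually_sequentially)
  qed
  have lim: "(\<lambda>n. heat t (indicator (B n)) y) \<longlonglongrightarrow> heat t (\<lambda>_. 1) y" if t: "t > 0" for t y
    unfolding kernel_op_def
  proof (rule integral_dominated_convergence[where w = "p t y"])
    note [measurable] = p_measurable[OF t]
    show "(\<lambda>z. p t y z * 1) \<in> borel_measurable M"
      "\<And>n. (\<lambda>z. p t y z * indicator (B n) z) \<in> borel_measurable M" by measurable
    show "integrable M (p t y)" by (rule p_integrable[OF t])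
    show "AE z in M. (\<lambda>n. p t y z * indicator (B n) z) \<longlonglongrightarrow> p t y z * 1"
      by (intro AE_I2 tendsto_mult tendsto_const ind)
    show "AE z in M. norm (p t y z * indicator (B n) z) \<le> p t y z" for n
      using p_nonneg[OF t] by (intro AE_I2) (auto simp: indicator_def)
  qed
  obtain C where C: "\<And>t x. t > 0 \<Longrightarrow> heat t (\<lambda>_. 1) x \<le> C" using kernel_op_one_bounds by blast
  have "(\<lambda>n. heat s (heat t (indicator (B n))) x) \<longlonglongrightarrow> heat s (heat t (\<lambda>_. 1)) x"
    unfolding kernel_op_def[of _ _ s]
  proof (rule integral_dominated_convergence[where w = "\<lambda>y. C * p s x y"])
    note [measurable] = p_measurable[OF s] kernel_op_measurable[OF t]
    show "(\<lambda>z. p s x z * heat t (\<lambda>_. 1) z) \<in> borel_measurable M"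
      "\<And>n. (\<lambda>z. p s x z * heat t (indicator (B n)) z) \<in> borel_measurable M" by measurable
    show "integrable M (\<lambda>y. C * p s x y)" using p_integrable[OF s] by simp
    show "AE z in M. (\<lambda>n. p s x z * heat t (indicator (B n)) z) \<longlonglongrightarrow> p s x z * heat t (\<lambda>_. 1) z"
      by (intro AE_I2 tendsto_mult tendsto_const lim[OF t])
    have "\<bar>heat t (indicator (B n)) z\<bar> \<le> C" for n z
      using kernel_op_indicator_range[OF t Bm, of n z] C[OF t, of z] by simp
    then show "AE z in M. norm (p s x z * heat t (indicator (B n)) z) \<le> C * p s x z" for n
      using mult_left_mono[OF _ p_nonneg[OF s]] p_nonneg[OF s]
      by (intro AE_I2) (simp add: abs_mult mult.commute[of C])
  qed
  moreover have "(\<lambda>n. heat s (heat t (indicator (B n))) x) = (\<lambda>n. heat (s + t) (indicator (B n)) x)"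
    using ball_finite[of x0] by (intro ext semigroup[symmetric] s t) (auto simp: B_def)
  ultimately show ?thesis using lim[of "s + t" x] s t by (auto intro: LIMSEQ_unique)
qed

text \<open>
  Conservativeness is a consequence of the Hoelder bound: as \<open>t \<rightarrow> \<infinity>\<close> the function
  \<open>\<phi>\<^sub>t = P\<^sub>t 1\<close> becomes locally constant, so that \<open>\<phi>\<^bsub>t+s\<^esub> - \<phi>\<^sub>t \<phi>\<^sub>s\<close> tends to zero. If \<open>\<phi>\<^sub>s \<noteq> 1\<close> at some
  point, then \<open>n \<mapsto> \<phi>\<^bsub>t+ns\<^esub>\<close> grows or decays at least linearly there, contradicting the two-sided
  bounds on the mass of the kernel.
\<close>

lemma conservative:
  assumes s: "s > 0"
  shows "heat s (\<lambda>_. 1) x = 1"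
proof (rule ccontr)
  define \<phi> where "\<phi> t = heat t (\<lambda>_. 1)" for t
  define a where "a = \<phi> s x"
  assume "heat s (\<lambda>_. 1) x \<noteq> 1"
  then have a1: "\<bar>a - 1\<bar> > 0" by (simp add: a_def \<phi>_def)
  obtain C where bounds: "\<And>t x. t > 0 \<Longrightarrow> cl * c1 \<le> \<phi> t x" "\<And>t x. t > 0 \<Longrightarrow> \<phi> t x \<le> C"
    using kernel_op_one_bounds unfolding \<phi>_def by blast
  define c where "c = cl * c1"
  have c: "c > 0" unfolding c_def using cl_pos c1_pos by simp
  \<comment> \<open>Without error the drift per step would be at least \<open>2 * \<eta>\<close>;
    tolerating an error \<open>\<eta>\<close> leaves a drift of \<open>\<eta>\<close>.\<close>
  define \<eta> where "\<eta> = \<bar>a - 1\<bar> * c / 2"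
  have \<eta>: "\<eta> > 0" unfolding \<eta>_def using a1 c by simp
  obtain D where D: "D > 0" "\<And>t x. t > 0 \<Longrightarrow>
      (\<integral>\<^sup>+ y. ennreal (p t x y * dist x y powr \<kappa>) \<partial>M) \<le> ennreal (D * t powr (\<kappa> / dW))"
    using moment_bound by blast
  note [measurable] = p_measurable[OF s]
  define m where "m = (\<integral>y. p s x y * dist x y powr \<kappa> \<partial>M)"
  have m_int: "integrable M (\<lambda>y. p s x y * dist x y powr \<kappa>)"
  proof (rule integrableI_bounded)
    show "(\<lambda>y. p s x y * dist x y powr \<kappa>) \<in> borel_measurable M" by measurable
    show "(\<integral>\<^sup>+ y. ennreal (norm (p s x y * dist x y powr \<kappa>)) \<partial>M) < \<infinity>"
      using le_less_trans[OF D(2)[OF s, of x] ennreal_less_top] p_nonneg[OF s] by (simp add: abs_mult)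
  qed
  have m: "m \<ge> 0" unfolding m_def using p_nonneg[OF s] by (intro integral_nonneg_AE AE_I2) auto
  have near: "\<bar>\<phi> (s + t) x - \<phi> t x * a\<bar> \<le> cw * m / t powr (\<kappa> / dW)" if t: "t > 0" for t
  proof -
    have [measurable]: "\<phi> t \<in> borel_measurable M" unfolding \<phi>_def by (intro kernel_op_measurable t) simp
    have B: "\<bar>\<phi> t y\<bar> \<le> C" for y using bounds[OF t, of y] c unfolding c_def by linarith
    have i1: "integrable M (\<lambda>y. p s x y * \<phi> t y)" by (rule kernel_op_integrable[OF s _ B]) simp
    have i2: "integrable M (\<lambda>y. p s x y * \<phi> t x)" by (rule kernel_op_integrable[OF s _ B]) simp
    have "\<phi> (s + t) x - \<phi> t x * a = (\<integral>y. p s x y * \<phi> t y \<partial>M) - (\<integral>y. p s x y * \<phi> t x \<partial>M)"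
      unfolding \<phi>_def semigroup_one[OF s t] a_def by (simp add: kernel_op_def mult.commute)
    also have "\<dots> = (\<integral>y. p s x y * \<phi> t y - p s x y * \<phi> t x \<partial>M)" using i1 i2 by simp
    finally have "\<bar>\<phi> (s + t) x - \<phi> t x * a\<bar> \<le> (\<integral>y. \<bar>p s x y * \<phi> t y - p s x y * \<phi> t x\<bar> \<partial>M)"
      using integral_abs_bound by simp
    also have "\<dots> \<le> (\<integral>y. cw / t powr (\<kappa> / dW) * (p s x y * dist x y powr \<kappa>) \<partial>M)"
    proof (rule integral_mono)
      show "integrable M (\<lambda>y. \<bar>p s x y * \<phi> t y - p s x y * \<phi> t x\<bar>)" using i1 i2 by auto
      show "integrable M (\<lambda>y. cw / t powr (\<kappa> / dW) * (p s x y * dist x y powr \<kappa>))" using m_int by simp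
      fix y
      have "\<bar>p s x y * \<phi> t y - p s x y * \<phi> t x\<bar> = p s x y * \<bar>\<phi> t x - \<phi> t y\<bar>"
        using p_nonneg[OF s, of x y] by (simp add: abs_mult right_diff_distrib[symmetric] abs_minus_commute)
      also have "\<dots> \<le> p s x y * (cw * (dist x y powr \<kappa> / t powr (\<kappa> / dW)))"
        unfolding \<phi>_def using p_nonneg[OF s, of x y] by (intro mult_left_mono hoelder[OF t]) auto
      finally show "\<bar>p s x y * \<phi> t y - p s x y * \<phi> t x\<bar> \<le> cw / t powr (\<kappa> / dW) * (p s x y * dist x y powr \<kappa>)"
        by (simp add: mult_ac)
    qed
    also have "\<dots> = cw * m / t powr (\<kappa> / dW)" unfolding m_def by simp
    finally show ?thesis .
  qed
  \<comment> \<open>From this time on the Hoelder error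
    \<open>cw * m / t powr (\<kappa> / dW)\<close> is at most \<open>\<eta>\<close>; the summand 1
    keeps the base positive when \<open>m = 0\<close>.\<close>
  define T where "T = (cw * m / \<eta> + 1) powr (dW / \<kappa>)"
  have base: "cw * m / \<eta> + 1 > 0" using cw_pos m \<eta> by (intro add_nonneg_pos) auto
  have T: "T > 0" unfolding T_def using base by simp
  have late: "\<bar>\<phi> (s + t) x - \<phi> t x * a\<bar> \<le> \<eta>" if t: "t \<ge> T" for t
  proof -
    have t0: "t > 0" using t T by simp
    have "cw * m / \<eta> + 1 = T powr (\<kappa> / dW)" unfolding T_def using base kappa by (simp add: powr_powr)
    also have "\<dots> \<le> t powr (\<kappa> / dW)" using t T kappa by (intro powr_mono2) auto
    finally have "cw * m / \<eta> \<le> t powr (\<kappa> / dW)" by simp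
    then have "cw * m / t powr (\<kappa> / dW) \<le> \<eta>" using t0 \<eta> by (simp add: field_simps)
    then show ?thesis using near[OF t0] by simp
  qed
  have step: "a > 1 \<Longrightarrow> \<phi> (s + t) x \<ge> \<phi> t x + \<eta>" "a < 1 \<Longrightarrow> \<phi> (s + t) x \<le> \<phi> t x - \<eta>" if t: "t \<ge> T" for t
  proof -
    have ct: "c \<le> \<phi> t x" using bounds(1)[of t x] t T by (simp add: c_def)
    have d: "\<phi> t x * a - \<phi> t x = \<phi> t x * (a - 1)" by (simp add: algebra_simps)
    show "\<phi> (s + t) x \<ge> \<phi> t x + \<eta>" if "a > 1"
    proof -
      have "c * (a - 1) \<le> \<phi> t x * (a - 1)" using ct that by (intro mult_right_mono) auto
      moreover have "c * (a - 1) = 2 * \<eta>" unfolding \<eta>_def using that by simp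
      ultimately show ?thesis using late[OF t] d by linarith
    qed
    show "\<phi> (s + t) x \<le> \<phi> t x - \<eta>" if "a < 1"
    proof -
      have "c * (1 - a) \<le> \<phi> t x * (1 - a)" using ct that by (intro mult_right_mono) auto
      moreover have "c * (1 - a) = 2 * \<eta>" unfolding \<eta>_def using that by simp
      moreover have "\<phi> t x * (1 - a) = \<phi> t x - \<phi> t x * a" by (simp add: algebra_simps)
      ultimately show ?thesis using late[OF t] by linarith
    qed
  qed
  have grow: "a > 1 \<Longrightarrow> \<phi> (T + real n * s) x \<ge> real n * \<eta>" "a < 1 \<Longrightarrow> \<phi> (T + real n * s) x \<le> C - real n * \<eta>" for n
  proof (induction n)
    case 0
    show "a > 1 \<Longrightarrow> \<phi> (T + real 0 * s) x \<ge> real 0 * \<eta>" "a < 1 \<Longrightarrow> \<phi> (T + real 0 * s) x \<le> C - real 0 * \<eta>"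
      using bounds[OF T, of x] c by (simp_all add: c_def)
  next
    case (Suc n)
    have e: "T + real (Suc n) * s = s + (T + real n * s)" by (simp add: algebra_simps)
    have ge: "T + real n * s \<ge> T" using s by simp
    show "a > 1 \<Longrightarrow> \<phi> (T + real (Suc n) * s) x \<ge> real (Suc n) * \<eta>"
      "a < 1 \<Longrightarrow> \<phi> (T + real (Suc n) * s) x \<le> C - real (Suc n) * \<eta>"
      using step[OF ge] Suc unfolding e by (simp_all add: algebra_simps)
  qed
  obtain n where n: "real n * \<eta> > C" using reals_Archimedean3[OF \<eta>] by blast
  have pos: "T + real n * s > 0" using T s by (simp add: add_pos_nonneg)
  show False
    using grow[of n] bounds[OF pos, of x] n a1 c unfolding c_def by linarith
qed

end

section \<open>Loss of heat\<close>

text \<open>One functional for three kernels: the heat kernel, its moment kernel and the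
  Korevaar-Schoen kernel. Monotonicity and the coarea formula are thereby proved once.\<close>

definition nonlocal_energy :: "'a measure \<Rightarrow> ('a \<Rightarrow> 'a \<Rightarrow> real) \<Rightarrow> ('a \<Rightarrow> real) \<Rightarrow> ennreal" where
  "nonlocal_energy M k f = (\<integral>\<^sup>+ x. \<integral>\<^sup>+ y. ennreal (k x y) * ennreal \<bar>f y - f x\<bar> \<partial>M \<partial>M)"

text \<open>\<open>ennreal\<close> sends negative numbers to 0, so without sign conditions
  additivity weakens to subadditivity.\<close>

lemma ennreal_plus_le: "ennreal (a + b) \<le> ennreal a + ennreal b"
proof (cases "a \<ge> 0 \<and> b \<ge> 0")
  case False
  then have "a + b \<le> a \<or> a + b \<le> b" by linarith
  then have "ennreal (a + b) \<le> ennreal a \<or> ennreal (a + b) \<le> ennreal b" by (auto intro: ennreal_leI)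
  then show ?thesis by (auto intro: add_increasing add_increasing2)
qed simp

text \<open>Integral comparison: since \<open>b - 1 < 0\<close>, the mean value theorem bounds each
  term by the increment of \<open>n powr b / b\<close>.\<close>

lemma sum_powr_le:
  fixes b :: real
  assumes b: "0 < b" "b < 1"
  shows "(\<Sum>j\<in>{1..<n}. real j powr (b - 1)) \<le> real n powr b / b"
proof -
  have *: "(\<Sum>j\<in>{1..n}. real j powr (b - 1)) \<le> real n powr b / b" for n
  proof (induction n)
    case (Suc n)
    have step: "real (Suc n) powr (b - 1) \<le> (real (Suc n) powr b - real n powr b) / b"
    proof (cases "n = 0")
      case True
      then show ?thesis using b by simp
    next
      case False
      have "\<exists>z>real n. z < real (Suc n) \<and>
          real (Suc n) powr b - real n powr b = (real (Suc n) - real n) * (b * z powr (b - 1))"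
        using False by (intro MVT2) (auto intro!: derivative_eq_intros)
      then obtain z where z: "real n < z" "z < real (Suc n)" "real (Suc n) powr b - real n powr b = b * z powr (b - 1)"
        by auto
      have "real (Suc n) powr (b - 1) \<le> z powr (b - 1)" using z b False by (intro powr_mono2') auto
      then show ?thesis using b unfolding z(3) by simp
    qed
    have "(\<Sum>j\<in>{1..Suc n}. real j powr (b - 1)) = (\<Sum>j\<in>{1..n}. real j powr (b - 1)) + real (Suc n) powr (b - 1)"
      by simp
    also have "\<dots> \<le> real n powr b / b + (real (Suc n) powr b - real n powr b) / b"
      by (intro add_mono Suc step)
    also have "\<dots> = real (Suc n) powr b / b" by (simp add: diff_divide_distrib)
    finally show ?case .
  qed simp
  have "(\<Sum>j\<in>{1..<n}. real j powr (b - 1)) \<le> (\<Sum>j\<in>{1..n}. real j powr (b - 1))"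
    by (intro sum_mono2) auto
  also note *
  finally show ?thesis .
qed

context heat_kernel_space
begin

lemma kernel_op_range:
  assumes t: "t > 0" and [measurable]: "g \<in> borel_measurable M" and g: "\<And>y. 0 \<le> g y \<and> g y \<le> 1"
  shows "0 \<le> heat t g x" "heat t g x \<le> 1"
proof -
  have "heat t (\<lambda>_. 0) x \<le> heat t g x"
    by (rule kernel_op_mono[OF t, where B = 1]) (use g in \<open>auto simp: abs_le_iff intro: order_trans[of _ 0]\<close>)
  then show "0 \<le> heat t g x" by (simp add: kernel_op_def)
  have "heat t g x \<le> heat t (\<lambda>_. 1) x"
    by (rule kernel_op_mono[OF t, where B = 1]) (use g in \<open>auto simp: abs_le_iff intro: order_trans[of _ 0]\<close>)
  then show "heat t g x \<le> 1" by (simp add: conservative[OF t])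
qed

lemma nn_integral_p: "t > 0 \<Longrightarrow> (\<integral>\<^sup>+ y. ennreal (p t x y) \<partial>M) = 1"
  using conservative[of t x] p_nonneg[of t] p_integrable[of t x]
  by (subst nn_integral_eq_integral) (auto simp: kernel_op_def)

definition heat_loss :: "'a set \<Rightarrow> real \<Rightarrow> real" where
  "heat_loss A t = (\<integral>x. indicator A x * (1 - heat t (indicator A) x) \<partial>M)"

text \<open>Division by \<open>t\<close> matches the Korevaar-Schoen scaling: at distances of order
  \<open>t powr (1 / dW)\<close> the factor d^kappa / t is of order d^(-(dW - kappa)).\<close>

definition heat_moment :: "real \<Rightarrow> 'a \<Rightarrow> 'a \<Rightarrow> real" where
  "heat_moment t x y = p t x y * dist x y powr \<kappa> / t"

abbreviation moment_energy :: "real \<Rightarrow> ('a \<Rightarrow> real) \<Rightarrow> ennreal" where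
  "moment_energy t f \<equiv> nonlocal_energy M (heat_moment t) f"

text \<open>Exchange of heat inside \<open>A\<close> cancels by symmetry of the kernel. Only pairs
  separated by the boundary of \<open>A\<close> remain, so the Hoelder bound on \<open>G\<close> is
  paid exactly where the indicator differs.\<close>

lemma heat_loss_step:
  assumes t: "t > 0" and A[measurable]: "A \<in> sets M" "emeasure M A < \<infinity>"
    and [measurable]: "G \<in> borel_measurable M" and G: "\<And>y. 0 \<le> G y \<and> G y \<le> 1"
    and L: "\<And>x y. \<bar>G x - G y\<bar> \<le> L * dist x y powr \<kappa>" "L \<ge> 0"
  shows "ennreal (\<integral>x. indicator A x * (G x - heat t G x) \<partial>M)
    \<le> ennreal (L * t) * moment_energy t (indicator A)"
proof -
  note [measurable] = p_measurable[OF t]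
  define q where "q z = indicator A (fst z) * p t (fst z) (snd z)" for z
  define h where "h z = q z * (G (fst z) - G (snd z))" for z
  define h1 where "h1 z = h z * indicator A (snd z)" for z
  define h2 where "h2 z = h z * indicator (- A) (snd z)" for z
  have qm[measurable]: "q \<in> borel_measurable (M \<Otimes>\<^sub>M M)" unfolding q_def by measurable
  have hm[measurable]: "h \<in> borel_measurable (M \<Otimes>\<^sub>M M)" unfolding h_def by measurable
  have Ac[measurable]: "- A \<in> sets M" using sets.compl_sets[OF A(1)] by (simp add: Compl_eq_Diff_UNIV)
  have h1m[measurable]: "h1 \<in> borel_measurable (M \<Otimes>\<^sub>M M)" unfolding h1_def by measurable
  have h2m[measurable]: "h2 \<in> borel_measurable (M \<Otimes>\<^sub>M M)" unfolding h2_def by measurable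
  have q0: "q z \<ge> 0" for z unfolding q_def using p_nonneg[OF t] by simp
  have q_int: "integrable (M \<Otimes>\<^sub>M M) q"
  proof (rule integrableI_bounded[OF qm])
    have "(\<integral>\<^sup>+ z. ennreal (norm (q z)) \<partial>(M \<Otimes>\<^sub>M M)) = (\<integral>\<^sup>+ x. \<integral>\<^sup>+ y. ennreal (q (x, y)) \<partial>M \<partial>M)"
      by (simp add: q0 sigma_finite_measure.nn_integral_fst[OF sigma_finite, where f = "\<lambda>z. ennreal (q z)"])
    also have "\<dots> = (\<integral>\<^sup>+ x. indicator A x * (\<integral>\<^sup>+ y. ennreal (p t x y) \<partial>M) \<partial>M)"
      unfolding q_def using p_nonneg[OF t]
      by (intro nn_integral_cong, subst nn_integral_cmult[symmetric]) (auto intro!: nn_integral_cong simp: indicator_def)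
    also have "\<dots> = emeasure M A" by (simp add: nn_integral_p[OF t])
    finally show "(\<integral>\<^sup>+ z. ennreal (norm (q z)) \<partial>(M \<Otimes>\<^sub>M M)) < \<infinity>" using A by simp
  qed
  have G1: "\<bar>G x - G y\<bar> \<le> 1" for x y using G[of x] G[of y] by auto
  have hq: "\<bar>h z\<bar> \<le> q z" for z
    unfolding h_def using q0[of z] mult_left_mono[OF G1 q0, of z "fst z" "snd z"] by (simp add: abs_mult)
  have h_int: "integrable (M \<Otimes>\<^sub>M M) h"
    by (rule Bochner_Integration.integrable_bound[OF q_int hm]) (use hq q0 in auto)
  have h1_int: "integrable (M \<Otimes>\<^sub>M M) h1"
    by (rule Bochner_Integration.integrable_bound[OF h_int]) (auto simp: h1_def indicator_def)
  have h2_int: "integrable (M \<Otimes>\<^sub>M M) h2"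
    by (rule Bochner_Integration.integrable_bound[OF h_int]) (auto simp: h2_def indicator_def)
  have "(\<integral>x. indicator A x * (G x - heat t G x) \<partial>M) = (\<integral>x. \<integral>y. h (x, y) \<partial>M \<partial>M)"
  proof (intro Bochner_Integration.integral_cong refl)
    fix x
    have i: "integrable M (\<lambda>y. p t x y * G x)" "integrable M (\<lambda>y. p t x y * G y)"
      using G p_integrable[OF t, of x] by (auto intro!: kernel_op_integrable[OF t, where B = 1])
    have "(\<integral>y. h (x, y) \<partial>M) = (\<integral>y. indicator A x * (p t x y * G x - p t x y * G y) \<partial>M)"
      unfolding h_def q_def by (intro Bochner_Integration.integral_cong refl) (simp add: algebra_simps)
    also have "\<dots> = indicator A x * (G x - heat t G x)"
      using i conservative[OF t, of x] by (simp add: kernel_op_def)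
    finally show "indicator A x * (G x - heat t G x) = (\<integral>y. h (x, y) \<partial>M)" by simp
  qed
  also have "\<dots> = (\<integral>z. h z \<partial>(M \<Otimes>\<^sub>M M))" by (rule integral_fst'[OF h_int])
  also have "\<dots> = (\<integral>z. h1 z + h2 z \<partial>(M \<Otimes>\<^sub>M M))"
    unfolding h1_def h2_def by (intro Bochner_Integration.integral_cong refl) (auto simp: indicator_def)
  also have "\<dots> = (\<integral>z. h1 z \<partial>(M \<Otimes>\<^sub>M M)) + (\<integral>z. h2 z \<partial>(M \<Otimes>\<^sub>M M))" using h1_int h2_int by simp
  \<comment> \<open>On \<open>A\<close> times \<open>A\<close> the integrand is antisymmetric under
    the swap of the two variables.\<close>
  also have "(\<integral>z. h1 z \<partial>(M \<Otimes>\<^sub>M M)) = 0"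
  proof -
    have "(\<integral>z. h1 z \<partial>(M \<Otimes>\<^sub>M M)) = (\<integral>(x, y). h1 (y, x) \<partial>(M \<Otimes>\<^sub>M M))"
      using h1_int by (intro integral_product_swap[symmetric]) auto
    also have "\<dots> = (\<integral>z. - h1 z \<partial>(M \<Otimes>\<^sub>M M))"
      using p_sym[OF t] by (intro Bochner_Integration.integral_cong refl)
        (auto simp: h1_def h_def q_def indicator_def algebra_simps)
    finally show ?thesis by simp
  qed
  finally have "ennreal (\<integral>x. indicator A x * (G x - heat t G x) \<partial>M) = ennreal (\<integral>z. h2 z \<partial>(M \<Otimes>\<^sub>M M))"
    by simp
  also have "\<dots> \<le> ennreal (norm (\<integral>z. h2 z \<partial>(M \<Otimes>\<^sub>M M)))" by (intro ennreal_leI) simp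
  also have "\<dots> \<le> (\<integral>\<^sup>+ z. ennreal (norm (h2 z)) \<partial>(M \<Otimes>\<^sub>M M))" by (rule integral_norm_bound_ennreal[OF h2_int])
  also have "\<dots> = (\<integral>\<^sup>+ x. \<integral>\<^sup>+ y. ennreal (norm (h2 (x, y))) \<partial>M \<partial>M)"
    using h2_int by (intro sigma_finite_measure.nn_integral_fst[OF sigma_finite, symmetric]) auto
  also have "\<dots> \<le> (\<integral>\<^sup>+ x. \<integral>\<^sup>+ y. ennreal (L * t) * (ennreal (heat_moment t x y) * ennreal \<bar>indicator A y - indicator A x\<bar>) \<partial>M \<partial>M)"
  proof (intro nn_integral_mono)
    fix x y
    have "norm (h2 (x, y)) \<le> (L * t) * (heat_moment t x y * \<bar>indicator A y - indicator A x\<bar>)"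
    proof (cases "x \<in> A \<and> y \<notin> A")
      case True
      have "norm (h2 (x, y)) = p t x y * \<bar>G x - G y\<bar>"
        unfolding h2_def h_def q_def using True p_nonneg[OF t, of x y] by (simp add: abs_mult)
      also have "\<dots> \<le> p t x y * (L * dist x y powr \<kappa>)" by (intro mult_left_mono L p_nonneg[OF t])
      also have "\<dots> = (L * t) * heat_moment t x y" unfolding heat_moment_def using t by simp
      finally show ?thesis using True by simp
    next
      case False
      then have "h2 (x, y) = 0" by (auto simp: h2_def h_def q_def)
      then show ?thesis using p_nonneg[OF t, of x y] L t by (simp add: heat_moment_def)
    qed
    moreover have "heat_moment t x y \<ge> 0" unfolding heat_moment_def using p_nonneg[OF t, of x y] t by simp
    ultimately show "ennreal (norm (h2 (x, y)))
      \<le> ennreal (L * t) * (ennreal (heat_moment t x y) * ennreal \<bar>indicator A y - indicator A x\<bar>)"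
      using L t by (simp add: ennreal_mult[symmetric] ennreal_leI)
  qed
  also have "\<dots> = ennreal (L * t) * moment_energy t (indicator A)"
    unfolding nonlocal_energy_def heat_moment_def by (simp add: nn_integral_cmult)
  finally show ?thesis .
qed

lemma heat_loss_integrable:
  assumes t: "t > 0" and A[measurable]: "A \<in> sets M" "emeasure M A < \<infinity>"
  shows "integrable M (\<lambda>x. indicator A x * (1 - heat t (indicator A) x))"
proof (rule Bochner_Integration.integrable_bound)
  note [measurable] = kernel_op_measurable[OF t]
  show "integrable M (indicator A :: 'a \<Rightarrow> real)" using A by (intro integrable_real_indicator)
  show "(\<lambda>x. indicator A x * (1 - heat t (indicator A) x)) \<in> borel_measurable M" by measurable
  have "norm (indicator A x * (1 - heat t (indicator A) x)) \<le> norm (indicator A x :: real)" for x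
    using kernel_op_range[OF t, of "indicator A" x] by (auto simp: indicator_def)
  then show "AE x in M. norm (indicator A x * (1 - heat t (indicator A) x)) \<le> norm (indicator A x :: real)"
    by simp
qed

lemma heat_loss_nonneg:
  assumes "t > 0" and [measurable]: "A \<in> sets M"
  shows "heat_loss A t \<ge> 0"
  unfolding heat_loss_def using kernel_op_range(2)[OF assms(1), of "indicator A"]
  by (intro integral_nonneg_AE AE_I2) (auto simp: indicator_def)

text \<open>The step from \<open>j * t\<close> to \<open>(j + 1) * t\<close> applies
  \<open>heat_loss_step\<close> to the heat flow at time \<open>j * t\<close>, with its Hoelder
  constant there. For \<open>j = 0\<close> there is no smoothing yet, so that step stays as
  \<open>heat_loss A t\<close>.\<close>

lemma heat_loss_multiple:
  assumes t: "t > 0" and A[measurable]: "A \<in> sets M" "emeasure M A < \<infinity>" and n: "n \<ge> 1"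
  shows "ennreal (heat_loss A (real n * t)) \<le> ennreal (heat_loss A t)
    + ennreal (t * (\<Sum>j\<in>{1..<n}. cw / (real j * t) powr (\<kappa> / dW))) * moment_energy t (indicator A)"
  using n
proof (induction n rule: nat_induct_at_least)
  case base
  then show ?case by simp
next
  case (Suc n)
  let ?E = "moment_energy t (indicator A)"
  let ?S = "\<lambda>n. t * (\<Sum>j\<in>{1..<n}. cw / (real j * t) powr (\<kappa> / dW))"
  define G where "G = heat (real n * t) (indicator A)"
  have nt: "real n * t > 0" using Suc t by simp
  have Gm[measurable]: "G \<in> borel_measurable M" unfolding G_def by (intro kernel_op_measurable nt) simp
  have G01: "0 \<le> G y \<and> G y \<le> 1" for y
    unfolding G_def using kernel_op_range[OF nt, of "indicator A"] by (auto simp: indicator_def)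
  let ?L = "cw / (real n * t) powr (\<kappa> / dW)"
  have L: "\<bar>G x - G y\<bar> \<le> ?L * dist x y powr \<kappa>" for x y
    using hoelder[OF nt, of "indicator A" x y] unfolding G_def by (simp add: indicator_def)
  have L0: "?L \<ge> 0" using cw_pos by simp
  have ind_int: "integrable M (\<lambda>x. indicator A x * f x)" if "f \<in> borel_measurable M" "\<And>y. \<bar>f y\<bar> \<le> (1::real)" for f
    by (rule Bochner_Integration.integrable_bound[of M "indicator A :: 'a \<Rightarrow> real"])
      (use that A in \<open>auto simp: indicator_def integrable_indicator_iff\<close>)
  have H: "heat (real (Suc n) * t) (indicator A) x = heat t G x" for x
    using semigroup[OF t nt A, of x] unfolding G_def by (simp add: algebra_simps)
  have PG: "0 \<le> heat t G x" "heat t G x \<le> 1" for x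
    using kernel_op_range[OF t Gm G01] by auto
  have PGm[measurable]: "heat t G \<in> borel_measurable M" by (intro kernel_op_measurable t) simp
  have "heat_loss A (real (Suc n) * t) = (\<integral>x. indicator A x * (1 - G x) + indicator A x * (G x - heat t G x) \<partial>M)"
    unfolding heat_loss_def H by (intro Bochner_Integration.integral_cong refl) (simp add: algebra_simps)
  also have "\<dots> = heat_loss A (real n * t) + (\<integral>x. indicator A x * (G x - heat t G x) \<partial>M)"
    unfolding heat_loss_def G_def[symmetric]
  proof (intro Bochner_Integration.integral_add ind_int)
    show "\<bar>1 - G y\<bar> \<le> 1" for y using G01[of y] by auto
    show "\<bar>G y - heat t G y\<bar> \<le> 1" for y using G01[of y] PG[of y] by auto
  qed measurable
  finally have eq: "heat_loss A (real (Suc n) * t) = heat_loss A (real n * t) + (\<integral>x. indicator A x * (G x - heat t G x) \<partial>M)" .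
  have S0: "?S n \<ge> 0" using t cw_pos by (intro mult_nonneg_nonneg sum_nonneg) auto
  have "ennreal (heat_loss A (real (Suc n) * t))
     \<le> ennreal (heat_loss A (real n * t)) + ennreal (\<integral>x. indicator A x * (G x - heat t G x) \<partial>M)"
    unfolding eq by (rule ennreal_plus_le)
  also have "\<dots> \<le> (ennreal (heat_loss A t) + ennreal (?S n) * ?E) + ennreal (?L * t) * ?E"
    by (intro add_mono Suc.IH heat_loss_step[OF t A Gm G01 L L0])
  also have "\<dots> = ennreal (heat_loss A t) + ennreal (?S n + ?L * t) * ?E"
    by (simp only: ennreal_plus[OF S0 mult_nonneg_nonneg[OF L0 less_imp_le[OF t]]] distrib_right add.assoc)
  also have "?S n + ?L * t = ?S (Suc n)" using Suc.hyps by (simp add: algebra_simps)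
  finally show ?case .
qed

text \<open>With \<open>\<kappa> / dW = 1 - \<alpha>\<close> the sum of Hoelder constants is a
  Riemann sum of s^(alpha - 1), hence bounded through the total time \<open>real n * t\<close>
  alone.\<close>

lemma heat_loss_growth:
  assumes t: "t > 0" and A: "A \<in> sets M" "emeasure M A < \<infinity>" and n: "n \<ge> 1"
  defines "\<alpha> \<equiv> (dW - \<kappa>) / dW"
  shows "ennreal (heat_loss A (real n * t)) \<le> ennreal (heat_loss A t)
    + ennreal (cw / \<alpha> * (real n * t) powr \<alpha>) * moment_energy t (indicator A)"
proof -
  have \<alpha>: "0 < \<alpha>" "\<alpha> < 1" unfolding \<alpha>_def using kappa by (auto simp: field_simps)
  have k: "\<kappa> / dW = 1 - \<alpha>" unfolding \<alpha>_def using dW_pos by (simp add: field_simps)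
  have "t * (\<Sum>j\<in>{1..<n}. cw / (real j * t) powr (\<kappa> / dW)) = cw * t powr \<alpha> * (\<Sum>j\<in>{1..<n}. real j powr (\<alpha> - 1))"
    unfolding sum_distrib_left k
  proof (intro sum.cong refl)
    fix j assume "j \<in> {1..<n}"
    have "(real j * t) powr (\<alpha> - 1) = real j powr (\<alpha> - 1) * t powr (\<alpha> - 1)" using t by (simp add: powr_mult)
    moreover have "cw / (real j * t) powr (1 - \<alpha>) = cw * (real j * t) powr (\<alpha> - 1)"
      using powr_minus_divide[of "real j * t" "1 - \<alpha>"] by simp
    moreover have "t * t powr (\<alpha> - 1) = t powr \<alpha>" using t by (simp add: powr_mult_base)
    ultimately show "t * (cw / (real j * t) powr (1 - \<alpha>)) = cw * t powr \<alpha> * real j powr (\<alpha> - 1)"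
      by (metis (no_types, opaque_lifting) mult.assoc mult.commute)
  qed
  also have "\<dots> \<le> cw * t powr \<alpha> * (real n powr \<alpha> / \<alpha>)"
    using cw_pos \<alpha> by (intro mult_left_mono sum_powr_le) auto
  also have "\<dots> = cw / \<alpha> * (real n * t) powr \<alpha>" using t by (simp add: powr_mult)
  finally have "ennreal (t * (\<Sum>j\<in>{1..<n}. cw / (real j * t) powr (\<kappa> / dW))) \<le> ennreal (cw / \<alpha> * (real n * t) powr \<alpha>)"
    by (rule ennreal_leI)
  then show ?thesis
    by (intro order_trans[OF heat_loss_multiple[OF t A n]] add_left_mono mult_right_mono) auto
qed

text \<open>
  The loss of heat at time scale \<open>t\<close> is bounded by energies at arbitrarily small scales, since
  \<open>\<Sum>\<^sub>j (j \<tau>)\<^bsup>-\<kappa>/dW\<^esup> \<tau>\<close> stays bounded as \<open>\<tau> \<rightarrow> 0\<close>.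
\<close>

lemma heat_loss_liminf:
  assumes t: "t > 0" and A: "A \<in> sets M" "emeasure M A < \<infinity>"
    and \<tau>: "\<And>n. \<tau> n > 0" "\<tau> \<longlonglongrightarrow> (0::real)"
    and X: "\<And>s. t \<le> s \<Longrightarrow> s \<le> 2 * t \<Longrightarrow> X \<le> heat_loss A s"
  defines "\<alpha> \<equiv> (dW - \<kappa>) / dW"
  shows "ennreal X \<le> ennreal (cw / \<alpha> * (2 * t) powr \<alpha>) *
    liminf (\<lambda>n. moment_energy (\<tau> n) (indicator A))"
proof -
  have \<alpha>: "0 < \<alpha>" "\<alpha> < 1" unfolding \<alpha>_def using kappa by (auto simp: field_simps)
  let ?K = "cw / \<alpha> * (2 * t) powr \<alpha>"
  let ?E = "\<lambda>n. moment_energy (\<tau> n) (indicator A)"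
  have K: "?K > 0" using cw_pos \<alpha> t by simp
  have key: "ennreal X \<le> ennreal (heat_loss A (\<tau> n)) + ennreal ?K * ?E n" if "\<tau> n \<le> t" for n
  proof -
    \<comment> \<open>\<open>t\<close> need not be a multiple of \<open>\<tau> n\<close>. Rounding
      up lands between \<open>t\<close> and \<open>2 * t\<close> once
      \<open>\<tau> n \<le> t\<close>, which is why \<open>X\<close> is assumed to bound the loss on
      that whole window.\<close>
    define m where "m = nat \<lceil>t / \<tau> n\<rceil>"
    have r: "t / \<tau> n \<ge> 1" using that \<tau>(1)[of n] by simp
    have m: "t / \<tau> n \<le> real m" "real m \<le> t / \<tau> n + 1" unfolding m_def using r by linarith+
    have m1: "m \<ge> 1" using m r by linarith
    have s: "t \<le> real m * \<tau> n" "real m * \<tau> n \<le> 2 * t"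
    proof -
      show "t \<le> real m * \<tau> n" using m(1) \<tau>(1)[of n] by (simp add: field_simps)
      have "real m * \<tau> n \<le> (t / \<tau> n + 1) * \<tau> n" using m(2) \<tau>(1)[of n] by (intro mult_right_mono) auto
      also have "\<dots> = t + \<tau> n" using \<tau>(1)[of n] by (simp add: field_simps)
      finally show "real m * \<tau> n \<le> 2 * t" using that by simp
    qed
    have "ennreal X \<le> ennreal (heat_loss A (real m * \<tau> n))" by (intro ennreal_leI X s)
    also have "\<dots> \<le> ennreal (heat_loss A (\<tau> n)) + ennreal (cw / \<alpha> * (real m * \<tau> n) powr \<alpha>) * ?E n"
      unfolding \<alpha>_def by (rule heat_loss_growth[OF \<tau>(1) A m1])
    also have "\<dots> \<le> ennreal (heat_loss A (\<tau> n)) + ennreal ?K * ?E n"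
      using s \<alpha> cw_pos t \<tau>(1)[of n]
      by (intro add_left_mono mult_right_mono ennreal_leI mult_left_mono powr_mono2) auto
    finally show ?thesis .
  qed
  have lim0: "filterlim \<tau> (at_right 0) sequentially"
    using \<tau> by (intro tendsto_imp_filterlim_at_right) auto
  have loss0: "(\<lambda>n. heat_loss A (\<tau> n)) \<longlonglongrightarrow> 0"
    using filterlim_compose[OF initial[OF A] lim0] unfolding heat_loss_def .
  show ?thesis
  proof (rule ennreal_le_epsilon)
    fix e :: real assume e: "0 < e"
    have "eventually (\<lambda>n. \<tau> n < t) sequentially" using order_tendstoD(2)[OF \<tau>(2) t] .
    moreover have "eventually (\<lambda>n. heat_loss A (\<tau> n) < e) sequentially" using order_tendstoD(2)[OF loss0 e] .
    \<comment> \<open>Solved for \<open>?E n\<close>, so that the lower bound is constant in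
      \<open>n\<close> and passes to the lower limit.\<close>
    ultimately have "eventually (\<lambda>n. ennreal ((X - e) / ?K) \<le> ?E n) sequentially"
    proof eventually_elim
      case (elim n)
      have le: "ennreal X \<le> ennreal e + ennreal ?K * ?E n"
        using elim by (intro order_trans[OF key add_right_mono] ennreal_leI) auto
      show ?case
      proof (cases "?E n")
        case (real r)
        have Kr: "?K * r \<ge> 0" using less_imp_le[OF K] real(1) by (rule mult_nonneg_nonneg)
        have "ennreal X \<le> ennreal (e + ?K * r)"
          using le unfolding real(2) ennreal_mult[OF less_imp_le[OF K] real(1), symmetric]
            ennreal_plus[OF less_imp_le[OF e] Kr] .
        then have "X \<le> e + ?K * r" using Kr e by (subst (asm) ennreal_le_iff) auto
        then have "X - e \<le> r * ?K" by (subst mult.commute) linarith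
        then have "(X - e) / ?K \<le> r" by (simp only: pos_divide_le_eq[OF K])
        then show ?thesis unfolding real(2) by (rule ennreal_leI)
      qed simp
    qed
    then have "ennreal ((X - e) / ?K) \<le> liminf ?E" by (rule Liminf_bounded)
    then have "ennreal ?K * ennreal ((X - e) / ?K) \<le> ennreal ?K * liminf ?E" by (rule mult_left_mono) simp
    moreover have "ennreal (X - e) = ennreal ?K * ennreal ((X - e) / ?K)"
      using K by (subst ennreal_mult'[symmetric]) auto
    ultimately have "ennreal (X - e) \<le> ennreal ?K * liminf ?E" by simp
    then have le: "ennreal (X - e) + ennreal e \<le> ennreal ?K * liminf ?E + ennreal e" by (rule add_right_mono)
    have "ennreal X \<le> ennreal (X - e) + ennreal e" using ennreal_plus_le[of "X - e" e] by simp
    from order_trans[OF this le] show "ennreal X \<le> ennreal ?K * liminf ?E + ennreal e" .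
  qed
qed

end

section \<open>Coarea formula and isoperimetric inequality\<close>

lemma powr_le_nn_integral:
  fixes a q :: real
  assumes a: "a \<ge> 0" and q: "q > 1"
  shows "ennreal (a powr q) \<le> (\<integral>\<^sup>+ s. ennreal (q * s powr (q - 1)) * indicator {0<..<a} s \<partial>lborel)"
    (is "_ \<le> ?I")
proof (cases "a = 0")
  case False
  then have a: "a > 0" using a by simp
  show ?thesis
  proof (rule ennreal_le_epsilon)
    fix e :: real assume e: "0 < e"
    \<comment> \<open>The fundamental theorem is applied on \<open>{d..a}\<close>, away from the
      singular point 0; the omitted part \<open>d powr q\<close> is at most
      \<open>e\<close>.\<close>
    define d where "d = min a (e powr (1 / q))"
    have d: "0 < d" "d \<le> a" unfolding d_def using a e by auto
    have dq: "d powr q \<le> e"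
    proof -
      have "d powr q \<le> (e powr (1 / q)) powr q" using d q unfolding d_def by (intro powr_mono2) auto
      then show ?thesis using e q by (simp add: powr_powr)
    qed
    have "ennreal (a powr q - d powr q) = (\<integral>\<^sup>+ s. ennreal (q * s powr (q - 1)) * indicator {d..a} s \<partial>lborel)"
    proof (rule nn_integral_FTC_Icc[where F = "\<lambda>s. s powr q", symmetric])
      show "(\<lambda>s. q * s powr (q - 1)) \<in> borel_measurable borel" by measurable
      show "((\<lambda>s. s powr q) has_real_derivative q * s powr (q - 1)) (at s)" if "s \<in> {d..a}" for s
        using d that by (intro has_real_derivative_powr) simp
      show "0 \<le> q * s powr (q - 1)" for s using q by simp
      show "d \<le> a" by (rule d)
    qed
    also have "\<dots> \<le> ?I"
    proof (rule nn_integral_mono_AE)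
      show "AE s in lborel. ennreal (q * s powr (q - 1)) * indicator {d..a} s \<le> ennreal (q * s powr (q - 1)) * indicator {0<..<a} s"
        using AE_lborel_singleton[of a] by eventually_elim (use d in \<open>auto simp: indicator_def\<close>)
    qed
    finally have "ennreal (a powr q - d powr q) + ennreal (d powr q) \<le> ?I + ennreal e"
      using dq by (intro add_mono ennreal_leI)
    moreover have "ennreal (a powr q) \<le> ennreal (a powr q - d powr q) + ennreal (d powr q)"
      using ennreal_plus_le[of "a powr q - d powr q" "d powr q"] by simp
    ultimately show "ennreal (a powr q) \<le> ?I + ennreal e" by (rule order_trans[rotated])
  qed
qed simp

text \<open>
  Minkowski's inequality \<open>\<parallel>f\<parallel>\<^sub>q \<le> \<integral> \<parallel>1\<^bsub>{f > s}\<^esub>\<parallel>\<^sub>q ds\<close> up to a constant: the integrand \<open>G\<close> on the right is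
  decreasing, so \<open>s G s \<le> V\<close>.
\<close>

lemma (in sigma_finite_measure) nn_integral_powr_le_layers:
  fixes f :: "'a \<Rightarrow> real"
  assumes [measurable]: "f \<in> borel_measurable M" and f: "\<And>x. f x \<ge> 0" and q: "q > 1" and V: "V \<ge> 0"
    and fin: "\<And>s. s > 0 \<Longrightarrow> emeasure M {x\<in>space M. s < f x} < \<infinity>"
    and le: "(\<integral>\<^sup>+ s. ennreal (measure M {x\<in>space M. s < f x} powr (1 / q)) * indicator {0<..} s \<partial>lborel) \<le> ennreal V"
  shows "(\<integral>\<^sup>+ x. ennreal (f x powr q) \<partial>M) \<le> ennreal (q * V powr q)"
proof -
  interpret L: pair_sigma_finite lborel M by unfold_locales
  define m where "m s = measure M {x\<in>space M. s < f x}" for s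
  define G where "G s = m s powr (1 / q)" for s
  have Gm[measurable]: "G \<in> borel_measurable borel"
  proof -
    have "m s = enn2real (\<integral>\<^sup>+ x. (if s < f x then 1 else 0) \<partial>M)" for s
    proof -
      have "(\<integral>\<^sup>+ x. (if s < f x then 1 else 0) \<partial>M) = (\<integral>\<^sup>+ x. indicator {x\<in>space M. s < f x} x \<partial>M)"
        by (intro nn_integral_cong) (auto simp: indicator_def)
      also have "\<dots> = emeasure M {x\<in>space M. s < f x}" by (rule nn_integral_indicator) measurable
      finally show ?thesis unfolding m_def measure_def by simp
    qed
    then show ?thesis unfolding G_def[abs_def] by simp
  qed
  have mG: "m s = G s powr q" for s unfolding G_def using q by (simp add: powr_powr m_def)
  have em: "emeasure M {x\<in>space M. s < f x} = ennreal (m s)" if "s > 0" for s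
    unfolding m_def using fin[OF that] by (intro emeasure_eq_ennreal_measure) auto
  have G0: "G s \<ge> 0" for s unfolding G_def by simp
  have G_anti: "G s \<le> G r" if r: "0 < r" "r \<le> s" for r s
  proof -
    have "ennreal (m s) \<le> ennreal (m r)"
      using r by (subst (1 2) em[symmetric]) (auto intro!: emeasure_mono)
    then have "m s \<le> m r" by (simp add: m_def)
    then show ?thesis unfolding G_def using q by (intro powr_mono2) (auto simp: m_def)
  qed
  have sG: "s * G s \<le> V" if s: "s > 0" for s
  proof -
    have "ennreal (s * G s) = (\<integral>\<^sup>+ r. ennreal (G s) * indicator {0<..<s} r \<partial>lborel)"
      using s G0 by (simp add: nn_integral_cmult_indicator ennreal_mult mult.commute)
    also have "\<dots> \<le> (\<integral>\<^sup>+ r. ennreal (G r) * indicator {0<..} r \<partial>lborel)"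
      using G_anti by (intro nn_integral_mono) (auto simp: indicator_def intro!: ennreal_leI)
    also have "\<dots> \<le> ennreal V" using le unfolding G_def m_def .
    finally show ?thesis using V by simp
  qed
  have "(\<integral>\<^sup>+ x. ennreal (f x powr q) \<partial>M)
     \<le> (\<integral>\<^sup>+ x. \<integral>\<^sup>+ s. ennreal (q * s powr (q - 1)) * (if 0 < s \<and> s < f x then 1 else 0) \<partial>lborel \<partial>M)"
  proof (rule nn_integral_mono)
    fix x
    show "ennreal (f x powr q) \<le> (\<integral>\<^sup>+ s. ennreal (q * s powr (q - 1)) * (if 0 < s \<and> s < f x then 1 else 0) \<partial>lborel)"
      using powr_le_nn_integral[OF f q, of x]
      by (rule order_trans) (intro nn_integral_mono, auto simp: indicator_def)
  qed
  also have "\<dots> = (\<integral>\<^sup>+ s. \<integral>\<^sup>+ x. ennreal (q * s powr (q - 1)) * (if 0 < s \<and> s < f x then 1 else 0) \<partial>M \<partial>lborel)"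
    by (rule L.Fubini') measurable
  also have "\<dots> \<le> (\<integral>\<^sup>+ s. ennreal (q * V powr (q - 1)) * (ennreal (G s) * indicator {0<..} s) \<partial>lborel)"
  proof (rule nn_integral_mono)
    fix s :: real
    show "(\<integral>\<^sup>+ x. ennreal (q * s powr (q - 1)) * (if 0 < s \<and> s < f x then 1 else 0) \<partial>M)
        \<le> ennreal (q * V powr (q - 1)) * (ennreal (G s) * indicator {0<..} s)"
    proof (cases "s > 0")
      case True
      have "(\<integral>\<^sup>+ x. ennreal (q * s powr (q - 1)) * (if 0 < s \<and> s < f x then 1 else 0) \<partial>M)
        = (\<integral>\<^sup>+ x. ennreal (q * s powr (q - 1)) * indicator {x\<in>space M. s < f x} x \<partial>M)"
        using True by (intro nn_integral_cong) (auto simp: indicator_def)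
      also have "\<dots> = ennreal (q * s powr (q - 1)) * ennreal (m s)"
        using em[OF True] by (subst nn_integral_cmult_indicator) auto
      also have "\<dots> = ennreal (q * s powr (q - 1) * m s)"
        using q by (intro ennreal_mult[symmetric]) (auto simp: m_def)
      also have "\<dots> \<le> ennreal (q * V powr (q - 1) * G s)"
      proof (rule ennreal_leI)
        have "m s = G s powr (q - 1) * G s"
        proof (cases "G s = 0")
          case False
          then have "G s > 0" using G0[of s] by simp
          then show ?thesis unfolding mG using powr_add[of "G s" "q - 1" 1] by simp
        qed (simp add: mG)
        then have "q * s powr (q - 1) * m s = q * (s * G s) powr (q - 1) * G s"
          using True G0[of s] by (simp add: powr_mult)
        also have "\<dots> \<le> q * V powr (q - 1) * G s"
          using True G0[of s] q sG[OF True] by (intro mult_right_mono mult_left_mono powr_mono2) auto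
        finally show "q * s powr (q - 1) * m s \<le> q * V powr (q - 1) * G s" .
      qed
      also have "\<dots> = ennreal (q * V powr (q - 1)) * (ennreal (G s) * indicator {0<..} s)"
        using True q G0[of s] by (simp add: ennreal_mult)
      finally show ?thesis .
    qed simp
  qed
  also have "\<dots> = ennreal (q * V powr (q - 1)) * (\<integral>\<^sup>+ s. ennreal (G s) * indicator {0<..} s \<partial>lborel)"
    by (rule nn_integral_cmult) measurable
  also have "\<dots> \<le> ennreal (q * V powr (q - 1)) * ennreal V"
    using le unfolding G_def m_def by (rule mult_left_mono) simp
  also have "\<dots> = ennreal (q * V powr (q - 1) * V)"
    using q V by (intro ennreal_mult[symmetric]) auto
  also have "q * V powr (q - 1) * V = q * V powr q"
    using V q by (cases "V = 0") (auto simp: powr_mult_base mult.commute)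
  finally show ?thesis .
qed

lemma nonlocal_energy_mono:
  assumes "\<And>x y. k x y \<le> k' x y" "\<And>x y. \<bar>f y - f x\<bar> \<le> \<bar>g y - g x\<bar>"
  shows "nonlocal_energy M k f \<le> nonlocal_energy M k' g"
  unfolding nonlocal_energy_def using assms by (intro nn_integral_mono mult_mono ennreal_leI) auto

section \<open>Coarea formula for nonlocal energies\<close>

context ahlfors_space
begin

lemma indicator_superlevel: "(indicator {x. s < f x} :: 'a \<Rightarrow> real) = (\<lambda>y. if s < f y then 1 else 0)"
  by (auto simp: fun_eq_iff indicator_def)

lemma nonlocal_energy_layers_measurable:
  fixes f :: "'a \<Rightarrow> real"
  assumes k: "(\<lambda>z. k (fst z) (snd z)) \<in> borel_measurable (M \<Otimes>\<^sub>M M)"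
    and [measurable]: "f \<in> borel_measurable M"
  shows "(\<lambda>s. nonlocal_energy M k (indicator {x. s < f x})) \<in> borel_measurable borel"
proof -
  note [measurable] = pair_compose[OF k]
  show ?thesis unfolding nonlocal_energy_def indicator_superlevel by measurable
qed

text \<open>\<open>\<bar>f y - f x\<bar>\<close> is the length of the half-open interval of levels
  \<open>s\<close> for which exactly one of \<open>x\<close>, \<open>y\<close> lies in the
  superlevel set; the rest is Tonelli, twice.\<close>

lemma nonlocal_energy_coarea:
  assumes k: "(\<lambda>z. k (fst z) (snd z)) \<in> borel_measurable (M \<Otimes>\<^sub>M M)"
    and [measurable]: "f \<in> borel_measurable M"
  shows "nonlocal_energy M k f = (\<integral>\<^sup>+ s. nonlocal_energy M k (indicator {x. s < f x}) \<partial>lborel)"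
proof -
  interpret L: pair_sigma_finite lborel M by unfold_locales
  note [measurable] = pair_compose[OF k]
  let ?d = "\<lambda>s x y. ennreal \<bar>(if s < f y then 1 else 0) - (if s < f x then 1 else 0)\<bar>"
  have len: "ennreal \<bar>f y - f x\<bar> = (\<integral>\<^sup>+ s. ?d s x y \<partial>lborel)" for x y
  proof -
    have "(\<integral>\<^sup>+ s. ?d s x y \<partial>lborel) = (\<integral>\<^sup>+ s. indicator {min (f x) (f y)..<max (f x) (f y)} s \<partial>lborel)"
      by (intro nn_integral_cong) (auto simp: indicator_def)
    also have "\<dots> = ennreal \<bar>f y - f x\<bar>" by (auto simp: max_def min_def abs_if)
    finally show ?thesis by simp
  qed
  have "nonlocal_energy M k f = (\<integral>\<^sup>+ x. \<integral>\<^sup>+ y. \<integral>\<^sup>+ s. ennreal (k x y) * ?d s x y \<partial>lborel \<partial>M \<partial>M)"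
    unfolding nonlocal_energy_def len by (intro nn_integral_cong nn_integral_cmult[symmetric]) measurable
  also have "\<dots> = (\<integral>\<^sup>+ x. \<integral>\<^sup>+ s. \<integral>\<^sup>+ y. ennreal (k x y) * ?d s x y \<partial>M \<partial>lborel \<partial>M)"
    by (intro nn_integral_cong L.Fubini') measurable
  also have "\<dots> = (\<integral>\<^sup>+ s. \<integral>\<^sup>+ x. \<integral>\<^sup>+ y. ennreal (k x y) * ?d s x y \<partial>M \<partial>M \<partial>lborel)"
    by (intro L.Fubini') measurable
  also have "\<dots> = (\<integral>\<^sup>+ s. nonlocal_energy M k (indicator {x. s < f x}) \<partial>lborel)"
    unfolding nonlocal_energy_def indicator_superlevel ..
  finally show ?thesis .
qed

end

section \<open>Isoperimetric and energy estimates for sets\<close>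

context heat_kernel_space
begin

text \<open>The Korevaar-Schoen kernel with the ball measure replaced by \<open>R powr dH\<close>:
  it becomes symmetric in \<open>x\<close> and \<open>y\<close>, at the price of Ahlfors
  constants.\<close>

definition ks_kernel :: "real \<Rightarrow> 'a \<Rightarrow> 'a \<Rightarrow> real" where
  "ks_kernel R x y = indicator {..<R} (dist x y) * R powr (- (dW - \<kappa> + dH))"

abbreviation ks_energy :: "real \<Rightarrow> ('a \<Rightarrow> real) \<Rightarrow> ennreal" where
  "ks_energy R f \<equiv> nonlocal_energy M (ks_kernel R) f"

lemma ks_kernel_measurable: "(\<lambda>z. ks_kernel R (fst z) (snd z)) \<in> borel_measurable (M \<Otimes>\<^sub>M M)"
  unfolding ks_kernel_def by measurable

lemma heat_moment_measurable:
  "t > 0 \<Longrightarrow> (\<lambda>z. heat_moment t (fst z) (snd z)) \<in> borel_measurable (M \<Otimes>\<^sub>M M)"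
  unfolding heat_moment_def by (intro borel_measurable_divide borel_measurable_times p_joint) measurable

text \<open>By conservativeness the heat sent from \<open>x\<close> outside \<open>A\<close> is
  \<open>1 - heat t (indicator A) x\<close>; the factor 2 counts the two orders of a separated pair,
  equal by symmetry.\<close>

lemma kernel_energy_heat_loss:
  assumes t: "t > 0" and A[measurable]: "A \<in> sets M" "emeasure M A < \<infinity>"
  shows "nonlocal_energy M (p t) (indicator A) = 2 * ennreal (heat_loss A t)"
proof -
  note [measurable] = p_measurable[OF t]
  have Ac[measurable]: "- A \<in> sets M" using sets.compl_sets[OF A(1)] by (simp add: Compl_eq_Diff_UNIV)
  define T where "T x y = ennreal (p t x y) * (indicator A x * indicator (- A) y)" for x y
  have Tm: "case_prod T \<in> borel_measurable (M \<Otimes>\<^sub>M M)" unfolding T_def by measurable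
  have Tm2[measurable]: "(\<lambda>y. T x y) \<in> borel_measurable M" "(\<lambda>x. \<integral>\<^sup>+ y. T x y \<partial>M) \<in> borel_measurable M"
    "(\<lambda>y. T y x) \<in> borel_measurable M" "(\<lambda>x. \<integral>\<^sup>+ y. T y x \<partial>M) \<in> borel_measurable M" for x
    unfolding T_def by measurable
  have 1: "(\<integral>\<^sup>+ x. \<integral>\<^sup>+ y. T x y \<partial>M \<partial>M) = ennreal (heat_loss A t)"
  proof -
    have "(\<integral>\<^sup>+ y. T x y \<partial>M) = ennreal (indicator A x * (1 - heat t (indicator A) x))" for x
    proof -
      have i: "integrable M (\<lambda>y. p t x y * indicator (- A) y)" "integrable M (\<lambda>y. p t x y * indicator A y)"
        by (intro kernel_op_integrable[OF t, where B = 1]; simp add: indicator_def)+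
      have "(\<integral>\<^sup>+ y. T x y \<partial>M) = (\<integral>\<^sup>+ y. indicator A x * ennreal (p t x y * indicator (- A) y) \<partial>M)"
        unfolding T_def by (intro nn_integral_cong) (auto simp: indicator_def)
      also have "\<dots> = indicator A x * (\<integral>\<^sup>+ y. ennreal (p t x y * indicator (- A) y) \<partial>M)"
        by (rule nn_integral_cmult) measurable
      also have "(\<integral>\<^sup>+ y. ennreal (p t x y * indicator (- A) y) \<partial>M) = ennreal (\<integral>y. p t x y * indicator (- A) y \<partial>M)"
        using i p_nonneg[OF t] by (intro nn_integral_eq_integral) auto
      also have "(\<integral>y. p t x y * indicator (- A) y \<partial>M) = (\<integral>y. p t x y - p t x y * indicator A y \<partial>M)"
        by (intro Bochner_Integration.integral_cong refl) (auto simp: indicator_def)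
      also have "\<dots> = 1 - heat t (indicator A) x"
        using i p_integrable[OF t, of x] conservative[OF t, of x] by (simp add: kernel_op_def)
      finally show ?thesis by (auto simp: indicator_def)
    qed
    then have "(\<integral>\<^sup>+ x. \<integral>\<^sup>+ y. T x y \<partial>M \<partial>M) = (\<integral>\<^sup>+ x. ennreal (indicator A x * (1 - heat t (indicator A) x)) \<partial>M)"
      by simp
    also have "\<dots> = ennreal (heat_loss A t)"
      unfolding heat_loss_def
    proof (rule nn_integral_eq_integral)
      have r: "0 \<le> heat t (indicator A) x" "heat t (indicator A) x \<le> 1" for x
        by (intro kernel_op_range[OF t]; simp add: indicator_def)+
      show "integrable M (\<lambda>x. indicator A x * (1 - heat t (indicator A) x))"
        by (rule heat_loss_integrable[OF t A])
      show "AE x in M. 0 \<le> indicator A x * (1 - heat t (indicator A) x)" using r by simp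
    qed
    finally show ?thesis .
  qed
  have "nonlocal_energy M (p t) (indicator A) = (\<integral>\<^sup>+ x. \<integral>\<^sup>+ y. T x y + T y x \<partial>M \<partial>M)"
    unfolding nonlocal_energy_def T_def using p_sym[OF t]
    by (intro nn_integral_cong) (auto simp: indicator_def)
  also have "\<dots> = (\<integral>\<^sup>+ x. \<integral>\<^sup>+ y. T x y \<partial>M \<partial>M) + (\<integral>\<^sup>+ x. \<integral>\<^sup>+ y. T y x \<partial>M \<partial>M)"
    by (simp add: nn_integral_add)
  also have "(\<integral>\<^sup>+ x. \<integral>\<^sup>+ y. T y x \<partial>M \<partial>M) = (\<integral>\<^sup>+ x. \<integral>\<^sup>+ y. T x y \<partial>M \<partial>M)"
    by (rule Fubini'[OF Tm])
  finally show ?thesis unfolding 1 by (simp add: mult_2)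
qed

lemma isoperimetric:
  assumes sub: "dW - \<kappa> < dH"
  shows "\<exists>C>0. \<forall>A \<tau>. A \<in> sets M \<longrightarrow> emeasure M A < \<infinity> \<longrightarrow> (\<forall>n. \<tau> n > 0) \<longrightarrow> \<tau> \<longlonglongrightarrow> 0 \<longrightarrow>
    ennreal (measure M A powr (1 - (dW - \<kappa>) / dH))
      \<le> ennreal C * liminf (\<lambda>n. moment_energy (\<tau> n) (indicator A))"
proof -
  define \<alpha> where "\<alpha> = (dW - \<kappa>) / dW"
  define \<theta> where "\<theta> = (dW - \<kappa>) / dH"
  have \<alpha>: "0 < \<alpha>" "\<alpha> < 1" unfolding \<alpha>_def using kappa by (auto simp: field_simps)
  have \<theta>: "0 < \<theta>" "\<theta> < 1" unfolding \<theta>_def using kappa sub dH_pos by (auto simp: field_simps)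
  \<comment> \<open>The leading 2 undoes the halved measure, \<open>2 powr \<alpha>\<close> comes
    from the time window up to \<open>2 * t\<close>, and \<open>(2 * cu) powr \<theta>\<close> from
    the choice of \<open>t\<close>.\<close>
  define C where "C = 2 * (cw / \<alpha> * 2 powr \<alpha> * (2 * cu) powr \<theta>)"
  have C: "C > 0" unfolding C_def using cw_pos cu_pos \<alpha> by simp
  have "ennreal (measure M A powr (1 - \<theta>)) \<le> ennreal C * liminf (\<lambda>n. moment_energy (\<tau> n) (indicator A))"
    if A[measurable]: "A \<in> sets M" "emeasure M A < \<infinity>" and \<tau>: "\<And>n. \<tau> n > 0" "\<tau> \<longlonglongrightarrow> 0" for A \<tau>
  proof (cases "measure M A = 0")
    case False
    define \<mu> where "\<mu> = measure M A"
    have \<mu>: "\<mu> > 0" unfolding \<mu>_def using False by (simp add: zero_less_measure_iff)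
    \<comment> \<open>Solves \<open>cu * t powr (- (dH / dW)) * \<mu> = 1 / 2\<close>: from time
      \<open>t\<close> on, the uniform kernel bound leaves at most half of the heat at any
      point.\<close>
    define t where "t = (2 * cu * \<mu>) powr (dW / dH)"
    have t: "t > 0" unfolding t_def using cu_pos \<mu> by simp
    have tH: "t powr (dH / dW) = 2 * cu * \<mu>" unfolding t_def using cu_pos \<mu> dH_pos dW_pos by (simp add: powr_powr)
    have t\<alpha>: "t powr \<alpha> = (2 * cu) powr \<theta> * \<mu> powr \<theta>"
      unfolding t_def \<alpha>_def \<theta>_def using cu_pos \<mu> dH_pos dW_pos by (simp add: powr_powr powr_mult)
    have loss: "\<mu> / 2 \<le> heat_loss A s" if s: "t \<le> s" for s
    proof -
      have s0: "s > 0" using s t by simp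
      note [measurable] = kernel_op_measurable[OF s0]
      have "t powr (dH / dW) \<le> s powr (dH / dW)" using s t dH_pos dW_pos by (intro powr_mono2) auto
      then have sH: "2 * cu * \<mu> \<le> s powr (dH / dW)" unfolding tH .
      have half: "heat s (indicator A) x \<le> 1 / 2" for x
      proof -
        have pb: "p s x y \<le> cu * s powr (- (dH / dW))" for y
        proof -
          have "(1 + dist x y / s powr (1 / dW)) powr (- (dW + dH + 1)) \<le> 1 powr (- (dW + dH + 1))"
            using dW_pos dH_pos by (intro powr_mono2') auto
          then have "(1 + dist x y / s powr (1 / dW)) powr (- (dW + dH + 1)) \<le> 1" by simp
          then have "cu * s powr (- (dH / dW)) * (1 + dist x y / s powr (1 / dW)) powr (- (dW + dH + 1)) \<le> cu * s powr (- (dH / dW)) * 1"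
            using cu_pos by (intro mult_left_mono) auto
          with p_upper[OF s0, of x y] show ?thesis by simp
        qed
        have "heat s (indicator A) x \<le> (\<integral>y. cu * s powr (- (dH / dW)) * indicator A y \<partial>M)"
          unfolding kernel_op_def
        proof (rule integral_mono)
          show "integrable M (\<lambda>y. p s x y * indicator A y)"
            by (intro kernel_op_integrable[OF s0, where B = 1]; simp add: indicator_def)
          show "integrable M (\<lambda>y. cu * s powr (- (dH / dW)) * indicator A y)"
            using A by (intro integrable_mult_right integrable_real_indicator)
          show "p s x y * indicator A y \<le> cu * s powr (- (dH / dW)) * indicator A y" for y
            using pb by (intro mult_right_mono) auto
        qed
        also have "\<dots> = cu * \<mu> / s powr (dH / dW)"
          using A by (simp add: \<mu>_def powr_minus divide_inverse mult_ac)
        also have "\<dots> \<le> 1 / 2" using sH s0 by (simp add: field_simps)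
        finally show ?thesis .
      qed
      have "\<mu> / 2 = (\<integral>x. indicator A x * (1 / 2) \<partial>M)" using A by (simp add: \<mu>_def)
      also have "\<dots> \<le> heat_loss A s" unfolding heat_loss_def
      proof (rule integral_mono)
        show "integrable M (\<lambda>x. indicator A x * (1 / 2) :: real)"
          using A by (intro integrable_mult_left integrable_real_indicator)
        show "integrable M (\<lambda>x. indicator A x * (1 - heat s (indicator A) x))"
          by (rule heat_loss_integrable[OF s0 A])
        show "indicator A x * (1 / 2) \<le> indicator A x * (1 - heat s (indicator A) x)" for x
          using half[of x] by (intro mult_left_mono) auto
      qed
      finally show ?thesis .
    qed
    let ?m = "liminf (\<lambda>n. moment_energy (\<tau> n) (indicator A))"
    have main: "ennreal (\<mu> / 2) \<le> ennreal (cw / \<alpha> * (2 * t) powr \<alpha>) * ?m"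
      unfolding \<alpha>_def by (rule heat_loss_liminf[OF t A \<tau>]) (use loss in auto)
    have K: "cw / \<alpha> * (2 * t) powr \<alpha> = C / 2 * \<mu> powr \<theta>"
      unfolding C_def using t t\<alpha> by (simp add: powr_mult)
    have pos: "2 * \<mu> powr (- \<theta>) \<ge> 0" by simp
    have "ennreal (\<mu> powr (1 - \<theta>)) = ennreal (2 * \<mu> powr (- \<theta>)) * ennreal (\<mu> / 2)"
    proof -
      have "\<mu> powr (1 - \<theta>) = \<mu> powr (- \<theta>) * \<mu>" using \<mu> powr_add[of \<mu> "- \<theta>" 1] by simp
      then have "\<mu> powr (1 - \<theta>) = (2 * \<mu> powr (- \<theta>)) * (\<mu> / 2)" by simp
      then show ?thesis using \<mu> pos by (simp only: ennreal_mult')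
    qed
    also have "\<dots> \<le> ennreal (2 * \<mu> powr (- \<theta>)) * (ennreal (C / 2 * \<mu> powr \<theta>) * ?m)"
      using main unfolding K by (rule mult_left_mono) simp
    also have "\<dots> = ennreal ((2 * \<mu> powr (- \<theta>)) * (C / 2 * \<mu> powr \<theta>)) * ?m"
      using pos by (simp only: ennreal_mult' mult.assoc)
    also have "(2 * \<mu> powr (- \<theta>)) * (C / 2 * \<mu> powr \<theta>) = C"
      using \<mu> by (simp add: powr_minus)
    finally show ?thesis unfolding \<mu>_def .
  qed simp
  then show ?thesis using C unfolding \<theta>_def by blast
qed

text \<open>At times comparable to \<open>R powr dW\<close> the heat kernel dominates a multiple of
  \<open>ks_kernel R\<close>, so the loss of heat bounds the energy. No smallness of
  \<open>R\<close> enters, which is what makes the supremum over all scales controllable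
  later.\<close>

lemma set_energy:
  "\<exists>C>0. \<forall>A \<tau> R. A \<in> sets M \<longrightarrow> emeasure M A < \<infinity> \<longrightarrow> (\<forall>n. \<tau> n > 0) \<longrightarrow> \<tau> \<longlonglongrightarrow> 0 \<longrightarrow> R > 0 \<longrightarrow>
    ks_energy R (indicator A)
      \<le> ennreal C * liminf (\<lambda>n. moment_energy (\<tau> n) (indicator A))"
proof -
  define \<alpha> where "\<alpha> = (dW - \<kappa>) / dW"
  have \<alpha>: "0 < \<alpha>" "\<alpha> < 1" unfolding \<alpha>_def using kappa by (auto simp: field_simps)
  \<comment> \<open>The factor \<open>2 powr (- (dH / dW))\<close> is the worst case of the lower
    kernel bound over the time window from \<open>t\<close> to \<open>2 * t\<close>.\<close>
  define b where "b = cl * 2 powr (- (dH / dW))"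
  have b: "b > 0" unfolding b_def using cl_pos by simp
  define C where "C = 2 / b * (cw / \<alpha> * 2 powr \<alpha>)"
  have C: "C > 0" unfolding C_def using b cw_pos \<alpha> by simp
  have "ks_energy R (indicator A)
      \<le> ennreal C * liminf (\<lambda>n. moment_energy (\<tau> n) (indicator A))"
    if A[measurable]: "A \<in> sets M" "emeasure M A < \<infinity>" and \<tau>: "\<And>n. \<tau> n > 0" "\<tau> \<longlonglongrightarrow> 0" and R: "R > 0" for A \<tau> R
  proof -
    let ?E = "ks_energy R (indicator A)"
    let ?m = "liminf (\<lambda>n. moment_energy (\<tau> n) (indicator A))"
    define t where "t = R powr dW"
    have t: "t > 0" unfolding t_def using R by simp
    define c where "c = b * R powr (dW - \<kappa>)"
    have c: "c > 0" unfolding c_def using b R by simp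
    have cE: "ennreal c * ?E \<le> 2 * ennreal (heat_loss A s)" if s: "t \<le> s" "s \<le> 2 * t" for s
    proof -
      have s0: "s > 0" using s t by simp
      have le: "c * ks_kernel R x y \<le> p s x y" for x y
      proof (cases "dist x y < R")
        case True
        have "R = t powr (1 / dW)" unfolding t_def using R dW_pos by (simp add: powr_powr)
        also have "\<dots> \<le> s powr (1 / dW)" using s t dW_pos by (intro powr_mono2) auto
        finally have "dist x y < s powr (1 / dW)" using True by simp
        from p_lower[OF s0 this] have "cl * s powr (- (dH / dW)) \<le> p s x y" .
        moreover have "cl * (2 * t) powr (- (dH / dW)) \<le> cl * s powr (- (dH / dW))"
          using s s0 cl_pos dH_pos dW_pos by (intro mult_left_mono powr_mono2') auto
        moreover have "cl * (2 * t) powr (- (dH / dW)) = b * R powr (- dH)"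
          unfolding b_def t_def using R dW_pos by (simp add: powr_mult powr_powr)
        moreover have "c * ks_kernel R x y = b * R powr (- dH)"
          unfolding c_def ks_kernel_def using True R by (simp add: powr_add[symmetric] algebra_simps)
        ultimately show ?thesis by simp
      next
        case False
        then show ?thesis using p_nonneg[OF s0] by (simp add: ks_kernel_def)
      qed
      note [measurable] = pair_compose[OF ks_kernel_measurable]
      have "ennreal c * ?E = nonlocal_energy M (\<lambda>x y. c * ks_kernel R x y) (indicator A)"
        unfolding nonlocal_energy_def using c
        by (simp add: nn_integral_cmult[symmetric] ennreal_mult' mult.assoc)
      also have "\<dots> \<le> nonlocal_energy M (p s) (indicator A)" using le by (intro nonlocal_energy_mono) auto
      also have "\<dots> = 2 * ennreal (heat_loss A s)" by (rule kernel_energy_heat_loss[OF s0 A])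
      finally show ?thesis .
    qed
    \<comment> \<open>Since \<open>heat_loss\<close> is real, the energy is finite; a real value
      \<open>e\<close> is needed to supply the bound \<open>X\<close> of
      \<open>heat_loss_liminf\<close>.\<close>
    have "ennreal c * ?E \<le> 2 * ennreal (heat_loss A t)" using cE[of t] t by simp
    also have "\<dots> < \<infinity>" by (simp add: ennreal_mult_less_top)
    finally have "?E < \<infinity>" using c by (auto simp: ennreal_mult_less_top)
    then obtain e where e: "e \<ge> 0" "?E = ennreal e" by (cases ?E) auto
    have "c * e / 2 \<le> heat_loss A s" if s: "t \<le> s" "s \<le> 2 * t" for s
    proof -
      have s0: "s > 0" using s t by simp
      have h: "heat_loss A s \<ge> 0" by (rule heat_loss_nonneg[OF s0 A(1)])
      have "ennreal (c * e) \<le> ennreal (2 * heat_loss A s)"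
        using cE[OF s] c e h by (simp add: ennreal_mult)
      then show ?thesis using h by simp
    qed
    then have main: "ennreal (c * e / 2) \<le> ennreal (cw / \<alpha> * (2 * t) powr \<alpha>) * ?m"
      unfolding \<alpha>_def by (rule heat_loss_liminf[OF t A \<tau>])
    have t\<alpha>: "t powr \<alpha> = R powr (dW - \<kappa>)" unfolding t_def \<alpha>_def using dW_pos by (simp add: powr_powr)
    have K: "cw / \<alpha> * (2 * t) powr \<alpha> = C * (c / 2)"
      unfolding C_def c_def using t t\<alpha> b by (simp add: powr_mult)
    have pos: "2 / c \<ge> 0" using c by simp
    have "?E = ennreal (2 / c) * ennreal (c * e / 2)"
      unfolding e(2) using c by (simp add: ennreal_mult'[symmetric])
    also have "\<dots> \<le> ennreal (2 / c) * (ennreal (C * (c / 2)) * ?m)"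
      using main unfolding K by (rule mult_left_mono) simp
    also have "\<dots> = ennreal (2 / c * (C * (c / 2))) * ?m"
      using pos by (simp only: ennreal_mult' mult.assoc)
    also have "2 / c * (C * (c / 2)) = C" using c by simp
    finally show ?thesis .
  qed
  then show ?thesis using C by blast
qed

end

section \<open>Energies at different scales\<close>

context heat_kernel_space
begin

text \<open>The moment kernel decays with order \<open>b + 1\<close>, one above the homogeneity
  \<open>b\<close> of \<open>ks_kernel\<close>. After rescaling, the shell of index \<open>j\<close>
  therefore keeps a weight of order 2^(-j), which is summable; shells below \<open>K\<close> are
  merged into one kernel.\<close>

lemma heat_moment_pointwise:
  assumes r: "r > 0"
  defines "b \<equiv> dW - \<kappa> + dH"
  shows "ennreal (heat_moment (r powr dW) x y)
    \<le> ennreal (cu * (2 ^ K) powr b) * ennreal (ks_kernel (2 ^ K * r) x y)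
      + (\<Sum>k. ennreal (cu * 2 powr b * (1 / 2) ^ K * (1 / 2) ^ k) * ennreal (ks_kernel (2 ^ (K + k + 1) * r) x y))"
proof -
  let ?a = "b + 1" and ?u = "dist x y / r"
  have b: "b > 0" unfolding b_def using kappa dH_pos by simp
  have t: "r powr dW > 0" using r by simp
  have root: "(r powr dW) powr (1 / dW) = r" using r dW_pos by (simp add: powr_powr)
  have scale: "ennreal (r powr (- b)) * indicator {..<c} ?u = ennreal (c powr b) * ennreal (ks_kernel (c * r) x y)"
    if c: "c > 0" for c
  proof -
    have "r powr (- b) = c powr b * (c * r) powr (- b)"
      using c r by (simp add: powr_mult powr_minus field_simps)
    then have "ennreal (r powr (- b)) = ennreal (c powr b) * ennreal ((c * r) powr (- b))"
      by (simp add: ennreal_mult[symmetric])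
    moreover have "?u < c \<longleftrightarrow> dist x y < c * r" using r by (simp add: field_simps)
    ultimately show ?thesis unfolding ks_kernel_def b_def[symmetric] by (auto simp: indicator_def)
  qed
  have distribute: "(e * e') * (i + (\<Sum>k. a k * j k)) = e * (e' * i) + (\<Sum>k. e * (a k * (e' * j k)))"
    for e e' i :: ennreal and a j :: "nat \<Rightarrow> ennreal"
    by (simp only: distrib_left ennreal_suminf_cmult[symmetric] mult_ac)
  have "heat_moment (r powr dW) x y \<le> cu * r powr (- b) * (1 + ?u) powr (- ?a)"
  proof -
    have "p (r powr dW) x y * dist x y powr \<kappa>
      \<le> cu * (r powr dW) powr ((\<kappa> - dH) / dW) * (1 + ?u) powr (- (dW + dH + 1 - \<kappa>))"
      using p_moment_pointwise[OF t less_imp_le[OF kappa(1)], of x y] unfolding root .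
    also have "(r powr dW) powr ((\<kappa> - dH) / dW) = r powr (\<kappa> - dH)" using dW_pos by (simp add: powr_powr)
    also have "dW + dH + 1 - \<kappa> = ?a" unfolding b_def by simp
    finally have "heat_moment (r powr dW) x y \<le> cu * r powr (\<kappa> - dH) * (1 + ?u) powr (- ?a) / r powr dW"
      unfolding heat_moment_def using t by (intro divide_right_mono) auto
    also have "\<dots> = cu * (r powr (\<kappa> - dH) / r powr dW) * (1 + ?u) powr (- ?a)" by simp
    also have "r powr (\<kappa> - dH) / r powr dW = r powr (- b)"
      unfolding b_def by (simp add: powr_diff[symmetric] algebra_simps)
    finally show ?thesis .
  qed
  then have "ennreal (heat_moment (r powr dW) x y) \<le> ennreal (cu * r powr (- b)) * ennreal ((1 + ?u) powr (- ?a))"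
    using cu_pos by (subst ennreal_mult[symmetric]) (auto intro: ennreal_leI)
  also have "\<dots> \<le> ennreal (cu * r powr (- b)) * (indicator {..<2 ^ K} ?u
      + (\<Sum>k. ennreal ((2 powr (- ?a)) ^ (K + k)) * indicator {..<2 ^ (K + k + 1)} ?u))"
    using b r by (intro mult_left_mono dyadic_powr_bound) auto
  also have "\<dots> = ennreal cu * (ennreal (r powr (- b)) * indicator {..<2 ^ K} ?u)
      + (\<Sum>k. ennreal cu * (ennreal ((2 powr (- ?a)) ^ (K + k)) * (ennreal (r powr (- b)) * indicator {..<2 ^ (K + k + 1)} ?u)))"
    unfolding ennreal_mult'[OF less_imp_le[OF cu_pos]] by (rule distribute)
  also have "ennreal cu * (ennreal (r powr (- b)) * indicator {..<2 ^ K} ?u)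
      = ennreal (cu * (2 ^ K) powr b) * ennreal (ks_kernel (2 ^ K * r) x y)"
    unfolding ennreal_mult'[OF less_imp_le[OF cu_pos]] by (subst scale) (simp_all only: zero_less_power zero_less_numeral mult.assoc)
  also have "(\<lambda>k. ennreal cu * (ennreal ((2 powr (- ?a)) ^ (K + k)) * (ennreal (r powr (- b)) * indicator {..<2 ^ (K + k + 1)} ?u)))
      = (\<lambda>k. ennreal (cu * 2 powr b * (1 / 2) ^ K * (1 / 2) ^ k) * ennreal (ks_kernel (2 ^ (K + k + 1) * r) x y))"
  proof
    fix k
    \<comment> \<open>The spare order of decay: exactly one factor 1/2 per shell survives.\<close>
    have half: "(2 powr (- ?a)) * (2 powr b) = (1 / 2 :: real)"
      by (simp add: powr_add[symmetric] powr_minus_divide)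
    have "(2 ^ (K + k + 1)) powr b = 2 powr b * (2 powr b) ^ (K + k)"
      by (simp add: powr_mult powr_power powr_powr powr_realpow[symmetric] mult.commute powr_add[symmetric] distrib_left)
    then have "(2 powr (- ?a)) ^ (K + k) * (2 ^ (K + k + 1)) powr b = 2 powr b * ((2 powr (- ?a)) * (2 powr b)) ^ (K + k)"
      by (simp only: power_mult_distrib mult_ac)
    also have "\<dots> = 2 powr b * (1 / 2) ^ (K + k)" unfolding half ..
    finally have eq: "(2 powr (- ?a)) ^ (K + k) * (2 ^ (K + k + 1)) powr b = 2 powr b * (1 / 2) ^ (K + k)" .
    have "ennreal cu * (ennreal ((2 powr (- ?a)) ^ (K + k)) * (ennreal (r powr (- b)) * indicator {..<2 ^ (K + k + 1)} ?u))
      = ennreal cu * (ennreal ((2 powr (- ?a)) ^ (K + k)) * (ennreal ((2 ^ (K + k + 1)) powr b) * ennreal (ks_kernel (2 ^ (K + k + 1) * r) x y)))"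
      by (subst scale) auto
    also have "\<dots> = ennreal (cu * ((2 powr (- ?a)) ^ (K + k) * (2 ^ (K + k + 1)) powr b)) * ennreal (ks_kernel (2 ^ (K + k + 1) * r) x y)"
      using cu_pos by (simp only: ennreal_mult' ennreal_mult'' less_imp_le zero_le_power powr_ge_zero mult.assoc)
    also have "\<dots> = ennreal (cu * 2 powr b * (1 / 2) ^ K * (1 / 2) ^ k) * ennreal (ks_kernel (2 ^ (K + k + 1) * r) x y)"
      unfolding eq by (simp add: power_add mult.assoc)
    finally show "ennreal cu * (ennreal ((2 powr (- ?a)) ^ (K + k)) * (ennreal (r powr (- b)) * indicator {..<2 ^ (K + k + 1)} ?u))
      = ennreal (cu * 2 powr b * (1 / 2) ^ K * (1 / 2) ^ k) * ennreal (ks_kernel (2 ^ (K + k + 1) * r) x y)" .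
  qed
  finally show ?thesis .
qed

text \<open>Only the energy at radius \<open>2 ^ K * r\<close> is kept explicitly. All larger scales
  are estimated by the uniform bound \<open>S\<close>, and their geometric weights add up to a
  multiple of 2^(-K).\<close>

lemma heat_moment_energy_le:
  assumes r: "r > 0" and [measurable]: "f \<in> borel_measurable M"
    and S: "\<And>R. R > 0 \<Longrightarrow> ks_energy R f \<le> S"
  defines "b \<equiv> dW - \<kappa> + dH"
  shows "moment_energy (r powr dW) f
    \<le> ennreal (cu * (2 ^ K) powr b) * ks_energy (2 ^ K * r) f
      + ennreal (2 * cu * 2 powr b * (1 / 2) ^ K) * S"
proof -
  note [measurable] = pair_compose[OF ks_kernel_measurable]
  let ?c = "cu * (2 ^ K) powr b" and ?w = "\<lambda>k. cu * 2 powr b * (1 / 2) ^ K * (1 / 2) ^ k"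
  let ?d = "\<lambda>x y. ennreal \<bar>f y - f x\<bar>"
  have "moment_energy (r powr dW) f
    \<le> (\<integral>\<^sup>+ x. \<integral>\<^sup>+ y. (ennreal ?c * (ennreal (ks_kernel (2 ^ K * r) x y) * ?d x y)
      + (\<Sum>k. ennreal (?w k) * (ennreal (ks_kernel (2 ^ (K + k + 1) * r) x y) * ?d x y))) \<partial>M \<partial>M)"
    unfolding nonlocal_energy_def
  proof (intro nn_integral_mono)
    fix x y
    have "ennreal (heat_moment (r powr dW) x y) * ?d x y \<le>
        (ennreal ?c * ennreal (ks_kernel (2 ^ K * r) x y)
      + (\<Sum>k. ennreal (?w k) * ennreal (ks_kernel (2 ^ (K + k + 1) * r) x y))) * ?d x y"
      unfolding b_def by (intro mult_right_mono heat_moment_pointwise r) simp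
    also have "\<dots> = ennreal ?c * (ennreal (ks_kernel (2 ^ K * r) x y) * ?d x y)
      + (\<Sum>k. ennreal (?w k) * (ennreal (ks_kernel (2 ^ (K + k + 1) * r) x y) * ?d x y))"
      by (simp only: distrib_right ennreal_suminf_multc[symmetric] mult.assoc)
    finally show "ennreal (heat_moment (r powr dW) x y) * ?d x y \<le> \<dots>" .
  qed
  also have "\<dots> = ennreal ?c * ks_energy (2 ^ K * r) f
      + (\<Sum>k. ennreal (?w k) * ks_energy (2 ^ (K + k + 1) * r) f)"
    unfolding nonlocal_energy_def by (simp add: nn_integral_add nn_integral_suminf nn_integral_cmult)
  also have "\<dots> \<le> ennreal ?c * ks_energy (2 ^ K * r) f + (\<Sum>k. ennreal (?w k) * S)"
    using r by (intro add_left_mono suminf_le summableI mult_left_mono S) auto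
  also have "(\<Sum>k. ennreal (?w k) * S) = (\<Sum>k. ennreal (?w k)) * S" by (rule ennreal_suminf_multc)
  also have "(\<Sum>k. ennreal (?w k)) = ennreal (cu * 2 powr b * (1 / 2) ^ K * (1 / (1 - 1 / 2)))"
    using cu_pos by (intro suminf_ennreal_eq sums_mult geometric_sums) auto
  also have "cu * 2 powr b * (1 / 2) ^ K * (1 / (1 - 1 / 2)) = 2 * cu * 2 powr b * (1 / 2) ^ K" by simp
  finally show ?thesis .
qed

section \<open>Comparison with the Korevaar-Schoen energy and uniform bounds over scales\<close>

lemma measure_ball_measurable: "(\<lambda>x. measure M (ball x R)) \<in> borel_measurable M"
proof -
  have "measure M (ball x R) = enn2real (\<integral>\<^sup>+ y. (if dist x y < R then 1 else 0) \<partial>M)" for x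
  proof -
    have "(\<integral>\<^sup>+ y. (if dist x y < R then 1 else 0) \<partial>M) = (\<integral>\<^sup>+ y. indicator (ball x R) y \<partial>M)"
      by (intro nn_integral_cong) (auto simp: indicator_def)
    also have "\<dots> = emeasure M (ball x R)" by simp
    finally show ?thesis unfolding measure_def by simp
  qed
  then show ?thesis by simp
qed

lemma ks_kernel_energy_le:
  assumes R: "R > 0" and [measurable]: "f \<in> borel_measurable M"
  shows "ks_energy R f \<le> ennreal c2 * KS_energy M (dW - \<kappa>) f R"
proof -
  note [measurable] = measure_ball_measurable
  let ?F = "\<lambda>x y. ennreal (\<bar>f y - f x\<bar> / (R powr (dW - \<kappa>) * measure M (ball x R))) * (if dist x y < R then 1 else 0)"
  have KS: "KS_energy M (dW - \<kappa>) f R = (\<integral>\<^sup>+ x. \<integral>\<^sup>+ y. ?F x y \<partial>M \<partial>M)"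
    unfolding KS_energy_def by (intro nn_integral_cong) (auto simp: indicator_def Delta_def)
  have "ks_energy R f \<le> (\<integral>\<^sup>+ x. \<integral>\<^sup>+ y. ennreal c2 * ?F x y \<partial>M \<partial>M)"
    unfolding nonlocal_energy_def
  proof (intro nn_integral_mono)
    fix x y
    show "ennreal (ks_kernel R x y) * ennreal \<bar>f y - f x\<bar> \<le> ennreal c2 * ?F x y"
    proof (cases "dist x y < R")
      case True
      \<comment> \<open>Positivity excludes the default value 0 of division by zero in
        \<open>KS_energy\<close>.\<close>
      have mpos: "measure M (ball x R) > 0"
        by (rule less_le_trans[OF mult_pos_pos[OF c1_pos] measure_ball(1)]) (use R in auto)
      have "R powr (- (dW - \<kappa> + dH)) = 1 / (R powr (dW - \<kappa>) * R powr dH)"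
        unfolding powr_add[symmetric] by (rule powr_minus_divide)
      also have "\<dots> = c2 / (R powr (dW - \<kappa>) * (c2 * R powr dH))" using c2_pos by simp
      also have "\<dots> \<le> c2 / (R powr (dW - \<kappa>) * measure M (ball x R))"
      proof (rule frac_le)
        show "0 < R powr (dW - \<kappa>) * measure M (ball x R)" using mpos R by simp
        show "R powr (dW - \<kappa>) * measure M (ball x R) \<le> R powr (dW - \<kappa>) * (c2 * R powr dH)"
          using R by (intro mult_left_mono measure_ball(2)) auto
      qed (use c2_pos in auto)
      finally have "ks_kernel R x y * \<bar>f y - f x\<bar> \<le> c2 / (R powr (dW - \<kappa>) * measure M (ball x R)) * \<bar>f y - f x\<bar>"
        using True unfolding ks_kernel_def by (intro mult_right_mono) auto
      also have "\<dots> = c2 * (\<bar>f y - f x\<bar> / (R powr (dW - \<kappa>) * measure M (ball x R)))" by simp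
      finally have "ennreal (ks_kernel R x y * \<bar>f y - f x\<bar>)
          \<le> ennreal (c2 * (\<bar>f y - f x\<bar> / (R powr (dW - \<kappa>) * measure M (ball x R))))" by (rule ennreal_leI)
      then show ?thesis
        using True by (simp only: ennreal_mult'[OF less_imp_le[OF c2_pos]] ennreal_mult''[OF abs_ge_zero] if_True mult_1_right)
    qed (simp add: ks_kernel_def)
  qed
  also have "\<dots> = ennreal c2 * KS_energy M (dW - \<kappa>) f R"
    unfolding KS by (simp add: nn_integral_cmult)
  finally show ?thesis .
qed

text \<open>Triangle inequality and integration of the kernel in one variable. The bound decays in
  \<open>R\<close> and thus covers the scales that a limit at \<open>0\<close> does not see.\<close>

lemma ks_kernel_energy_le_L1:
  assumes R: "R > 0" and [measurable]: "f \<in> borel_measurable M"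
  shows "ks_energy R f \<le> ennreal (2 * c2 * R powr (- (dW - \<kappa>))) * (\<integral>\<^sup>+ x. ennreal \<bar>f x\<bar> \<partial>M)"
proof -
  note [measurable] = pair_compose[OF ks_kernel_measurable]
  have kint: "(\<integral>\<^sup>+ y. ennreal (ks_kernel R x y) \<partial>M) \<le> ennreal (c2 * R powr (- (dW - \<kappa>)))" for x
  proof -
    have "(\<integral>\<^sup>+ y. ennreal (ks_kernel R x y) \<partial>M) = (\<integral>\<^sup>+ y. ennreal (R powr (- (dW - \<kappa> + dH))) * indicator {y. dist x y < R} y \<partial>M)"
      unfolding ks_kernel_def by (intro nn_integral_cong) (auto simp: indicator_def)
    also have "\<dots> = ennreal (R powr (- (dW - \<kappa> + dH))) * emeasure M {y. dist x y < R}"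
      by (rule nn_integral_cmult_indicator) simp
    also have "\<dots> \<le> ennreal (R powr (- (dW - \<kappa> + dH))) * ennreal (c2 * R powr dH)"
      using R by (intro mult_left_mono emeasure_ball_le) auto
    also have "\<dots> = ennreal (R powr (- (dW - \<kappa> + dH)) * (c2 * R powr dH))"
      using c2_pos by (intro ennreal_mult[symmetric]) auto
    also have "R powr (- (dW - \<kappa> + dH)) * (c2 * R powr dH) = c2 * (R powr (- (dW - \<kappa> + dH)) * R powr dH)" by simp
    also have "R powr (- (dW - \<kappa> + dH)) * R powr dH = R powr (- (dW - \<kappa>))"
      by (subst powr_add[symmetric]) simp
    finally show ?thesis .
  qed
  let ?c = "ennreal (c2 * R powr (- (dW - \<kappa>)))" and ?I = "\<integral>\<^sup>+ x. ennreal \<bar>f x\<bar> \<partial>M"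
  have 1: "(\<integral>\<^sup>+ x. \<integral>\<^sup>+ y. ennreal (ks_kernel R x y) * ennreal \<bar>f x\<bar> \<partial>M \<partial>M) \<le> ?c * ?I"
  proof -
    have "(\<integral>\<^sup>+ x. \<integral>\<^sup>+ y. ennreal (ks_kernel R x y) * ennreal \<bar>f x\<bar> \<partial>M \<partial>M)
      = (\<integral>\<^sup>+ x. (\<integral>\<^sup>+ y. ennreal (ks_kernel R x y) \<partial>M) * ennreal \<bar>f x\<bar> \<partial>M)"
      by (intro nn_integral_cong nn_integral_multc) measurable
    also have "\<dots> \<le> (\<integral>\<^sup>+ x. ?c * ennreal \<bar>f x\<bar> \<partial>M)" by (intro nn_integral_mono mult_right_mono kint) simp
    also have "\<dots> = ?c * ?I" by (rule nn_integral_cmult) measurable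
    finally show ?thesis .
  qed
  have 2: "(\<integral>\<^sup>+ x. \<integral>\<^sup>+ y. ennreal (ks_kernel R x y) * ennreal \<bar>f y\<bar> \<partial>M \<partial>M) \<le> ?c * ?I"
  proof -
    have "(\<integral>\<^sup>+ x. \<integral>\<^sup>+ y. ennreal (ks_kernel R x y) * ennreal \<bar>f y\<bar> \<partial>M \<partial>M)
      = (\<integral>\<^sup>+ y. \<integral>\<^sup>+ x. ennreal (ks_kernel R x y) * ennreal \<bar>f y\<bar> \<partial>M \<partial>M)"
      by (rule Fubini'[symmetric]) measurable
    then show ?thesis using 1 by (simp add: ks_kernel_def dist_commute)
  qed
  have "ks_energy R f
    \<le> (\<integral>\<^sup>+ x. \<integral>\<^sup>+ y. ennreal (ks_kernel R x y) * ennreal \<bar>f x\<bar> + ennreal (ks_kernel R x y) * ennreal \<bar>f y\<bar> \<partial>M \<partial>M)"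
    unfolding nonlocal_energy_def
  proof (intro nn_integral_mono)
    fix x y
    have "ennreal \<bar>f y - f x\<bar> \<le> ennreal \<bar>f x\<bar> + ennreal \<bar>f y\<bar>"
      by (rule order_trans[OF ennreal_leI ennreal_plus_le]) simp
    then have "ennreal (ks_kernel R x y) * ennreal \<bar>f y - f x\<bar> \<le> ennreal (ks_kernel R x y) * (ennreal \<bar>f x\<bar> + ennreal \<bar>f y\<bar>)"
      by (rule mult_left_mono) simp
    then show "ennreal (ks_kernel R x y) * ennreal \<bar>f y - f x\<bar>
      \<le> ennreal (ks_kernel R x y) * ennreal \<bar>f x\<bar> + ennreal (ks_kernel R x y) * ennreal \<bar>f y\<bar>"
      by (simp only: distrib_left)
  qed
  also have "\<dots> = (\<integral>\<^sup>+ x. \<integral>\<^sup>+ y. ennreal (ks_kernel R x y) * ennreal \<bar>f x\<bar> \<partial>M \<partial>M)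
     + (\<integral>\<^sup>+ x. \<integral>\<^sup>+ y. ennreal (ks_kernel R x y) * ennreal \<bar>f y\<bar> \<partial>M \<partial>M)"
    by (simp add: nn_integral_add)
  also have "\<dots> \<le> ?c * ?I + ?c * ?I" by (intro add_mono 1 2)
  also have "\<dots> = ennreal (2 * c2 * R powr (- (dW - \<kappa>))) * ?I"
    using c2_pos by (simp add: ennreal_mult' mult_2[symmetric] mult.assoc)
  finally show ?thesis .
qed

text \<open>A finite upper limit bounds the energies below some radius \<open>\<delta>\<close>;
  above it the L1 estimate takes over.\<close>

lemma KS_energy_bounded:
  assumes f: "f \<in> KS M (dW - \<kappa>)"
  shows "\<exists>S. \<forall>R>0. ks_energy R f \<le> ennreal S"
proof -
  have [measurable]: "f \<in> borel_measurable M" and L1: "integrable M f"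
    using f unfolding KS_def Lp_space_def by (auto simp: integrable_abs_iff)
  have lim: "Limsup (at_right 0) (KS_energy M (dW - \<kappa>) f) < \<infinity>" using f unfolding KS_def by simp
  then obtain B where B: "B \<ge> 0" "Limsup (at_right 0) (KS_energy M (dW - \<kappa>) f) = ennreal B"
    by (cases "Limsup (at_right 0) (KS_energy M (dW - \<kappa>) f)") auto
  have "Limsup (at_right 0) (KS_energy M (dW - \<kappa>) f) < ennreal (B + 1)" unfolding B(2) using B(1) by (simp add: ennreal_lessI)
  then have "eventually (\<lambda>R. KS_energy M (dW - \<kappa>) f R < ennreal (B + 1)) (at_right 0)" by (rule Limsup_lessD)
  then obtain \<delta> where \<delta>: "\<delta> > 0" "\<And>R. 0 < R \<Longrightarrow> R < \<delta> \<Longrightarrow> KS_energy M (dW - \<kappa>) f R < ennreal (B + 1)"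
    unfolding eventually_at_right_field by auto
  define I where "I = (\<integral>x. \<bar>f x\<bar> \<partial>M)"
  have I: "(\<integral>\<^sup>+ x. ennreal \<bar>f x\<bar> \<partial>M) = ennreal I" "I \<ge> 0"
    unfolding I_def using L1 by (auto intro!: nn_integral_eq_integral)
  let ?S = "max (c2 * (B + 1)) (2 * c2 * \<delta> powr (- (dW - \<kappa>)) * I)"
  have "ks_energy R f \<le> ennreal ?S" if R: "R > 0" for R
  proof (cases "R < \<delta>")
    case True
    have "ks_energy R f \<le> ennreal c2 * KS_energy M (dW - \<kappa>) f R"
      by (rule ks_kernel_energy_le[OF R]) simp
    also have "\<dots> \<le> ennreal c2 * ennreal (B + 1)" using \<delta>(2)[OF R True] by (intro mult_left_mono) auto
    also have "\<dots> = ennreal (c2 * (B + 1))" using c2_pos B by (intro ennreal_mult[symmetric]) auto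
    also have "\<dots> \<le> ennreal ?S" by (intro ennreal_leI) simp
    finally show ?thesis .
  next
    case False
    have "ks_energy R f \<le> ennreal (2 * c2 * R powr (- (dW - \<kappa>))) * ennreal I"
      unfolding I(1)[symmetric] by (rule ks_kernel_energy_le_L1[OF R]) simp
    also have "\<dots> = ennreal (2 * c2 * R powr (- (dW - \<kappa>)) * I)"
      using c2_pos I by (intro ennreal_mult[symmetric]) auto
    also have "\<dots> \<le> ennreal (2 * c2 * \<delta> powr (- (dW - \<kappa>)) * I)"
      using False \<delta>(1) kappa c2_pos I by (intro ennreal_leI mult_right_mono mult_left_mono powr_mono2') auto
    also have "\<dots> \<le> ennreal ?S" by (intro ennreal_leI) simp
    finally show ?thesis .
  qed
  then show ?thesis by blast
qed

text \<open>
  All energies of \<open>f\<close> are controlled by the heat moments at small scales \<open>\<tau>\<close>, hence by a large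
  multiple of the energy at scale \<open>2\<^sup>K \<tau>\<^bsup>1/dW\<^esup>\<close> plus \<open>2\<^bsup>-K\<^esup>\<close> times the supremum of the energies; for
  large \<open>K\<close> the supremum is absorbed, and only energies along a sequence realising the lower limit
  remain. This is where the finiteness of the upper limit enters.
\<close>

lemma sobolev:
  assumes sub: "dW - \<kappa> < dH" and q: "1 / q = 1 - (dW - \<kappa>) / dH"
  shows "\<exists>C>0. \<forall>f\<in>KS M (dW - \<kappa>). \<exists>v\<ge>0. Liminf (at_right 0) (KS_energy M (dW - \<kappa>) f) = ennreal v \<and>
    (\<integral>\<^sup>+ x. ennreal (\<bar>f x\<bar> powr q) \<partial>M) \<le> ennreal (q * (C * v) powr q)"
proof -
  define b where "b = dW - \<kappa> + dH"
  have q1: "q > 1"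
  proof -
    have "0 < 1 / q" "1 / q < 1" unfolding q using sub kappa dH_pos by (auto simp: field_simps)
    then show ?thesis by (simp add: field_simps zero_less_divide_iff)
  qed
  obtain C3 where C3: "C3 > 0" "\<And>A \<tau> R. A \<in> sets M \<Longrightarrow> emeasure M A < \<infinity> \<Longrightarrow> (\<forall>n. \<tau> n > 0) \<Longrightarrow> \<tau> \<longlonglongrightarrow> 0 \<Longrightarrow> R > 0 \<Longrightarrow>
    ks_energy R (indicator A)
      \<le> ennreal C3 * liminf (\<lambda>n. moment_energy (\<tau> n) (indicator A))"
    using set_energy by blast
  obtain C4 where C4: "C4 > 0" "\<And>A \<tau>. A \<in> sets M \<Longrightarrow> emeasure M A < \<infinity> \<Longrightarrow> (\<forall>n. \<tau> n > 0) \<Longrightarrow> \<tau> \<longlonglongrightarrow> 0 \<Longrightarrow>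
    ennreal (measure M A powr (1 / q))
      \<le> ennreal C4 * liminf (\<lambda>n. moment_energy (\<tau> n) (indicator A))"
    using isoperimetric[OF sub] unfolding q by blast
  define C2 where "C2 = 2 * cu * 2 powr b"
  have C2: "C2 > 0" unfolding C2_def using cu_pos by simp
  \<comment> \<open>Makes the share \<open>C3 * C2 * (1 / 2) ^ K\<close> of the supremum that is fed
    back smaller than one half.\<close>
  obtain K where K: "(1 / 2) ^ K < 1 / (2 * C3 * C2)" using real_arch_pow_inv[of "1 / (2 * C3 * C2)" "1 / 2"] C2 C3 by auto
  define A where "A = cu * (2 ^ K) powr b * c2"
  have A: "A > 0" unfolding A_def using cu_pos c2_pos by simp
  define C where "C = C4 * (2 * A)"
  have C: "C > 0" unfolding C_def using C4 A by simp
  have "\<exists>v\<ge>0. Liminf (at_right 0) (KS_energy M (dW - \<kappa>) f) = ennreal v \<and>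
    (\<integral>\<^sup>+ x. ennreal (\<bar>f x\<bar> powr q) \<partial>M) \<le> ennreal (q * (C * v) powr q)" if f: "f \<in> KS M (dW - \<kappa>)" for f
  proof -
    have fm[measurable]: "f \<in> borel_measurable M" and L1: "integrable M f"
      using f unfolding KS_def Lp_space_def by (auto simp: integrable_abs_iff)
    let ?KS = "KS_energy M (dW - \<kappa>) f"
    have "Liminf (at_right 0) ?KS \<le> Limsup (at_right 0) ?KS" by (rule Liminf_le_Limsup) simp
    also have "\<dots> < \<infinity>" using f unfolding KS_def by simp
    finally obtain v where v: "v \<ge> 0" "Liminf (at_right 0) ?KS = ennreal v"
      by (cases "Liminf (at_right 0) ?KS") auto
    \<comment> \<open>Radii along which the energy of \<open>f\<close> realises its lower
      limit.\<close>
    have "\<exists>r>0. r < 1 / Suc n \<and> ?KS r \<le> ennreal (v + 1 / Suc n)" for n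
    proof (rule ccontr)
      assume no: "\<not> ?thesis"
      have "eventually (\<lambda>r. r \<in> {0<..<1 / Suc n}) (at_right (0::real))" by (rule eventually_at_right_real) simp
      then have "eventually (\<lambda>r. ennreal (v + 1 / Suc n) \<le> ?KS r) (at_right 0)"
        by eventually_elim (use no in \<open>auto simp: not_le less_imp_le\<close>)
      then have "ennreal (v + 1 / Suc n) \<le> ennreal v" unfolding v(2)[symmetric] by (rule Liminf_bounded)
      then show False using v(1) by (simp add: ennreal_le_iff2)
    qed
    then obtain \<rho> where \<rho>: "\<And>n. \<rho> n > 0" "\<And>n. \<rho> n < 1 / Suc n" "\<And>n. ?KS (\<rho> n) \<le> ennreal (v + 1 / Suc n)"
      by metis
    have ne: "\<forall>n. \<rho> n \<noteq> 0" using \<rho>(1) by (metis less_irrefl)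
    \<comment> \<open>Chosen so that the one energy kept by \<open>heat_moment_energy_le\<close>
      sits at the radius \<open>\<rho> n\<close>.\<close>
    define \<tau> where "\<tau> n = (\<rho> n / 2 ^ K) powr dW" for n
    have \<tau>pos: "\<forall>n. \<tau> n > 0" unfolding \<tau>_def using ne by simp
    have \<rho>0: "\<rho> \<longlonglongrightarrow> 0"
    proof (rule tendsto_sandwich[OF _ _ tendsto_const])
      show "(\<lambda>n. 1 / real (Suc n)) \<longlonglongrightarrow> 0" using lim_inverse_n' LIMSEQ_Suc by blast
      show "\<forall>\<^sub>F n in sequentially. 0 \<le> \<rho> n" "\<forall>\<^sub>F n in sequentially. \<rho> n \<le> 1 / real (Suc n)"
        using \<rho> by (auto intro!: always_eventually less_imp_le)
    qed
    have \<tau>0: "\<tau> \<longlonglongrightarrow> 0"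
    proof -
      have "(\<lambda>n. (\<rho> n / 2 ^ K) powr dW) \<longlonglongrightarrow> (0 / 2 ^ K) powr dW"
        using \<rho>(1) dW_pos by (intro tendsto_powr' tendsto_divide \<rho>0 tendsto_const) (auto simp: ne intro!: always_eventually less_imp_le)
      then show ?thesis unfolding \<tau>_def using dW_pos by simp
    qed
    \<comment> \<open>Taking absolute values does not raise energies, and every superlevel set of
      \<open>g\<close> at a positive level has finite measure, as the set estimates require.\<close>
    define g where "g x = \<bar>f x\<bar>" for x
    have gm[measurable]: "g \<in> borel_measurable M" unfolding g_def by measurable
    have g0: "g x \<ge> 0" for x unfolding g_def by simp
    have gf: "nonlocal_energy M k g \<le> nonlocal_energy M k f" for k
      unfolding g_def by (intro nonlocal_energy_mono) auto
    obtain S where S: "\<And>R. R > 0 \<Longrightarrow> ks_energy R f \<le> ennreal S" using KS_energy_bounded[OF f] by blast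
    define s where "s = enn2real (SUP R\<in>{0<..}. ks_energy R g)"
    have "(SUP R\<in>{0<..}. ks_energy R g) \<le> ennreal S"
      by (intro SUP_least) (auto intro: order_trans[OF gf S])
    then have "(SUP R\<in>{0<..}. ks_energy R g) < \<infinity>" by (rule le_less_trans) simp
    then have s: "(SUP R\<in>{0<..}. ks_energy R g) = ennreal s" "s \<ge> 0" unfolding s_def by auto
    have s_upper: "ks_energy R g \<le> ennreal s" if "R > 0" for R
      unfolding s(1)[symmetric] using that by (intro SUP_upper) auto
    define m where "m = liminf (\<lambda>n. moment_energy (\<tau> n) g)"
    define B where "B = C2 * (1 / 2) ^ K * s"
    have B0: "B \<ge> 0" unfolding B_def using C2 s by simp
    have m_le: "m \<le> ennreal (A * v + B)"
    proof -
      have step: "moment_energy (\<tau> n) g \<le> ennreal (A * (v + 1 / Suc n) + B)" for n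
      proof -
        let ?r = "\<rho> n / 2 ^ K"
        have r: "?r > 0" using \<rho>(1) by simp
        have rr: "2 ^ K * ?r = \<rho> n" by simp
        have v1: "v + 1 / Suc n \<ge> 0" using v by simp
        have "moment_energy (\<tau> n) g
          \<le> ennreal (cu * (2 ^ K) powr b) * ks_energy (2 ^ K * ?r) g + ennreal (2 * cu * 2 powr b * (1 / 2) ^ K) * ennreal s"
          unfolding \<tau>_def b_def by (rule heat_moment_energy_le[OF r gm s_upper])
        also have "\<dots> \<le> ennreal (cu * (2 ^ K) powr b) * (ennreal c2 * ennreal (v + 1 / Suc n)) + ennreal (2 * cu * 2 powr b * (1 / 2) ^ K) * ennreal s"
          unfolding rr
          by (intro add_right_mono mult_left_mono order_trans[OF gf order_trans[OF ks_kernel_energy_le[OF \<rho>(1) fm]]] \<rho>(3)) auto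
        also have "\<dots> = ennreal (A * (v + 1 / Suc n)) + ennreal B"
          unfolding A_def B_def C2_def using cu_pos c2_pos v1 s by (simp add: ennreal_mult'[symmetric] ennreal_mult''[symmetric] mult_ac)
        also have "\<dots> = ennreal (A * (v + 1 / Suc n) + B)"
          using A v1 B0 by (intro ennreal_plus[symmetric] mult_nonneg_nonneg) auto
        finally show ?thesis .
      qed
      have l1: "(\<lambda>n. 1 / real (Suc n)) \<longlonglongrightarrow> 0" using lim_inverse_n' LIMSEQ_Suc by blast
      have "(\<lambda>n. A * (v + 1 / real (Suc n)) + B) \<longlonglongrightarrow> A * (v + 0) + B" by (intro tendsto_intros l1)
      then have "(\<lambda>n. ennreal (A * (v + 1 / real (Suc n)) + B)) \<longlonglongrightarrow> ennreal (A * v + B)"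
        by (intro tendsto_ennrealI) simp
      then have "liminf (\<lambda>n. ennreal (A * (v + 1 / real (Suc n)) + B)) = ennreal (A * v + B)"
        by (intro lim_imp_Liminf) auto
      moreover have "m \<le> liminf (\<lambda>n. ennreal (A * (v + 1 / real (Suc n)) + B))"
        unfolding m_def by (intro Liminf_mono always_eventually allI step)
      ultimately show ?thesis by simp
    qed
    let ?m = "\<lambda>h. liminf (\<lambda>n. moment_energy (\<tau> n) (indicator {x. h < g x}))"
    have layer_m[measurable]: "?m \<in> borel_measurable borel"
    proof -
      have [measurable]: "(\<lambda>h. moment_energy (\<tau> n) (indicator {x. h < g x})) \<in> borel_measurable borel" for n
        using \<tau>pos by (intro nonlocal_energy_layers_measurable heat_moment_measurable gm) auto
      show ?thesis by measurable
    qed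
    \<comment> \<open>Fatou's lemma, then the coarea formula at each scale. It applies because the
      sequence \<open>\<tau>\<close> is the same for all levels \<open>h\<close>.\<close>
    have layers: "(\<integral>\<^sup>+ h. ?m h \<partial>lborel) \<le> m"
    proof -
      have "(\<integral>\<^sup>+ h. ?m h \<partial>lborel) \<le> liminf (\<lambda>n. \<integral>\<^sup>+ h. moment_energy (\<tau> n) (indicator {x. h < g x}) \<partial>lborel)"
        using \<tau>pos nonlocal_energy_layers_measurable[OF heat_moment_measurable gm] by (intro nn_integral_liminf) auto
      also have "\<dots> = m"
        unfolding m_def using \<tau>pos by (simp add: nonlocal_energy_coarea[OF heat_moment_measurable gm])
      finally show ?thesis .
    qed
    have level[measurable]: "{x. h < g x} \<in> sets M" for h
    proof -
      have "{x \<in> space M. h < g x} \<in> sets M" by measurable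
      then show ?thesis by simp
    qed
    have level_fin: "emeasure M {x. h < g x} < \<infinity>" if h: "h > 0" for h
    proof -
      have "integrable M g" unfolding g_def using L1 by simp
      from integral_Markov_inequality[OF this _ h] g0
      have "emeasure M {x\<in>space M. g x \<ge> h} \<le> ennreal (1 / h * (\<integral>x. g x \<partial>M))" by simp
      moreover have "emeasure M {x. h < g x} \<le> emeasure M {x\<in>space M. g x \<ge> h}"
        by (intro emeasure_mono) auto
      ultimately show ?thesis by (metis ennreal_less_top infinity_ennreal_def order_le_less_trans)
    qed
    \<comment> \<open>The set estimate has a right-hand side that does not depend on
      \<open>R\<close>, so it passes through the coarea formula to the supremum.\<close>
    have s_le: "ennreal s \<le> ennreal C3 * m"
      unfolding s(1)[symmetric]
    proof (rule SUP_least)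
      fix R :: real assume "R \<in> {0<..}"
      then have R: "R > 0" by simp
      have "ks_energy R g = (\<integral>\<^sup>+ h. ks_energy R (indicator {x. h < g x}) \<partial>lborel)"
        by (rule nonlocal_energy_coarea[OF ks_kernel_measurable gm])
      also have "\<dots> \<le> (\<integral>\<^sup>+ h. ennreal C3 * ?m h \<partial>lborel)"
      proof (rule nn_integral_mono_AE)
        show "AE h in lborel. ks_energy R (indicator {x. h < g x}) \<le> ennreal C3 * ?m h"
          using AE_lborel_singleton[of 0]
        proof eventually_elim
          case (elim h)
          show ?case
          proof (cases "h > 0")
            case True
            then show ?thesis by (intro C3(2) level level_fin \<tau>pos \<tau>0 R)
          next
            case False
            \<comment> \<open>A negative level gives the whole space, which has infinite measure but
              zero energy; the level 0 was discarded as a null set.\<close>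
            then have "{x. h < g x} = UNIV" using elim g0 by (auto intro: less_le_trans[of h 0])
            then show ?thesis by (simp add: nonlocal_energy_def)
          qed
        qed
      qed
      also have "\<dots> = ennreal C3 * (\<integral>\<^sup>+ h. ?m h \<partial>lborel)" by (rule nn_integral_cmult) (use layer_m in simp)
      also have "\<dots> \<le> ennreal C3 * m" using layers by (rule mult_left_mono) simp
      finally show "ks_energy R g \<le> ennreal C3 * m" .
    qed
    have AvB: "A * v + B \<ge> 0" using A v B0 by simp
    have "ennreal s \<le> ennreal C3 * ennreal (A * v + B)" using s_le m_le by (meson mult_left_mono order_trans zero_le)
    also have "\<dots> = ennreal (C3 * (A * v + B))" using C3(1) AvB by (intro ennreal_mult[symmetric]) auto
    finally have "s \<le> C3 * (A * v + B)" using C3(1) AvB by simp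
    then have s_bound: "s \<le> C3 * (A * v) + C3 * B" by (simp only: distrib_left)
    \<comment> \<open>Absorption: at most half of \<open>s\<close> returns on the right, and since
      \<open>s\<close> is finite it can be subtracted.\<close>
    have "C3 * C2 * (1 / 2) ^ K \<le> C3 * C2 * (1 / (2 * C3 * C2))" using K C2 C3(1) by (intro mult_left_mono) auto
    also have "\<dots> = 1 / 2" using C2 C3(1) by simp
    finally have "(C3 * C2 * (1 / 2) ^ K) * s \<le> (1 / 2) * s" using s(2) by (rule mult_right_mono)
    then have "C3 * B \<le> s / 2" unfolding B_def by (simp add: mult_ac)
    with s_bound have "C3 * B \<le> C3 * (A * v)" by linarith
    then have "A * v + B \<le> 2 * A * v" using C3(1) by simp
    then have m2: "m \<le> ennreal (2 * A * v)" by (rule order_trans[OF m_le ennreal_leI])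
    have "(\<integral>\<^sup>+ h. ennreal (measure M {x\<in>space M. h < g x} powr (1 / q)) * indicator {0<..} h \<partial>lborel)
      \<le> (\<integral>\<^sup>+ h. ennreal C4 * ?m h \<partial>lborel)"
    proof (rule nn_integral_mono)
      fix h :: real
      show "ennreal (measure M {x\<in>space M. h < g x} powr (1 / q)) * indicator {0<..} h \<le> ennreal C4 * ?m h"
      proof (cases "h > 0")
        case True
        have "ennreal (measure M {x. h < g x} powr (1 / q)) \<le> ennreal C4 * ?m h"
          using True by (intro C4(2) level level_fin \<tau>pos \<tau>0)
        then show ?thesis using True by simp
      qed simp
    qed
    also have "\<dots> = ennreal C4 * (\<integral>\<^sup>+ h. ?m h \<partial>lborel)" by (rule nn_integral_cmult) (use layer_m in simp)
    also have "\<dots> \<le> ennreal C4 * ennreal (2 * A * v)" using order_trans[OF layers m2] by (rule mult_left_mono) simp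
    also have "\<dots> = ennreal (C * v)" unfolding C_def using C4(1) A v by (subst ennreal_mult[symmetric]) (auto simp: mult_ac)
    finally have layers_V: "(\<integral>\<^sup>+ h. ennreal (measure M {x\<in>space M. h < g x} powr (1 / q)) * indicator {0<..} h \<partial>lborel) \<le> ennreal (C * v)" .
    have "(\<integral>\<^sup>+ x. ennreal (g x powr q) \<partial>M) \<le> ennreal (q * (C * v) powr q)"
      using C v level_fin
      by (intro sigma_finite_measure.nn_integral_powr_le_layers[OF sigma_finite gm g0 q1 _ _ layers_V]) auto
    then show ?thesis using v unfolding g_def by blast
  qed
  then show ?thesis using C by blast
qed

end

section \<open>From sub-Gaussian Dirichlet spaces to heat kernel spaces\<close>

text \<open>From \<open>ln w \<le> w - 1\<close> one gets z^k \<le> (k/c)^k exp(c z); take z =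
  u^delta and k = m/delta. For \<open>u > 1\<close> use \<open>1 + u \<le> 2 * u\<close>;
  \<open>L \<ge> 1\<close> covers small \<open>u\<close>.\<close>

lemma exp_powr_decay:
  fixes c \<delta> m :: real
  assumes c: "c > 0" and \<delta>: "\<delta> > 0" and m: "m > 0"
  shows "\<exists>C>0. \<forall>u\<ge>0. exp (- c * u powr \<delta>) \<le> C * (1 + u) powr (- m)"
proof -
  define k where "k = m / \<delta>"
  have k: "k > 0" unfolding k_def using m \<delta> by simp
  define L where "L = max 1 ((k / c) powr k)"
  have L: "L \<ge> 1" "L \<ge> (k / c) powr k" unfolding L_def by auto
  show ?thesis
  proof (intro exI conjI allI impI)
    show "2 powr m * L > 0" using L by simp
    fix u :: real assume u: "u \<ge> 0"
    have "(1 + u) powr m \<le> 2 powr m * L * exp (c * u powr \<delta>)"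
    proof (cases "u \<le> 1")
      case True
      have "(1 + u) powr m \<le> 2 powr m * 1" using True u m by (simp add: powr_mono2)
      also have "\<dots> \<le> 2 powr m * (L * exp (c * u powr \<delta>))"
        using L c u by (intro mult_left_mono) (auto intro: order_trans[OF _ mult_mono[of 1 L 1]])
      finally show ?thesis by simp
    next
      case False
      define z where "z = u powr \<delta>"
      have z: "z > 0" unfolding z_def using False by simp
      have "z powr k \<le> (k / c) powr k * exp (c * z)"
      proof -
        have "ln (c * z / k) \<le> c * z / k - 1" using c z k by (intro ln_le_minus_one) auto
        then have "ln (c * z / k) \<le> c * z / k" by simp
        then have "k * ln (c * z / k) \<le> c * z" using k by (simp add: field_simps)
        then have "(c * z / k) powr k \<le> exp (c * z)" using c z k by (simp add: powr_def)
        then have "(k / c) powr k * (c * z / k) powr k \<le> (k / c) powr k * exp (c * z)" by (intro mult_left_mono) auto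
        moreover have "(k / c) powr k * (c * z / k) powr k = z powr k"
          using c z k by (subst powr_mult[symmetric]) auto
        ultimately show ?thesis by simp
      qed
      also have "\<dots> \<le> L * exp (c * z)" using L by (intro mult_right_mono) auto
      finally have um: "u powr m \<le> L * exp (c * z)" unfolding z_def k_def using \<delta> by (simp add: powr_powr)
      have "(1 + u) powr m \<le> (2 * u) powr m" using False m by (intro powr_mono2) auto
      also have "\<dots> = 2 powr m * u powr m" using False by (simp add: powr_mult)
      also have "\<dots> \<le> 2 powr m * (L * exp (c * z))" using um by (intro mult_left_mono) auto
      finally show ?thesis unfolding z_def by simp
    qed
    then have "exp (- (c * u powr \<delta>)) * (1 + u) powr m \<le> exp (- (c * u powr \<delta>)) * (2 powr m * L * exp (c * u powr \<delta>))"
      by (intro mult_left_mono) auto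
    also have "\<dots> = 2 powr m * L * (exp (- (c * u powr \<delta>)) * exp (c * u powr \<delta>))" by (simp only: mult_ac)
    also have "exp (- (c * u powr \<delta>)) * exp (c * u powr \<delta>) = 1" by (simp add: exp_minus)
    finally have le: "exp (- (c * u powr \<delta>)) * (1 + u) powr m \<le> 2 powr m * L" by simp
    have "exp (- (c * u powr \<delta>)) = exp (- (c * u powr \<delta>)) * (1 + u) powr m * (1 + u) powr (- m)"
      using u by (simp add: powr_minus)
    also have "\<dots> \<le> 2 powr m * L * (1 + u) powr (- m)" using le by (rule mult_right_mono) simp
    finally show "exp (- c * u powr \<delta>) \<le> 2 powr m * L * (1 + u) powr (- m)" by simp
  qed
qed

section \<open>From almost everywhere to everywhere, by continuity\<close>

context ahlfors_space
begin

lemma ball_pos: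
  assumes "r > 0"
  shows "emeasure M (ball x r) > 0"
  by (rule less_le_trans[OF _ ball_lower]) (use assms c1_pos in auto)

text \<open>Balls have positive measure, so an open set of disagreement cannot be null.\<close>

lemma continuous_AE_eq:
  fixes f g :: "'a \<Rightarrow> real"
  assumes c: "continuous_on UNIV f" "continuous_on UNIV g" and ae: "AE x in M. f x = g x"
  shows "f x = g x"
proof (rule ccontr)
  assume n: "f x \<noteq> g x"
  have "open {x. f x \<noteq> g x}" using c by (rule open_Collect_neq)
  then obtain r where r: "r > 0" "ball x r \<subseteq> {x. f x \<noteq> g x}"
    by (rule openE[of _ x]) (use n in auto)
  have "AE y in M. y \<notin> ball x r" using ae by eventually_elim (use r in auto)
  then have "ball x r \<in> null_sets M" by (rule AE_iff_null_sets[THEN iffD2, rotated]) simp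
  then show False using ball_pos[OF r(1), of x] by (simp add: null_sets_def)
qed

text \<open>A rectangle of balls inside the open set of negativity has positive product measure.
  Applied to differences, it upgrades the kernel bounds to every pair of points.\<close>

lemma continuous_AE_nonneg_pair:
  fixes f :: "'a \<times> 'a \<Rightarrow> real"
  assumes c: "continuous_on UNIV f" and ae: "AE z in M \<Otimes>\<^sub>M M. 0 \<le> f z"
  shows "0 \<le> f z"
proof (rule ccontr)
  assume n: "\<not> 0 \<le> f z"
  have U: "open {z. f z < 0}" using c by (intro open_Collect_less) (auto simp: continuous_on_const)
  obtain A B where AB: "open A" "open B" "z \<in> A \<times> B" "A \<times> B \<subseteq> {z. f z < 0}"
    by (rule open_prod_elim[OF U, of z]) (use n in auto)
  obtain r where r: "r > 0" "ball (fst z) r \<subseteq> A" by (rule openE[OF AB(1), of "fst z"]) (use AB in auto)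
  obtain s where s: "s > 0" "ball (snd z) s \<subseteq> B" by (rule openE[OF AB(2), of "snd z"]) (use AB in auto)
  let ?R = "ball (fst z) r \<times> ball (snd z) s"
  have R: "?R \<in> sets (M \<Otimes>\<^sub>M M)" by simp
  have "?R \<in> null_sets (M \<Otimes>\<^sub>M M)"
  proof (rule AE_iff_null_sets[OF R, THEN iffD2])
    show "AE w in M \<Otimes>\<^sub>M M. w \<notin> ?R" using ae by eventually_elim (use r s AB(4) in force)
  qed
  then have "emeasure M (ball (fst z) r) * emeasure M (ball (snd z) s) = 0"
    using sigma_finite_measure.emeasure_pair_measure_Times[OF sigma_finite, of "ball (fst z) r" M "ball (snd z) s"]
    by (simp add: null_sets_def)
  then show False using ball_pos[OF r(1), of "fst z"] ball_pos[OF s(1), of "snd z"] by auto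
qed

lemma indicator_L2:
  assumes "A \<in> sets M" "emeasure M A < \<infinity>"
  shows "(indicator A :: 'a \<Rightarrow> real) \<in> L2 M"
proof -
  have "(\<lambda>x. indicator A x * indicator A x :: real) = indicator A" by (auto simp: indicator_def)
  then show ?thesis using assms by (simp add: L2_iff integrable_indicator_iff)
qed

end

lemma continuous_sub_Gaussian:
  assumes t: "t > 0" and d: "d_W > 1"
  shows "continuous_on UNIV (\<lambda>(x, y :: 'a :: metric_space). sub_Gaussian d_H d_W c t x y)"
proof -
  have dist: "continuous_on UNIV (\<lambda>z :: 'a \<times> 'a. dist (fst z) (snd z))" by (intro continuous_intros)
  have power: "continuous_on UNIV (\<lambda>z :: 'a \<times> 'a. dist (fst z) (snd z) powr d_W)"
    by (rule continuous_on_powr'[OF dist continuous_on_const]) (use d in auto)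
  have quotient: "continuous_on UNIV (\<lambda>z :: 'a \<times> 'a. dist (fst z) (snd z) powr d_W / t)"
    by (rule continuous_on_divide[OF power continuous_on_const]) (use t in auto)
  have "continuous_on UNIV (\<lambda>z :: 'a \<times> 'a. (dist (fst z) (snd z) powr d_W / t) powr (1 / (d_W - 1)))"
    by (rule continuous_on_powr'[OF quotient continuous_on_const]) (use d t in auto)
  then show ?thesis
    unfolding sub_Gaussian_def case_prod_beta
    by (intro continuous_on_mult continuous_on_exp continuous_on_const)
qed

text \<open>Expresses the exponent through the parabolic distance d / t^(1/dW), the variable in
  which the relaxed polynomial decay is stated.\<close>

lemma sub_Gaussian_scaled:
  assumes t: "t > 0" and d: "d_W > 1"
  shows "(dist x y powr d_W / t) powr (1 / (d_W - 1)) = (dist x y / t powr (1 / d_W)) powr (d_W / (d_W - 1))"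
proof -
  have "dist x y powr d_W / t = (dist x y / t powr (1 / d_W)) powr d_W"
    using t d by (simp add: powr_divide powr_powr)
  then show ?thesis by (simp add: powr_powr)
qed

lemma Linf_norm_le:
  assumes [measurable]: "g \<in> borel_measurable M" and g: "\<And>x. \<bar>g x\<bar> \<le> B"
  shows "g \<in> Linf_space M" "Linf_norm M g \<le> B"
proof -
  have B: "B \<ge> 0" using g[of undefined] by linarith
  have e: "esssup M (\<lambda>x. ennreal \<bar>g x\<bar>) \<le> ennreal B"
    by (rule esssup_I) (use g in \<open>auto intro: ennreal_leI\<close>)
  then have "esssup M (\<lambda>x. ennreal \<bar>g x\<bar>) < \<infinity>" by (rule le_less_trans) simp
  then show "g \<in> Linf_space M" unfolding Linf_space_def by simp
  show "Linf_norm M g \<le> B" unfolding Linf_norm_def using e B by (metis enn2real_ennreal enn2real_mono ennreal_less_top infinity_ennreal_def)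
qed

text \<open>Trades the essential supremum for any pointwise bound.\<close>

lemma wBE_bounded:
  assumes "wBE M p d_W \<kappa>"
  shows "\<exists>C>0. \<forall>t>0. \<forall>g B x y. g \<in> borel_measurable M \<longrightarrow> (\<forall>z. \<bar>g z\<bar> \<le> B) \<longrightarrow>
    \<bar>kernel_op M p t g x - kernel_op M p t g y\<bar> \<le> C * (dist x y powr \<kappa> / t powr (\<kappa> / d_W)) * B"
proof -
  obtain C where C: "C > 0" "\<And>t g x y. t > 0 \<Longrightarrow> g \<in> Linf_space M \<Longrightarrow>
      \<bar>kernel_op M p t g x - kernel_op M p t g y\<bar> \<le> C * (dist x y powr \<kappa> / t powr (\<kappa> / d_W)) * Linf_norm M g"
    using assms unfolding wBE_def by blast
  show ?thesis
  proof (intro exI conjI allI impI)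
    fix t B :: real and g :: "'a \<Rightarrow> real" and x y
    assume t: "t > 0" and g: "g \<in> borel_measurable M" "\<forall>z. \<bar>g z\<bar> \<le> B"
    note L = Linf_norm_le[OF g(1), of B]
    have "\<bar>kernel_op M p t g x - kernel_op M p t g y\<bar> \<le> C * (dist x y powr \<kappa> / t powr (\<kappa> / d_W)) * Linf_norm M g"
      using g L by (intro C(2)[OF t]) auto
    also have "\<dots> \<le> C * (dist x y powr \<kappa> / t powr (\<kappa> / d_W)) * B"
      using g L C(1) by (intro mult_left_mono) auto
    finally show "\<bar>kernel_op M p t g x - kernel_op M p t g y\<bar> \<le> C * (dist x y powr \<kappa> / t powr (\<kappa> / d_W)) * B" .
  qed (rule C(1))
qed

lemma hoelder_continuous_on:
  fixes f :: "'a::metric_space \<Rightarrow> real"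
  assumes f: "\<And>x y. \<bar>f x - f y\<bar> \<le> K * dist x y powr \<kappa>" and \<kappa>: "\<kappa> > 0"
  shows "continuous_on UNIV f"
  unfolding continuous_on_def
proof
  fix x :: 'a
  have "((\<lambda>y. K * dist y x powr \<kappa>) \<longlongrightarrow> K * dist x x powr \<kappa>) (at x)"
    using \<kappa> by (intro tendsto_mult tendsto_const tendsto_powr' tendsto_dist tendsto_ident_at) auto
  then have "((\<lambda>y. K * dist y x powr \<kappa>) \<longlongrightarrow> 0) (at x)" using \<kappa> by simp
  then have "((\<lambda>y. f y - f x) \<longlongrightarrow> 0) (at x)"
    by (rule Lim_null_comparison[rotated]) (use f in auto)
  then show "(f \<longlongrightarrow> f x) (at x)" by (simp add: LIM_zero_iff)
qed

section \<open>Pointwise symmetry of the kernel\<close>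

context kernel_space
begin

lemma kernel_op_indicator_pair:
  assumes t: "t > 0" and [measurable]: "A \<in> sets M" "B \<in> sets M" and fin: "emeasure M B < \<infinity>"
  shows "ennreal (L2_inner M (heat t (indicator A)) (indicator B))
    = (\<integral>\<^sup>+ x. \<integral>\<^sup>+ y. ennreal (p t x y) * (indicator B x * indicator A y) \<partial>M \<partial>M)"
proof -
  note [measurable] = p_measurable[OF t] kernel_op_measurable[OF t]
  let ?H = "heat t (indicator A)"
  obtain C where C: "\<And>x. heat t (\<lambda>_. 1) x \<le> C" using kernel_op_one_bounds t by blast
  have i: "integrable M (\<lambda>y. p t x y * indicator A y)" for x
    by (intro kernel_op_integrable[OF t, where B = 1]) (auto simp: indicator_def)
  have H: "0 \<le> ?H x" "?H x \<le> C" for x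
    using kernel_op_indicator_range[OF t assms(2), of x] C[of x] by auto
  have C0: "C \<ge> 0" using H[of undefined] by simp
  have "integrable M (\<lambda>x. ?H x * indicator B x)"
  proof (rule Bochner_Integration.integrable_bound)
    show "integrable M (\<lambda>x. C * indicator B x)" using fin by (intro integrable_mult_right integrable_real_indicator) auto
    show "AE x in M. norm (?H x * indicator B x) \<le> norm (C * indicator B x)"
      using H C0 by (intro AE_I2) (auto simp: indicator_def)
  qed measurable
  then have "ennreal (L2_inner M ?H (indicator B)) = (\<integral>\<^sup>+ x. ennreal (?H x * indicator B x) \<partial>M)"
    unfolding L2_inner_def using H by (intro nn_integral_eq_integral[symmetric]) auto
  also have "\<dots> = (\<integral>\<^sup>+ x. \<integral>\<^sup>+ y. ennreal (p t x y) * (indicator B x * indicator A y) \<partial>M \<partial>M)"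
  proof (rule nn_integral_cong)
    fix x
    have "ennreal (?H x) = (\<integral>\<^sup>+ y. ennreal (p t x y * indicator A y) \<partial>M)"
      unfolding kernel_op_def using i p_nonneg[OF t] by (intro nn_integral_eq_integral[symmetric]) auto
    then have "ennreal (?H x * indicator B x) = indicator B x * (\<integral>\<^sup>+ y. ennreal (p t x y * indicator A y) \<partial>M)"
      by (auto simp: indicator_def)
    also have "\<dots> = (\<integral>\<^sup>+ y. indicator B x * ennreal (p t x y * indicator A y) \<partial>M)"
      by (rule nn_integral_cmult[symmetric]) measurable
    also have "\<dots> = (\<integral>\<^sup>+ y. ennreal (p t x y) * (indicator B x * indicator A y) \<partial>M)"
      by (intro nn_integral_cong) (auto simp: indicator_def)
    finally show "ennreal (?H x * indicator B x) = \<dots>" .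
  qed
  finally show ?thesis .
qed

text \<open>Symmetry tested on indicators of balls equates the integrals of the kernel and of its
  transpose over small rectangles; by continuity an asymmetry at one point would persist on such a
  rectangle.\<close>

lemma kernel_symmetric:
  assumes t: "t > 0" and cont: "continuous_on UNIV (\<lambda>(x, y). p t x y)"
    and sym: "\<And>A B. A \<in> sets M \<Longrightarrow> B \<in> sets M \<Longrightarrow> emeasure M A < \<infinity> \<Longrightarrow> emeasure M B < \<infinity> \<Longrightarrow>
      L2_inner M (heat t (indicator A)) (indicator B) = L2_inner M (indicator A) (heat t (indicator B))"
  shows "p t x y = p t y x"
proof -
  note [measurable] = p_measurable[OF t]
  have le: "p t x y \<le> p t y x" for x y
  proof (rule ccontr)
    assume "\<not> p t x y \<le> p t y x"
    then obtain a where a: "p t y x < a" "a < p t x y" using dense[of "p t y x" "p t x y"] by auto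
    \<comment> \<open>A second level leaves a strict gap: near the point one kernel stays below
      \<open>a\<close>, the other above \<open>b\<close>, and the rectangle has positive finite
      measure.\<close>
    obtain b where b: "a < b" "b < p t x y" using dense[OF a(2)] by auto
    have "continuous_on UNIV (\<lambda>z :: 'a \<times> 'a. (snd z, fst z))" by (intro continuous_intros)
    from continuous_on_compose2[OF cont this]
    have swap: "continuous_on UNIV (\<lambda>z. p t (snd z) (fst z))" by simp
    have cont': "continuous_on UNIV (\<lambda>z. p t (fst z) (snd z))" using cont by (simp add: case_prod_beta)
    have U: "open ({z. p t (snd z) (fst z) < a} \<inter> {z. b < p t (fst z) (snd z)})" (is "open ?U")
      using swap cont' by (intro open_Int open_Collect_less continuous_on_const)
    have "(x, y) \<in> ?U" using a b by simp
    from open_prod_elim[OF U this] obtain V W where VW: "open V" "open W" "(x, y) \<in> V \<times> W" "V \<times> W \<subseteq> ?U" .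
    obtain r where r: "r > 0" "ball x r \<subseteq> V" by (rule openE[OF VW(1), of x]) (use VW in auto)
    obtain s where s: "s > 0" "ball y s \<subseteq> W" by (rule openE[OF VW(2), of y]) (use VW in auto)
    let ?B = "ball x r" and ?A = "ball y s"
    have pt: "p t w v < a" "b < p t v w" if "v \<in> ?B" "w \<in> ?A" for v w
      using VW(4) r s that by (auto simp: subset_iff)
    have a0: "a \<ge> 0" using a(1) p_nonneg[OF t, of y x] by simp
    let ?m = "emeasure M ?B * emeasure M ?A"
    have const: "(\<integral>\<^sup>+ v. \<integral>\<^sup>+ w. ennreal c * (indicator ?B v * indicator ?A w) \<partial>M \<partial>M) = ennreal c * ?m" for c
      by (simp add: nn_integral_cmult mult.assoc nn_integral_multc)
    have "ennreal b * ?m \<le> (\<integral>\<^sup>+ v. \<integral>\<^sup>+ w. ennreal (p t v w) * (indicator ?B v * indicator ?A w) \<partial>M \<partial>M)"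
      unfolding const[symmetric]
    proof (intro nn_integral_mono)
      fix v w
      show "ennreal b * (indicator ?B v * indicator ?A w) \<le> ennreal (p t v w) * (indicator ?B v * indicator ?A w)"
        using ennreal_leI[OF less_imp_le[OF pt(2)], of v w] by (cases "v \<in> ?B \<and> w \<in> ?A") auto
    qed
    also have "\<dots> = ennreal (L2_inner M (heat t (indicator ?A)) (indicator ?B))"
      by (rule kernel_op_indicator_pair[OF t, symmetric]) (use ball_finite in auto)
    also have "L2_inner M (heat t (indicator ?A)) (indicator ?B) = L2_inner M (indicator ?A) (heat t (indicator ?B))"
      by (rule sym) (use ball_finite in auto)
    also have "\<dots> = L2_inner M (heat t (indicator ?B)) (indicator ?A)" by (rule L2_inner_commute)
    also have "ennreal \<dots> = (\<integral>\<^sup>+ w. \<integral>\<^sup>+ v. ennreal (p t w v) * (indicator ?A w * indicator ?B v) \<partial>M \<partial>M)"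
      by (rule kernel_op_indicator_pair[OF t]) (use ball_finite in auto)
    also have "\<dots> = (\<integral>\<^sup>+ v. \<integral>\<^sup>+ w. ennreal (p t w v) * (indicator ?A w * indicator ?B v) \<partial>M \<partial>M)"
      by (rule Fubini') measurable
    also have "\<dots> \<le> ennreal a * ?m"
      unfolding const[symmetric]
    proof (intro nn_integral_mono)
      fix v w
      show "ennreal (p t w v) * (indicator ?A w * indicator ?B v) \<le> ennreal a * (indicator ?B v * indicator ?A w)"
        using ennreal_leI[OF less_imp_le[OF pt(1)], of v w] by (cases "v \<in> ?B \<and> w \<in> ?A") auto
    qed
    finally have "ennreal b * ?m \<le> ennreal a * ?m" .
    moreover have "?m \<noteq> 0" "?m \<noteq> top"
      using ball_pos[OF r(1), of x] ball_pos[OF s(1), of y] ball_finite[of x r] ball_finite[of y s]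
      by (auto simp: ennreal_mult_eq_top_iff)
    moreover have "ennreal a < ennreal b" using a0 b by (simp add: ennreal_lessI)
    ultimately show False using ennreal_mult_strict_right_mono[of "ennreal a" "ennreal b" ?m]
      by (simp add: less_top zero_less_iff_neq_zero leD)
  qed
  show ?thesis using le[of x y] le[of y x] by simp
qed

end

text \<open>Turns the data of the form into pointwise facts. Kernel bounds and symmetry become
  pointwise by joint continuity of the kernel; the semigroup law does because \<open>wBE\<close>
  makes the heat flow of bounded functions Hoelder continuous.\<close>

lemma (in sub_Gaussian_Dirichlet_space) heat_kernel_space_exists:
  assumes wBE: "wBE M p d_W \<kappa>"
  shows "\<exists>c1 c2 cl cu cw. heat_kernel_space M d_H c1 c2 p d_W \<kappa> cl cu cw"
proof -
  have \<kappa>: "0 < \<kappa>" "\<kappa> < d_W" using wBE unfolding wBE_def by auto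
  have sets: "sets M = sets borel" using Radon unfolding Radon_measure_def by simp
  obtain c1 c2 where c: "d_H > 0" "c1 > 0" "c2 > 0"
    "\<And>x r. r \<ge> 0 \<Longrightarrow> ennreal (c1 * r powr d_H) \<le> emeasure M (ball x r)"
    "\<And>x r. r \<ge> 0 \<Longrightarrow> emeasure M (ball x r) \<le> ennreal (c2 * r powr d_H)"
    using Ahlfors unfolding Ahlfors_regular_def by blast
  interpret A: ahlfors_space M d_H c1 c2
    by unfold_locales (use sets compact_balls c in auto)
  obtain c3 c4 c5 c6 where k: "c3 > 0" "c4 > 0" "c5 > 0" "c6 > 0"
    "AE z in M \<Otimes>\<^sub>M M. \<forall>t>0. c5 * sub_Gaussian d_H d_W c6 t (fst z) (snd z) \<le> p t (fst z) (snd z) \<and>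
         p t (fst z) (snd z) \<le> c3 * sub_Gaussian d_H d_W c4 t (fst z) (snd z)"
    using kernel_bounds unfolding case_prod_beta by blast
  have pcont: "continuous_on UNIV (\<lambda>z. p t (fst z) (snd z))" if "t > 0" for t
    using kernel_continuous[OF that] by (simp add: case_prod_beta)
  have gcont: "continuous_on UNIV (\<lambda>z :: 'a \<times> 'a. sub_Gaussian d_H d_W c t (fst z) (snd z))" if "t > 0" for t c
    using continuous_sub_Gaussian[OF that, of d_W d_H c] d_W_gt_2 by (simp add: case_prod_beta)
  have everywhere: "f x y \<le> g x y"
    if "continuous_on UNIV (\<lambda>z. f (fst z) (snd z))" "continuous_on UNIV (\<lambda>z. g (fst z) (snd z))"
      and ae: "AE z in M \<Otimes>\<^sub>M M. f (fst z) (snd z) \<le> g (fst z) (snd z)" for f g :: "'a \<Rightarrow> 'a \<Rightarrow> real" and x y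
  proof -
    have "AE z in M \<Otimes>\<^sub>M M. 0 \<le> g (fst z) (snd z) - f (fst z) (snd z)" using ae by eventually_elim simp
    from A.continuous_AE_nonneg_pair[OF continuous_on_diff[OF that(2,1)] this, of "(x, y)"] show ?thesis by simp
  qed
  have lower: "c5 * sub_Gaussian d_H d_W c6 t x y \<le> p t x y"
    and upper: "p t x y \<le> c3 * sub_Gaussian d_H d_W c4 t x y" if t: "t > 0" for t x y
  proof -
    have ae: "AE z in M \<Otimes>\<^sub>M M. c5 * sub_Gaussian d_H d_W c6 t (fst z) (snd z) \<le> p t (fst z) (snd z)"
      "AE z in M \<Otimes>\<^sub>M M. p t (fst z) (snd z) \<le> c3 * sub_Gaussian d_H d_W c4 t (fst z) (snd z)"
      using k(5) by (eventually_elim, use t in simp)+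
    note scaled = continuous_on_mult[OF continuous_on_const gcont[OF t]]
    show "c5 * sub_Gaussian d_H d_W c6 t x y \<le> p t x y"
      by (rule everywhere[of "\<lambda>x y. c5 * sub_Gaussian d_H d_W c6 t x y", OF scaled pcont[OF t] ae(1)])
    show "p t x y \<le> c3 * sub_Gaussian d_H d_W c4 t x y"
      by (rule everywhere[of _ "\<lambda>x y. c3 * sub_Gaussian d_H d_W c4 t x y", OF pcont[OF t] scaled ae(2)])
  qed
  obtain Ce where Ce: "Ce > 0" "\<And>u. u \<ge> 0 \<Longrightarrow> exp (- c4 * u powr (d_W / (d_W - 1))) \<le> Ce * (1 + u) powr (- (d_W + d_H + 1))"
    using exp_powr_decay[of c4 "d_W / (d_W - 1)" "d_W + d_H + 1"] k d_W_gt_2 c by auto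
  \<comment> \<open>When the scaled distance is below 1, the exponential factor is at least
    \<open>exp (- c6)\<close>.\<close>
  define cl where "cl = c5 * exp (- c6)"
  define cu where "cu = c3 * Ce"
  interpret K: kernel_space M d_H c1 c2 p d_W \<kappa> cl cu
  proof unfold_locales
    show "0 < \<kappa>" "\<kappa> < d_W" by (rule \<kappa>)+
    show "0 < cl" "0 < cu" unfolding cl_def cu_def using k Ce by auto
    show "(\<lambda>z. p t (fst z) (snd z)) \<in> borel_measurable (M \<Otimes>\<^sub>M M)" if "t > 0" for t
      by (rule A.continuous_pair_measurable[OF pcont[OF that]])
    show "0 \<le> p t x y" if "t > 0" for t x y
      using lower[OF that, of x y] k(3) by (intro order_trans[OF _ lower[OF that]]) (simp add: sub_Gaussian_def)
    show "cl * t powr (- (d_H / d_W)) \<le> p t x y" if t: "t > 0" and d: "dist x y < t powr (1 / d_W)" for t x y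
    proof -
      have "dist x y / t powr (1 / d_W) \<le> 1" using t d by simp
      then have "(dist x y / t powr (1 / d_W)) powr (d_W / (d_W - 1)) \<le> 1"
        using d_W_gt_2 by (intro powr_le1) auto
      then have "exp (- c6) \<le> exp (- c6 * (dist x y powr d_W / t) powr (1 / (d_W - 1)))"
        using k(4) d_W_gt_2 by (subst sub_Gaussian_scaled[OF t]) (auto simp: mult_left_le)
      then have "c5 * (t powr (- (d_H / d_W)) * exp (- c6)) \<le> c5 * sub_Gaussian d_H d_W c6 t x y"
        unfolding sub_Gaussian_def using k(3) by (intro mult_left_mono) auto
      also have "\<dots> \<le> p t x y" by (rule lower[OF t])
      finally show ?thesis unfolding cl_def by (simp add: mult_ac)
    qed
    show "p t x y \<le> cu * t powr (- (d_H / d_W)) * (1 + dist x y / t powr (1 / d_W)) powr (- (d_W + d_H + 1))"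
      if t: "t > 0" for t x y
    proof -
      have "p t x y \<le> c3 * sub_Gaussian d_H d_W c4 t x y" by (rule upper[OF t])
      also have "\<dots> \<le> c3 * (t powr (- (d_H / d_W)) * (Ce * (1 + dist x y / t powr (1 / d_W)) powr (- (d_W + d_H + 1))))"
        unfolding sub_Gaussian_def using k(1) d_W_gt_2 t
        by (intro mult_left_mono) (auto simp only: sub_Gaussian_scaled[OF t] intro!: Ce(2), auto)
      finally show ?thesis unfolding cu_def by (simp add: mult_ac)
    qed
  qed
  obtain P where P: "heat_semigroup M \<E> \<F> P" and
    Pk: "\<And>t g. t > 0 \<Longrightarrow> g \<in> L2 M \<Longrightarrow> AE x in M. integrable M (\<lambda>y. p t x y * g y) \<and> P t g x = kernel_op M p t g x"
    using heat_kernel unfolding heat_kernel_def by blast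
  have S: "L2_contraction_semigroup M P" using P unfolding heat_semigroup_def by simp
  note PL2 = L2_contraction_semigroupD(1)[OF S]
  have Pk': "AE x in M. P t g x = kernel_op M p t g x" if "t > 0" "g \<in> L2 M" for t g
    using Pk[OF that] by eventually_elim simp
  have KL2: "kernel_op M p t g \<in> L2 M" if t: "t > 0" and g: "g \<in> L2 M" for t g
  proof -
    have m: "kernel_op M p t g \<in> borel_measurable M" using g by (intro K.kernel_op_measurable t) (simp add: L2_iff)
    have P2: "P t g \<in> borel_measurable M" "integrable M (\<lambda>x. P t g x * P t g x)" using PL2[of t g] t g by (auto simp: L2_iff)
    have "integrable M (\<lambda>x. kernel_op M p t g x * kernel_op M p t g x)"
      using P2(2) by (rule integrable_cong_AE_imp) (use m Pk'[OF t g] in auto)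
    then show ?thesis using m by (simp add: L2_iff)
  qed
  obtain cw where cw: "cw > 0" "\<And>t g B x y. t > 0 \<Longrightarrow> g \<in> borel_measurable M \<Longrightarrow> (\<And>z. \<bar>g z\<bar> \<le> B) \<Longrightarrow>
    \<bar>kernel_op M p t g x - kernel_op M p t g y\<bar> \<le> cw * (dist x y powr \<kappa> / t powr (\<kappa> / d_W)) * B"
    using wBE_bounded[OF wBE] by blast
  have cont: "continuous_on UNIV (kernel_op M p t g)" if t: "t > 0" and g: "g \<in> borel_measurable M" "\<And>z. \<bar>g z\<bar> \<le> B" for t g B
  proof (rule hoelder_continuous_on[OF _ \<kappa>(1)])
    show "\<bar>kernel_op M p t g x - kernel_op M p t g y\<bar> \<le> (cw * B / t powr (\<kappa> / d_W)) * dist x y powr \<kappa>" for x y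
      using cw(2)[OF t g, of x y] by (simp add: mult_ac)
  qed
  obtain C where C: "\<And>t x. t > 0 \<Longrightarrow> kernel_op M p t (\<lambda>_. 1) x \<le> C" using K.kernel_op_one_bounds by blast
  have "heat_kernel_space M d_H c1 c2 p d_W \<kappa> cl cu cw"
  proof unfold_locales
    show "cw > 0" by (rule cw)
    show "p t x y = p t y x" if t: "t > 0" for t x y
    proof (rule K.kernel_symmetric[OF t kernel_continuous[OF t]])
      fix A B assume AB: "A \<in> sets M" "B \<in> sets M" "emeasure M A < \<infinity>" "emeasure M B < \<infinity>"
      note iA = A.indicator_L2[OF AB(1,3)] and iB = A.indicator_L2[OF AB(2,4)]
      have "L2_inner M (kernel_op M p t (indicator A)) (indicator B) = L2_inner M (P t (indicator A)) (indicator B)"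
        using Pk'[OF t iA] by (intro L2_inner_cong_AE KL2 PL2 iA iB t less_imp_le[OF t]) auto
      also have "\<dots> = L2_inner M (indicator A) (P t (indicator B))"
        by (rule heat_semigroup_symmetric[OF P t iA iB])
      also have "\<dots> = L2_inner M (indicator A) (kernel_op M p t (indicator B))"
        using Pk'[OF t iB] by (intro L2_inner_cong_AE KL2 PL2 iA iB t less_imp_le[OF t]) auto
      finally show "L2_inner M (kernel_op M p t (indicator A)) (indicator B) = L2_inner M (indicator A) (kernel_op M p t (indicator B))" .
    qed
    show "kernel_op M p (s + t) (indicator A) x = kernel_op M p s (kernel_op M p t (indicator A)) x"
      if s: "s > 0" and t: "t > 0" and A: "A \<in> sets M" "emeasure M A < \<infinity>" for s t A x
    proof (rule A.continuous_AE_eq)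
      note iA = A.indicator_L2[OF A]
      have [measurable]: "(indicator A :: 'a \<Rightarrow> real) \<in> borel_measurable M" using A by simp
      have km: "kernel_op M p t (indicator A) \<in> borel_measurable M" by (intro K.kernel_op_measurable t) simp
      show "continuous_on UNIV (kernel_op M p (s + t) (indicator A))"
        by (rule cont[where B = 1]) (use s t in \<open>auto simp: indicator_def\<close>)
      show "continuous_on UNIV (kernel_op M p s (kernel_op M p t (indicator A)))"
      proof (rule cont[OF s km])
        show "\<bar>kernel_op M p t (indicator A) z\<bar> \<le> C" for z
          using K.kernel_op_indicator_range[OF t A(1), of z] C[OF t, of z] by simp
      qed
      have st: "s + t > 0" using s t by simp
      have add: "AE x in M. P (s + t) (indicator A) x = P s (P t (indicator A)) x"
        using s t iA by (intro L2_contraction_semigroupD(4)[OF S]) auto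
      \<comment> \<open>\<open>P t (indicator A)\<close> equals the kernel integral only almost
        everywhere; integrating it against \<open>p s x\<close> removes the exceptional set at every
        \<open>x\<close>.\<close>
      have comp: "kernel_op M p s (P t (indicator A)) x = kernel_op M p s (kernel_op M p t (indicator A)) x" for x
      proof -
        note [measurable] = K.p_measurable[OF s] km
        have [measurable]: "P t (indicator A) \<in> borel_measurable M" using PL2[of t "indicator A"] t iA by (simp add: L2_iff)
        show ?thesis unfolding kernel_op_def[of M p s]
          using Pk'[OF t iA] by (intro integral_cong_AE) (measurable, auto)
      qed
      show "AE x in M. kernel_op M p (s + t) (indicator A) x = kernel_op M p s (kernel_op M p t (indicator A)) x"
        using add Pk'[OF st iA] Pk'[OF s PL2[OF less_imp_le[OF t] iA]] by eventually_elim (simp add: comp)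
    qed
    show "\<bar>kernel_op M p t g x - kernel_op M p t g y\<bar> \<le> cw * (dist x y powr \<kappa> / t powr (\<kappa> / d_W))"
      if t: "t > 0" and g: "g \<in> borel_measurable M" "\<And>z. 0 \<le> g z \<and> g z \<le> 1" for t g x y
      using cw(2)[OF t g(1), of 1 x y] g(2) by (simp add: abs_le_iff order_trans[OF _ g(2)[THEN conjunct1]])
    show "((\<lambda>t. \<integral>x. indicator A x * (1 - kernel_op M p t (indicator A) x) \<partial>M) \<longlongrightarrow> 0) (at_right 0)"
      if A: "A \<in> sets M" "emeasure M A < \<infinity>" for A
    proof -
      note iA = A.indicator_L2[OF A]
      \<comment> \<open>The loss is minus the inner product of the increment of the semigroup with
        the indicator, so Cauchy-Schwarz reduces the claim to strong continuity in L2.\<close>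
      let ?n = "\<lambda>t. Lp_norm M 2 (\<lambda>x. P t (indicator A) x - indicator A x) * Lp_norm M 2 (indicator A)"
      have "((\<lambda>t. Lp_norm M 2 (\<lambda>x. P t (indicator A) x - indicator A x)) \<longlongrightarrow> 0) (at_right 0)"
        using S iA unfolding L2_contraction_semigroup_def by blast
      then have n0: "(?n \<longlongrightarrow> 0) (at_right 0)" by (rule tendsto_mult_left_zero)
      show ?thesis
      proof (rule Lim_null_comparison[OF _ n0])
        show "\<forall>\<^sub>F t in at_right 0. norm (\<integral>x. indicator A x * (1 - kernel_op M p t (indicator A) x) \<partial>M) \<le> ?n t"
          using eventually_at_right_less[of "0::real"]
        proof eventually_elim
          case (elim t)
          have L: "(\<lambda>x. P t (indicator A) x - indicator A x) \<in> L2 M" using elim by (intro L2_diff PL2 iA) auto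
          have L': "(\<lambda>x. kernel_op M p t (indicator A) x - indicator A x) \<in> L2 M" using elim by (intro L2_diff KL2 iA) auto
          have "(\<integral>x. indicator A x * (1 - kernel_op M p t (indicator A) x) \<partial>M)
            = (\<integral>x. - ((kernel_op M p t (indicator A) x - indicator A x) * indicator A x) \<partial>M)"
            by (intro Bochner_Integration.integral_cong refl) (auto simp: indicator_def)
          also have "\<dots> = - L2_inner M (\<lambda>x. kernel_op M p t (indicator A) x - indicator A x) (indicator A)"
            unfolding L2_inner_def by simp
          also have "L2_inner M (\<lambda>x. kernel_op M p t (indicator A) x - indicator A x) (indicator A)
            = L2_inner M (\<lambda>x. P t (indicator A) x - indicator A x) (indicator A)"
            using Pk'[OF elim iA] by (intro L2_inner_cong_AE L L' iA) auto
          finally show ?case using L2_Cauchy_Schwarz[OF L iA] by simp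
        qed
      qed
    qed
  qed
  then show ?thesis by blast
qed

theorem theorem4p18:
  fixes M :: "'a::metric_space measure"
    and \<E> :: "('a \<Rightarrow> real) \<Rightarrow> ('a \<Rightarrow> real) \<Rightarrow> real"
    and \<F> :: "('a \<Rightarrow> real) set"
    and p :: "real \<Rightarrow> 'a \<Rightarrow> 'a \<Rightarrow> real"
    and d_H d_W \<kappa> one_star :: real
  assumes "sub_Gaussian_Dirichlet_space M \<E> \<F> p d_H d_W"
    and "wBE M p d_W \<kappa>"
    and "ereal \<kappa> = ereal d_W - lambda1_sharp M"
    and "d_W - \<kappa> < d_H"
    and "1 / one_star = 1 - (d_W - \<kappa>) / d_H"
  shows "BV M \<subseteq> Lp_space M one_star \<and>
    (\<exists>C::real. C > 0 \<and> (\<forall>f\<in>BV M. ennreal (Lp_norm M one_star f) \<le> ennreal C * Var M f)) \<and>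
    (\<exists>C::real. C > 0 \<and> (\<forall>A. finite_perimeter M A \<longrightarrow>
       ennreal (measure M A powr ((d_H - d_W + \<kappa>) / d_H)) \<le> ennreal C * perimeter M A))"
proof -
  interpret sub_Gaussian_Dirichlet_space M \<E> \<F> p d_H d_W by (rule assms(1))
  obtain c1 c2 cl cu cw where H: "heat_kernel_space M d_H c1 c2 p d_W \<kappa> cl cu cw"
    using heat_kernel_space_exists[OF assms(2)] by blast
  interpret H: heat_kernel_space M d_H c1 c2 p d_W \<kappa> cl cu cw by (rule H)
  \<comment> \<open>Equality with the real number \<open>\<kappa>\<close> excludes an infinite
    critical exponent, so the coercion in \<open>BV\<close> and \<open>Var\<close> returns its
    actual value.\<close>
  have lam: "real_of_ereal (lambda1_sharp M) = d_W - \<kappa>"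
    using assms(3) by (cases "lambda1_sharp M") auto
  have BV: "BV M = KS M (d_W - \<kappa>)" unfolding BV_def lam ..
  have Var: "Var M f = Liminf (at_right 0) (KS_energy M (d_W - \<kappa>) f)" for f unfolding Var_def lam ..
  define q where "q = one_star"
  have q: "1 / q = (d_H - d_W + \<kappa>) / d_H" unfolding q_def assms(5) using H.dH_pos by (simp add: field_simps)
  have q0: "q > 0"
  proof -
    have "1 / q > 0" unfolding q using assms(4) H.dH_pos by (intro divide_pos_pos) auto
    then show ?thesis by simp
  qed
  obtain C where C: "C > 0" "\<And>f. f \<in> KS M (d_W - \<kappa>) \<Longrightarrow> \<exists>v\<ge>0.
    Liminf (at_right 0) (KS_energy M (d_W - \<kappa>) f) = ennreal v \<and>
    (\<integral>\<^sup>+ x. ennreal (\<bar>f x\<bar> powr q) \<partial>M) \<le> ennreal (q * (C * v) powr q)"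
    using H.sobolev[OF assms(4,5)] unfolding q_def by blast
  \<comment> \<open>The factor \<open>q powr (1 / q)\<close> is the \<open>q\<close>-th root of the
    \<open>q\<close> left by the layer estimate.\<close>
  define D where "D = q powr (1 / q) * C"
  have D: "D > 0" unfolding D_def using q0 C by simp
  have main: "f \<in> Lp_space M q \<and> ennreal (Lp_norm M q f) \<le> ennreal D * Var M f" if f: "f \<in> BV M" for f
  proof -
    obtain v where v: "v \<ge> 0" "Var M f = ennreal v" "(\<integral>\<^sup>+ x. ennreal (\<bar>f x\<bar> powr q) \<partial>M) \<le> ennreal (q * (C * v) powr q)"
      using C(2) f unfolding BV Var by blast
    have [measurable]: "f \<in> borel_measurable M" using f unfolding BV KS_def Lp_space_def by simp
    have int: "integrable M (\<lambda>x. \<bar>f x\<bar> powr q)"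
    proof (rule integrableI_bounded)
      show "(\<integral>\<^sup>+ x. ennreal (norm (\<bar>f x\<bar> powr q)) \<partial>M) < \<infinity>"
        using le_less_trans[OF v(3) ennreal_less_top] by simp
    qed measurable
    have "ennreal (\<integral>x. \<bar>f x\<bar> powr q \<partial>M) \<le> ennreal (q * (C * v) powr q)"
      using v(3) int by (subst (asm) nn_integral_eq_integral) auto
    then have "(\<integral>x. \<bar>f x\<bar> powr q \<partial>M) \<le> q * (C * v) powr q" using q0 by (subst (asm) ennreal_le_iff) auto
    then have "Lp_norm M q f \<le> (q * (C * v) powr q) powr (1 / q)"
      unfolding Lp_norm_def using q0 by (intro powr_mono2) auto
    also have "\<dots> = D * v" unfolding D_def using q0 C(1) v(1) by (simp add: powr_mult powr_powr)
    finally have "ennreal (Lp_norm M q f) \<le> ennreal (D * v)" by (rule ennreal_leI)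
    also have "\<dots> = ennreal D * Var M f" unfolding v(2) using D v(1) by (simp add: ennreal_mult)
    finally show ?thesis using int unfolding Lp_space_def by simp
  qed
  have set: "ennreal (measure M A powr ((d_H - d_W + \<kappa>) / d_H)) \<le> ennreal D * perimeter M A"
    if A: "finite_perimeter M A" for A
  proof -
    have m: "A \<in> sets M" and bv: "indicator A \<in> BV M"
      using A H.sets_M unfolding finite_perimeter_def by auto
    have "(\<integral>x. \<bar>indicator A x :: real\<bar> powr q \<partial>M) = (\<integral>x. indicator A x \<partial>M)"
      by (intro Bochner_Integration.integral_cong refl) (auto simp: indicator_def)
    also have "\<dots> = measure M A" using m by simp
    finally have "Lp_norm M q (indicator A) = measure M A powr ((d_H - d_W + \<kappa>) / d_H)"
      unfolding Lp_norm_def q by simp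
    then show ?thesis using main[OF bv] unfolding perimeter_def by simp
  qed
  show ?thesis using main set D unfolding q_def by blast
qed

end
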